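(* Let $p>1$ and let $\phi$ be a finite energy solution to the defocusing semilinear wave equation $$-\partial_t^2\phi+\partial_x^2\phi=|\phi|^{p-1}\phi\quad\text{in }\mathbb{R}^{1+1},\qquad \phi(0,x)=\phi_0(x),\qquad \partial_t\phi(0,x)=\phi_1(x).$$ Then for every fixed $R>0$, $$\lim_{T\to+\infty}\frac1T\int_0^T\int_{|x|\le t+R}|\phi(t,x)|^{p+1}\,dx\,dt=0 .$$
   Context: The energy is $\mathcal{E}_0[\phi]=\int_{\mathbb{R}}\big(|\partial_x\phi_0|^2+|\phi_1|^2+\frac{2}{p+1}|\phi_0|^{p+1}\big)dx$. Functions are real-valued. A finite energy solution is a solution with $\mathcal{E}_0[\phi]<\infty$, understood in the energy space: $\phi$ is a continuous function of $(t,x)\in\mathbb{R}\times\mathbb{R}$ with $\phi\in C_t L_x^{p+1}(\mathbb{R})$, $\partial_x\phi,\partial_t\phi\in C_tL_x^2(\mathbb{R})$, solving the equation in the sense of distributions and attaining the initial data at $t=0$. *)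

theory Defs
  imports "HOL-Analysis.Analysis"
begin

section \<open>Distributional derivatives\<close>

text \<open>\<open>frechet_derivative\<close> is unspecified at points of non-differentiability; below it is only
  applied to functions that are required to be differentiable.\<close>

definition dir_deriv :: "'a::euclidean_space \<Rightarrow> ('a \<Rightarrow> real) \<Rightarrow> 'a \<Rightarrow> real" where
  "dir_deriv b f z = frechet_derivative f (at z) b"

primrec C_k :: "nat \<Rightarrow> ('a::euclidean_space \<Rightarrow> real) \<Rightarrow> bool" where
  "C_k 0 f \<longleftrightarrow> continuous_on UNIV f"
| "C_k (Suc n) f \<longleftrightarrow> (\<forall>z. f differentiable at z) \<and> (\<forall>b\<in>Basis. C_k n (dir_deriv b f))"

definition test_function :: "('a::euclidean_space \<Rightarrow> real) \<Rightarrow> bool" where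
  "test_function \<psi> \<longleftrightarrow> (\<forall>n. C_k n \<psi>) \<and> compact (closure {z. \<psi> z \<noteq> 0})"

definition locally_integrable :: "('a::euclidean_space \<Rightarrow> real) \<Rightarrow> bool" where
  "locally_integrable f \<longleftrightarrow> (\<forall>K. compact K \<longrightarrow> set_integrable lborel K f)"

definition has_weak_deriv :: "'a::euclidean_space \<Rightarrow> ('a \<Rightarrow> real) \<Rightarrow> ('a \<Rightarrow> real) \<Rightarrow> bool" where
  "has_weak_deriv b u v \<longleftrightarrow> locally_integrable u \<and> locally_integrable v \<and>
     (\<forall>\<psi>. test_function \<psi> \<longrightarrow>
        (LINT z|lborel. u z * dir_deriv b \<psi> z) = - (LINT z|lborel. v z * \<psi> z))"

section \<open>Curves in Lebesgue spaces\<close>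

definition in_Lp :: "real \<Rightarrow> (real \<Rightarrow> real) \<Rightarrow> bool" where
  "in_Lp q f \<longleftrightarrow> f \<in> borel_measurable borel \<and> integrable lborel (\<lambda>x. \<bar>f x\<bar> powr q)"

definition Lp_norm :: "real \<Rightarrow> (real \<Rightarrow> real) \<Rightarrow> real" where
  "Lp_norm q f = (LINT x|lborel. \<bar>f x\<bar> powr q) powr (1 / q)"

definition C_t_Lp :: "real \<Rightarrow> (real \<times> real \<Rightarrow> real) \<Rightarrow> bool" where
  "C_t_Lp q u \<longleftrightarrow> (\<forall>t. in_Lp q (\<lambda>x. u (t, x))) \<and>
     (\<forall>t0. ((\<lambda>t. Lp_norm q (\<lambda>x. u (t, x) - u (t0, x))) \<longlongrightarrow> 0) (at t0))"

section \<open>The defocusing semilinear wave equation\<close>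

text \<open>Points of space-time are pairs \<open>(t, x)\<close>, so \<open>(1, 0)\<close> is the time direction and
  \<open>(0, 1)\<close> the space direction.\<close>

definition distributional_solution :: "real \<Rightarrow> (real \<times> real \<Rightarrow> real) \<Rightarrow> bool" where
  "distributional_solution p \<phi> \<longleftrightarrow>
     (\<forall>\<psi>. test_function \<psi> \<longrightarrow>
        (LINT z|lborel. \<phi> z * (- dir_deriv (1, 0) (dir_deriv (1, 0) \<psi>) z
                              + dir_deriv (0, 1) (dir_deriv (0, 1) \<psi>) z))
        = (LINT z|lborel. \<bar>\<phi> z\<bar> powr (p - 1) * \<phi> z * \<psi> z))"

text \<open>The second argument stands for the weak derivative of \<open>\<phi>0\<close>, which is unique only
  up to a null set and is therefore passed explicitly.\<close>

definition energy ::
    "real \<Rightarrow> (real \<Rightarrow> real) \<Rightarrow> (real \<Rightarrow> real) \<Rightarrow> (real \<Rightarrow> real) \<Rightarrow> ennreal" where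
  "energy p d\<phi>0 \<phi>0 \<phi>1 =
     (\<integral>\<^sup>+x. ennreal (\<bar>d\<phi>0 x\<bar>\<^sup>2 + \<bar>\<phi>1 x\<bar>\<^sup>2 + 2 / (p + 1) * \<bar>\<phi>0 x\<bar> powr (p + 1)) \<partial>lborel)"

definition finite_energy_data :: "real \<Rightarrow> (real \<Rightarrow> real) \<Rightarrow> (real \<Rightarrow> real) \<Rightarrow> bool" where
  "finite_energy_data p \<phi>0 \<phi>1 \<longleftrightarrow>
     \<phi>0 \<in> borel_measurable borel \<and> \<phi>1 \<in> borel_measurable borel \<and>
     (\<exists>d\<phi>0 \<in> borel_measurable borel.
        has_weak_deriv 1 \<phi>0 d\<phi>0 \<and> energy p d\<phi>0 \<phi>0 \<phi>1 < \<infinity>)"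

text \<open>The weak derivatives \<open>\<phi>\<^sub>t\<close> and \<open>\<phi>\<^sub>x\<close> are determined, as continuous curves in
  \<open>L\<^sup>2\<close>, by \<open>\<phi>\<close>. Hence the trace of \<open>\<phi>\<^sub>t\<close> at time zero is well defined as an element of \<open>L\<^sup>2\<close>,
  and the data are attained in the almost-everywhere sense.\<close>

definition finite_energy_solution ::
    "real \<Rightarrow> (real \<times> real \<Rightarrow> real) \<Rightarrow> (real \<Rightarrow> real) \<Rightarrow> (real \<Rightarrow> real) \<Rightarrow> bool" where
  "finite_energy_solution p \<phi> \<phi>0 \<phi>1 \<longleftrightarrow>
     finite_energy_data p \<phi>0 \<phi>1 \<and>
     continuous_on UNIV \<phi> \<and> C_t_Lp (p + 1) \<phi> \<and>
     distributional_solution p \<phi> \<and>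
     (AE x in lborel. \<phi> (0, x) = \<phi>0 x) \<and>
     (\<exists>\<phi>\<^sub>t \<phi>\<^sub>x. has_weak_deriv (1, 0) \<phi> \<phi>\<^sub>t \<and> has_weak_deriv (0, 1) \<phi> \<phi>\<^sub>x \<and>
        C_t_Lp 2 \<phi>\<^sub>t \<and> C_t_Lp 2 \<phi>\<^sub>x \<and>
        (AE x in lborel. \<phi>\<^sub>t (0, x) = \<phi>1 x))"

end

theory Submission
  imports Defs
begin

text \<open>In the null coordinates \<open>u = t - x\<close>, \<open>v = t + x\<close> the equation reads
  \<open>\<theta>\<^sub>u\<^sub>v = - N(\<theta>) / 4\<close> with \<open>N(s) = \<bar>s\<bar>\<^bsup>p-1\<^esup> s\<close>. Testing with products shows that \<open>\<theta>\<close> has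
  densities \<open>\<theta>\<^sub>u\<close>, \<open>\<theta>\<^sub>v\<close> that are differentiable in the other variable, which makes the
  multiplier identities rigorous: with \<open>V = \<bar>\<theta>\<bar>\<^bsup>p+1\<^esup> / (p + 1)\<close>,
  \<open>(\<theta>\<^sub>u\<^sup>2)\<^sub>v + (V/2)\<^sub>u = 0\<close>, \<open>(\<theta>\<^sub>v\<^sup>2)\<^sub>u + (V/2)\<^sub>v = 0\<close> and
  \<open>(\<theta>\<^sup>2)\<^sub>u\<^sub>v = 2 \<theta>\<^sub>u \<theta>\<^sub>v - (p + 1) V / 2\<close>. The first two are the conservation laws of energy and
  momentum. They say that \<open>\<theta>\<^sub>v\<^sup>2\<close>, \<open>\<theta>\<^sub>u\<^sup>2\<close>, \<open>- V/2\<close> are the second derivatives of a function with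
  bounded gradient, which the third identity makes convex in time-like directions up to the
  mixed derivative of \<open>\<theta>\<^sup>2\<close>. Integrating its convexity along the rays \<open>x = s t\<close> amounts to a multiplier that is
  homogeneous of degree zero and yields
  \<open>\<integral>\<integral> V K < \<infinity>\<close> with \<open>K = 32 u\<^sup>2 v\<^sup>2 / (u + v)\<^sup>5\<close>, a weight comparable to \<open>1/t\<close> inside the cone;
  hence the potential energy in \<open>u, v \<ge> \<delta> T\<close>, \<open>t \<le> T\<close> is \<open>o(T)\<close>.
  In the remaining strips \<open>u \<le> \<delta> T\<close> and \<open>v \<le> \<delta> T\<close>
  the flux through null lines bounds it by \<open>C (\<delta> T + R)\<close>, and \<open>\<delta>\<close> is arbitrary.\<close>

section \<open>Smooth test functions\<close>

text \<open>The obstacle is regularity. The density \<theta>_u is only locally square integrable and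
  cannot be differentiated in u, and \<theta> need not be square integrable in x. Hence every
  identity differentiates \<theta>_u in v only, and functions of \<theta> alone in u, each term
  being integrated along its own family of null lines. The mixed derivative of \<theta>^2 is
  integrated by parts only once; it leaves K_v \<theta> \<theta>_u, where all that is known is
  \<theta>^2 <= 1 + (p + 1) V. So K has to vanish outside the forward cone, whose time slices have
  length 2t: then the constant 1 is affordable, since K_v = O(1/t^2) and Young's inequality with
  ratio sqrt t leaves weights of order t^(-3/2), which are integrable in time. The squares in u^2
  v^2 make K continuously differentiable across the boundary of the cone. Degree zero keeps the
  multiplier bounded, so that the terms at both ends of the time interval are controlled by the
  energy uniformly in T. The square completed in the bulk is that of u \<theta>_u - v \<theta>_v,
  the derivative along Lorentz boosts; V keeps the coefficient (p - 1) / 2, positive as p > 1. The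
  factor 32 = 2^5 makes K = 1/t on the axis u = v.\<close>

text \<open>No Leibniz rule for higher derivatives is needed: a set of functions generated in this way
  is closed under differentiation by induction, hence consists of smooth functions.\<close>

inductive_set smooth_fun :: "(real \<Rightarrow> real) set" where
  flat: "(\<lambda>x. if x \<le> 0 then 0 else inverse x ^ k * exp (- inverse x)) \<in> smooth_fun"
| const: "(\<lambda>x. c) \<in> smooth_fun"
| add: "f \<in> smooth_fun \<Longrightarrow> g \<in> smooth_fun \<Longrightarrow> (\<lambda>x. f x + g x) \<in> smooth_fun"
| mult: "f \<in> smooth_fun \<Longrightarrow> g \<in> smooth_fun \<Longrightarrow> (\<lambda>x. f x * g x) \<in> smooth_fun"
| affine: "f \<in> smooth_fun \<Longrightarrow> (\<lambda>x. f (a * x + b)) \<in> smooth_fun"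
| antideriv: "f \<in> smooth_fun \<Longrightarrow> (\<forall>x. (F has_real_derivative f x) (at x)) \<Longrightarrow> F \<in> smooth_fun"

lemmas smooth_intros = smooth_fun.flat smooth_fun.const smooth_fun.add smooth_fun.mult smooth_fun.affine

text \<open>Differentiation raises the exponent of \<open>inverse x\<close> by one or by two. The
  family over all exponents is therefore closed under differentiation, whereas exp(-1/x) alone is
  not.\<close>

lemma flat_has_derivative:
  defines "e \<equiv> \<lambda>k x::real. if x \<le> 0 then 0 else inverse x ^ k * exp (- inverse x)"
  shows "(e k has_real_derivative (- real k) * e (Suc k) x + e (k + 2) x) (at x)"
proof -
  consider "x < 0" | "x = 0" | "x > 0" by linarith
  then show ?thesis
  proof cases
    case 1
    have "((\<lambda>x. 0) has_real_derivative 0) (at x)" by simp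
    then have "(e k has_real_derivative 0) (at x)"
      by (rule has_field_derivative_transform_within_open[where S = "{..<0}"]) (use 1 in \<open>auto simp: e_def\<close>)
    then show ?thesis using 1 by (simp add: e_def)
  next
    case 3
    have pw: "((\<lambda>x. inverse x ^ j) has_real_derivative - real j * inverse x ^ Suc j) (at x)" for j
    proof (induction j)
      case (Suc j)
      have "((\<lambda>x. inverse x * inverse x ^ j) has_real_derivative
          - (inverse x * inverse x) * inverse x ^ j + (- real j * inverse x ^ Suc j) * inverse x) (at x)"
        by (rule DERIV_mult[OF _ Suc]) (use 3 in \<open>auto intro!: derivative_eq_intros\<close>)
      then show ?case by (simp add: algebra_simps)
    qed simp
    have "((\<lambda>x. inverse x ^ k * exp (- inverse x)) has_real_derivative
        ((- real k) * (inverse x ^ Suc k * exp (- inverse x)) + inverse x ^ (k + 2) * exp (- inverse x))) (at x)"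
      by (rule DERIV_cong[OF DERIV_mult[OF pw]]) (use 3 in \<open>auto intro!: derivative_eq_intros simp: power2_eq_square algebra_simps\<close>)
    then have "(e k has_real_derivative ((- real k) * (inverse x ^ Suc k * exp (- inverse x)) + inverse x ^ (k + 2) * exp (- inverse x))) (at x)"
      by (rule has_field_derivative_transform_within_open[where S = "{0<..}"]) (use 3 in \<open>auto simp: e_def\<close>)
    then show ?thesis using 3 by (simp add: e_def)
  next
    case 2
    have l: "((\<lambda>y. (e k y - e k 0) / (y - 0)) \<longlongrightarrow> 0) (at_left 0)"
    proof (rule Lim_transform_eventually[of "\<lambda>_. 0"])
      show "\<forall>\<^sub>F y in at_left 0. 0 = (e k y - e k 0) / (y - 0)"
        by (rule eventually_mono[OF eventually_at_left_real[of "-1" 0]]) (auto simp: e_def)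
    qed simp
    \<comment> \<open>The right difference quotient at 0 with increment h is this function at 1/h,
      so the decay at infinity gives the limit.\<close>
    have "((\<lambda>y::real. y ^ Suc k / exp y) \<longlongrightarrow> 0) at_top"
      by (rule tendsto_power_div_exp_0)
    then have "((\<lambda>y. inverse y ^ Suc k / exp (inverse y)) \<longlongrightarrow> 0) (at_right (0::real))"
      by (rule filterlim_compose[OF _ filterlim_inverse_at_top_right])
    then have r: "((\<lambda>y. (e k y - e k 0) / (y - 0)) \<longlongrightarrow> 0) (at_right 0)"
    proof (rule Lim_transform_eventually)
      show "\<forall>\<^sub>F y in at_right 0. inverse y ^ Suc k / exp (inverse y) = (e k y - e k 0) / (y - 0)"
        by (rule eventually_mono[OF eventually_at_right_real[of 0 1]])
          (auto simp: e_def exp_minus field_simps)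
    qed
    show ?thesis
      using l r 2 by (auto simp: DERIV_def has_field_derivative_iff filterlim_at_split e_def)
  qed
qed

lemma smooth_fun_has_derivative:
  assumes "f \<in> smooth_fun"
  shows "\<exists>f'\<in>smooth_fun. \<forall>x. (f has_real_derivative f' x) (at x)"
  using assms
proof induction
  case (flat k)
  show ?case
  proof (rule bexI)
    show "\<forall>x. ((\<lambda>x. if x \<le> 0 then 0 else inverse x ^ k * exp (- inverse x)) has_real_derivative
        (- real k) * (if x \<le> 0 then 0 else inverse x ^ Suc k * exp (- inverse x))
        + (if x \<le> 0 then 0 else inverse x ^ (k + 2) * exp (- inverse x))) (at x)"
      using flat_has_derivative by blast
  qed (intro smooth_intros)
next
  case (const c)
  show ?case by (rule bexI[of _ "\<lambda>x. 0"]) (auto intro: smooth_fun.const)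
next
  case (add f g)
  then obtain f' g' where "f' \<in> smooth_fun" "\<forall>x. (f has_real_derivative f' x) (at x)"
     "g' \<in> smooth_fun" "\<forall>x. (g has_real_derivative g' x) (at x)" by blast
  then show ?case
    by (intro bexI[of _ "\<lambda>x. f' x + g' x"]) (auto intro: smooth_fun.add DERIV_add)
next
  case (mult f g)
  then obtain f' g' where "f' \<in> smooth_fun" "\<forall>x. (f has_real_derivative f' x) (at x)"
     "g' \<in> smooth_fun" "\<forall>x. (g has_real_derivative g' x) (at x)" by blast
  with mult show ?case
    by (intro bexI[of _ "\<lambda>x. f' x * g x + g' x * f x"]) (auto intro: smooth_intros DERIV_mult)
next
  case (affine f a b)
  then obtain f' where f': "f' \<in> smooth_fun" "\<forall>x. (f has_real_derivative f' x) (at x)" by blast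
  have "((\<lambda>x. f (a * x + b)) has_real_derivative f' (a * x + b) * a) (at x)" for x
    by (rule DERIV_chain2[OF f'(2)[rule_format]]) (auto intro!: derivative_eq_intros)
  with f' show ?case
    by (intro bexI[of _ "\<lambda>x. f' (a * x + b) * a"]) (auto intro: smooth_intros)
next
  case (antideriv f F)
  then show ?case by blast
qed

lemma smooth_fun_derivative_unique:
  assumes "f \<in> smooth_fun" "\<And>x. (f has_real_derivative f' x) (at x)"
  shows "f' \<in> smooth_fun"
proof -
  obtain g where "g \<in> smooth_fun" "\<forall>x. (f has_real_derivative g x) (at x)"
    using smooth_fun_has_derivative[OF assms(1)] by blast
  moreover from this have "g = f'"
    using assms(2) DERIV_unique by blast
  ultimately show ?thesis by simp
qed

lemma smooth_fun_isCont: "f \<in> smooth_fun \<Longrightarrow> isCont f x"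
  using smooth_fun_has_derivative DERIV_isCont by blast

lemma smooth_fun_continuous: "f \<in> smooth_fun \<Longrightarrow> continuous_on A f"
  using smooth_fun_isCont continuous_at_imp_continuous_on by blast

text \<open>The profile e(x) e(1 - x) is positive exactly on (0, 1). Its antiderivative is constant
  on either side of that interval, and it becomes the step after subtraction of its value at 0 and
  division by its total increase.\<close>

lemma smooth_step_exists:
  obtains S S' where "S \<in> smooth_fun" "\<And>x. (S has_real_derivative S' x) (at x)"
    "\<And>x. S' x \<ge> 0" "\<And>x. x \<le> 0 \<Longrightarrow> S x = 0" "\<And>x. x \<ge> 1 \<Longrightarrow> S x = 1"
    "\<And>x. x \<le> 0 \<or> x \<ge> 1 \<Longrightarrow> S' x = 0"
proof -
  define e where "e = (\<lambda>x::real. if x \<le> 0 then 0 else inverse x ^ 0 * exp (- inverse x))"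
  define \<rho> where "\<rho> = (\<lambda>x. e x * e ((- 1) * x + 1))"
  have \<rho>: "\<rho> \<in> smooth_fun"
    unfolding \<rho>_def e_def by (intro smooth_fun.mult smooth_fun.flat smooth_fun.affine[where f = "\<lambda>x::real. if x \<le> 0 then 0 else inverse x ^ 0 * exp (- inverse x)"])
  have \<rho>0: "\<rho> x = 0" if "x \<le> 0 \<or> x \<ge> 1" for x using that by (auto simp: \<rho>_def e_def)
  have \<rho>p: "\<rho> x > 0" if "0 < x" "x < 1" for x using that by (auto simp: \<rho>_def e_def)
  have \<rho>n: "\<rho> x \<ge> 0" for x by (auto simp: \<rho>_def e_def)
  obtain F where F: "\<And>x. (F has_real_derivative \<rho> x) (at x)"
    using einterval_antiderivative[of "-\<infinity>" "\<infinity>" \<rho>] smooth_fun_isCont[OF \<rho>]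
    by (auto simp: has_real_derivative_iff_has_vector_derivative)
  have "F 0 < F 1"
  proof (rule DERIV_pos_imp_increasing_open[of 0 1 F])
    show "\<exists>y. (F has_real_derivative y) (at x) \<and> 0 < y" if "0 < x" "x < 1" for x
      using F \<rho>p[OF that] by blast
    show "continuous_on {0..1} F"
      by (intro continuous_at_imp_continuous_on ballI DERIV_isCont[OF F])
  qed simp
  define S where "S = (\<lambda>x. inverse (F 1 - F 0) * (F x + (- F 0)))"
  have "F \<in> smooth_fun" using smooth_fun.antideriv[OF \<rho>] F by blast
  then have 1: "S \<in> smooth_fun" unfolding S_def by (intro smooth_intros)
  have 2: "(S has_real_derivative inverse (F 1 - F 0) * \<rho> x) (at x)" for x
    unfolding S_def by (auto intro!: derivative_eq_intros F)
  have cF: "continuous_on A F" for A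
    by (intro continuous_at_imp_continuous_on ballI DERIV_isCont[OF F])
  have F0: "F x = F 0" if "x \<le> 0" for x
  proof (cases "x = 0")
    case False
    have "(F has_real_derivative 0) (at y)" if "x < y" "y < 0" for y
      using F[of y] \<rho>0[of y] that by simp
    then show ?thesis using DERIV_isconst_end[of x 0 F] cF False that by simp
  qed simp
  have F1: "F x = F 1" if "x \<ge> 1" for x
  proof (cases "x = 1")
    case False
    have "(F has_real_derivative 0) (at y)" if "1 < y" "y < x" for y
      using F[of y] \<rho>0[of y] that by simp
    then show ?thesis using DERIV_isconst_end[of 1 x F] cF False that by simp
  qed simp
  show ?thesis
  proof
    show "S \<in> smooth_fun" by fact
    show "(S has_real_derivative inverse (F 1 - F 0) * \<rho> x) (at x)" for x by fact
    show "S x = 0" if "x \<le> 0" for x using F0[OF that] by (simp add: S_def)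
    show "S x = 1" if "x \<ge> 1" for x using F1[OF that] \<open>F 0 < F 1\<close> by (simp add: S_def)
  qed (use \<rho>n \<rho>0 \<open>F 0 < F 1\<close> in auto)
qed

text \<open>Functions of a single linear combination of the coordinates generate enough: the test
  functions used below are products of a function of t - x and a function of t + x.\<close>

inductive_set smooth_fun2 :: "(real \<times> real \<Rightarrow> real) set" where
  plane: "f \<in> smooth_fun \<Longrightarrow> (\<lambda>z. f (a * fst z + b * snd z)) \<in> smooth_fun2"
| add: "f \<in> smooth_fun2 \<Longrightarrow> g \<in> smooth_fun2 \<Longrightarrow> (\<lambda>z. f z + g z) \<in> smooth_fun2"
| mult: "f \<in> smooth_fun2 \<Longrightarrow> g \<in> smooth_fun2 \<Longrightarrow> (\<lambda>z. f z * g z) \<in> smooth_fun2"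

lemma smooth_fun2_derivative:
  assumes "f \<in> smooth_fun2"
  shows "\<exists>f'. (\<forall>z. (f has_derivative f' z) (at z)) \<and> (\<forall>b. (\<lambda>z. f' z b) \<in> smooth_fun2)"
  using assms
proof induction
  case (plane f a b)
  then obtain f' where f': "f' \<in> smooth_fun" "\<And>x. (f has_real_derivative f' x) (at x)"
    using smooth_fun_has_derivative by blast
  have "((\<lambda>z. f (a * fst z + b * snd z)) has_derivative
      (\<lambda>h. f' (a * fst z + b * snd z) * (a * fst h + b * snd h))) (at z)" for z
    by (rule has_derivative_eq_rhs[OF DERIV_compose_FDERIV[OF f'(2)]]) (auto intro!: derivative_eq_intros simp: fun_eq_iff)
  moreover have "(\<lambda>z. f' (a * fst z + b * snd z) * (a * fst h + b * snd h)) \<in> smooth_fun2" for h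
    using smooth_fun2.mult[OF smooth_fun2.plane[OF f'(1), of a b] smooth_fun2.plane[OF smooth_fun.const[of "a * fst h + b * snd h"]]] .
  ultimately show ?case
    by (intro exI[of _ "\<lambda>z h. f' (a * fst z + b * snd z) * (a * fst h + b * snd h)"]) blast
next
  case (add f g)
  then obtain f' g' where fg: "\<And>z. (f has_derivative f' z) (at z)" "\<And>b. (\<lambda>z. f' z b) \<in> smooth_fun2"
    "\<And>z. (g has_derivative g' z) (at z)" "\<And>b. (\<lambda>z. g' z b) \<in> smooth_fun2" by blast
  show ?case
    by (rule exI[of _ "\<lambda>z h. f' z h + g' z h"]) (auto intro: has_derivative_add fg smooth_fun2.add)
next
  case (mult f g)
  then obtain f' g' where fg: "\<And>z. (f has_derivative f' z) (at z)" "\<And>b. (\<lambda>z. f' z b) \<in> smooth_fun2"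
    "\<And>z. (g has_derivative g' z) (at z)" "\<And>b. (\<lambda>z. g' z b) \<in> smooth_fun2" by blast
  show ?case
    by (intro exI[of _ "\<lambda>z h. f z * g' z h + f' z h * g z"] conjI allI has_derivative_mult fg
        smooth_fun2.add[OF smooth_fun2.mult smooth_fun2.mult] mult.hyps)
qed

lemma dir_deriv_eq: "(f has_derivative f') (at z) \<Longrightarrow> dir_deriv b f z = f' b"
  unfolding dir_deriv_def using frechet_derivative_at by metis

lemma smooth_fun2_C_k: "f \<in> smooth_fun2 \<Longrightarrow> C_k n f"
proof (induction n arbitrary: f)
  case 0
  then obtain f' where "\<And>z. (f has_derivative f' z) (at z)" using smooth_fun2_derivative by blast
  then show ?case
    by (auto intro!: continuous_at_imp_continuous_on has_derivative_continuous)
next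
  case (Suc n)
  then obtain f' where f': "\<And>z. (f has_derivative f' z) (at z)" "\<And>b. (\<lambda>z. f' z b) \<in> smooth_fun2"
    using smooth_fun2_derivative by blast
  then have "dir_deriv b f = (\<lambda>z. f' z b)" for b by (auto simp: dir_deriv_eq)
  then show ?case using f' Suc.IH unfolding C_k.simps differentiable_def by metis
qed

text \<open>The derivative is an argument of its own so that weak identities can name both
  functions, and the support bound covers both.\<close>

definition bump :: "(real \<Rightarrow> real) \<Rightarrow> (real \<Rightarrow> real) \<Rightarrow> bool" where
  "bump P P' \<longleftrightarrow> P \<in> smooth_fun \<and> (\<forall>x. (P has_real_derivative P' x) (at x)) \<and>
     (\<exists>B. \<forall>x. \<bar>x\<bar> > B \<longrightarrow> P x = 0 \<and> P' x = 0)"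

text \<open>The wave operator differentiates each factor of a product once, so \<open>P'\<close>
  must itself be admissible as a test profile.\<close>

lemma bump_deriv_exists:
  assumes "bump P P'" obtains P'' where "bump P' P''"
proof -
  have P': "P' \<in> smooth_fun" using assms smooth_fun_derivative_unique unfolding bump_def by blast
  then obtain P'' where P'': "P'' \<in> smooth_fun" "\<And>x. (P' has_real_derivative P'' x) (at x)"
    using smooth_fun_has_derivative by blast
  obtain B where B: "\<And>x. \<bar>x\<bar> > B \<Longrightarrow> P' x = 0" using assms unfolding bump_def by blast
  have "P'' x = 0" if "\<bar>x\<bar> > B" for x
  proof -
    have "(P' has_real_derivative 0) (at x)"
      by (rule has_field_derivative_transform_within_open[of "\<lambda>_. 0", where S = "{x. \<bar>x\<bar> > B}"])
        (use that B in \<open>auto intro!: open_Collect_less continuous_intros\<close>)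
    then show ?thesis using P''(2) DERIV_unique by blast
  qed
  then have "bump P' P''" using P' P'' B unfolding bump_def by blast
  then show ?thesis using that by blast
qed

lemma null_product_has_derivative:
  assumes "bump P P'" "bump Q Q'"
  shows "((\<lambda>z. P (fst z - snd z) * Q (fst z + snd z)) has_derivative
    (\<lambda>h. (fst h - snd h) * (P' (fst z - snd z) * Q (fst z + snd z))
       + (fst h + snd h) * (P (fst z - snd z) * Q' (fst z + snd z)))) (at z)"
proof -
  have P: "\<And>x. (P has_real_derivative P' x) (at x)" and Q: "\<And>x. (Q has_real_derivative Q' x) (at x)"
    using assms unfolding bump_def by auto
  have "((\<lambda>z. P (fst z - snd z) * Q (fst z + snd z)) has_derivative
      (\<lambda>h. P (fst z - snd z) * (Q' (fst z + snd z) * (fst h + snd h))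
        + P' (fst z - snd z) * (fst h - snd h) * Q (fst z + snd z))) (at z)"
    by (intro has_derivative_mult has_derivative_eq_rhs[OF DERIV_compose_FDERIV[OF P]]
        has_derivative_eq_rhs[OF DERIV_compose_FDERIV[OF Q]])
      (auto intro!: derivative_eq_intros simp: fun_eq_iff)
  then show ?thesis
    by (rule has_derivative_eq_rhs) (auto simp: fun_eq_iff algebra_simps)
qed

text \<open>\<open>P\<close> sees u = t - x and \<open>Q\<close> sees v = t + x, so a direction acts
  on them through the difference and the sum of its components. Time and space derivatives of such
  products thus differ only in the sign of the \<open>P'\<close> term.\<close>

lemma null_product_test_function:
  assumes "bump P P'" "bump Q Q'"
  defines "\<psi> \<equiv> \<lambda>z. P (fst z - snd z) * Q (fst z + snd z)"
  shows "test_function \<psi>"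
    and "dir_deriv b \<psi> z = (fst b - snd b) * (P' (fst z - snd z) * Q (fst z + snd z))
           + (fst b + snd b) * (P (fst z - snd z) * Q' (fst z + snd z))"
proof -
  have P: "P \<in> smooth_fun" and Q: "Q \<in> smooth_fun"
    using assms unfolding bump_def by auto
  show "dir_deriv b \<psi> z = (fst b - snd b) * (P' (fst z - snd z) * Q (fst z + snd z))
           + (fst b + snd b) * (P (fst z - snd z) * Q' (fst z + snd z))"
    unfolding \<psi>_def by (rule dir_deriv_eq[OF null_product_has_derivative[OF assms(1,2)]])
  have "\<psi> \<in> smooth_fun2"
    using smooth_fun2.mult[OF smooth_fun2.plane[OF P, of 1 "-1"] smooth_fun2.plane[OF Q, of 1 1]]
    by (simp add: \<psi>_def)
  then have "\<forall>n. C_k n \<psi>" using smooth_fun2_C_k by blast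
  moreover have "compact (closure {z. \<psi> z \<noteq> 0})"
  proof -
    obtain B C where B: "\<And>x. \<bar>x\<bar> > B \<Longrightarrow> P x = 0" and C: "\<And>x. \<bar>x\<bar> > C \<Longrightarrow> Q x = 0"
      using assms unfolding bump_def by metis
    have "{z. \<psi> z \<noteq> 0} \<subseteq> cbox (- \<bar>B\<bar> - \<bar>C\<bar>, - \<bar>B\<bar> - \<bar>C\<bar>) (\<bar>B\<bar> + \<bar>C\<bar>, \<bar>B\<bar> + \<bar>C\<bar>)"
    proof
      fix z assume "z \<in> {z. \<psi> z \<noteq> 0}"
      then have "P (fst z - snd z) \<noteq> 0" "Q (fst z + snd z) \<noteq> 0" by (auto simp: \<psi>_def)
      then have "\<bar>fst z - snd z\<bar> \<le> B" "\<bar>fst z + snd z\<bar> \<le> C"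
        using B C not_le_imp_less by blast+
      then show "z \<in> cbox (- \<bar>B\<bar> - \<bar>C\<bar>, - \<bar>B\<bar> - \<bar>C\<bar>) (\<bar>B\<bar> + \<bar>C\<bar>, \<bar>B\<bar> + \<bar>C\<bar>)"
        by (cases z) auto
    qed
    then have "bounded {z. \<psi> z \<noteq> 0}" using bounded_cbox bounded_subset by blast
    then show ?thesis by (simp add: compact_closure)
  qed
  ultimately show "test_function \<psi>" unfolding test_function_def by blast
qed

section \<open>The lemma of du Bois-Reymond\<close>

lemma integrable_compact_support:
  fixes f :: "'a::euclidean_space \<Rightarrow> real"
  assumes "continuous_on UNIV f" "compact K" "\<And>x. x \<notin> K \<Longrightarrow> f x = 0"
  shows "integrable lborel f"
proof -
  have "integrable lborel (\<lambda>x. indicator K x *\<^sub>R f x)"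
    using assms by (intro borel_integrable_compact) (auto intro: continuous_on_subset)
  moreover have "(\<lambda>x. indicator K x *\<^sub>R f x) = f"
    using assms(3) by (auto simp: fun_eq_iff indicator_def)
  ultimately show ?thesis by simp
qed

text \<open>The kernels have mass one and concentrate at \<open>a\<close> from the right. The scale
  \<open>c n = n + 1\<close> is at least 1, which keeps all supports inside {a..a + 1} and provides
  one bound on \<open>F\<close> for the dominated convergence.\<close>

lemma approximate_identity:
  fixes F :: "real \<Rightarrow> real"
  assumes F: "continuous_on UNIV F"
    and S': "continuous_on UNIV S'" "\<And>x. S' x \<ge> 0" "\<And>x. x \<le> 0 \<or> x \<ge> 1 \<Longrightarrow> S' x = 0"
      "(LINT x|lborel. S' x) = 1"
  defines "c \<equiv> \<lambda>n. real (Suc n)"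
  shows "integrable lborel (\<lambda>x. F x * (c n * S' (c n * x + (- c n * a))))"
    and "(\<lambda>n. LINT x|lborel. F x * (c n * S' (c n * x + (- c n * a)))) \<longlonglongrightarrow> F a"
proof -
  have c: "c n > 0" "c n \<ge> 1" and cne [simp]: "c n \<noteq> 0" for n by (auto simp: c_def)
  have S'0: "S' (c n * x + (- c n * a)) = 0" if "x \<notin> {a..a + 1}" for x n
  proof (rule S'(3))
    show "c n * x + (- c n * a) \<le> 0 \<or> c n * x + (- c n * a) \<ge> 1"
    proof (cases "x < a")
      case True
      then have "c n * x \<le> c n * a" using c[of n] by (intro mult_left_mono) auto
      then show ?thesis by auto
    next
      case False
      then have "x - a \<ge> 1" using that by auto
      then have "c n * (x - a) \<ge> 1 * 1" using c[of n] by (intro mult_mono) auto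
      then show ?thesis by (simp add: algebra_simps)
    qed
  qed
  show "integrable lborel (\<lambda>x. F x * (c n * S' (c n * x + (- c n * a))))"
    by (rule integrable_compact_support[where K = "{a..a + 1}"])
      (use S'0 in \<open>auto intro!: continuous_intros F continuous_on_compose2[OF S'(1)]\<close>)
  \<comment> \<open>The substitution x = a + y / c n moves the scaling from the kernel into the
    argument of \<open>F\<close>; the limit is then the continuity of \<open>F\<close> at
    \<open>a\<close>.\<close>
  have eq: "(LINT x|lborel. F x * (c n * S' (c n * x + (- c n * a))))
      = (LINT y|lborel. F (a + (1 / c n) * y) * S' y)" for n
  proof -
    have "(LINT x|lborel. F x * (c n * S' (c n * x + (- c n * a)))) = \<bar>1 / c n\<bar> *\<^sub>R
        (LINT y|lborel. F (a + (1 / c n) * y) * (c n * S' (c n * (a + (1 / c n) * y) + (- c n * a))))"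
      by (rule lborel_integral_real_affine) (use c[of n] in simp)
    also have "(\<lambda>y. F (a + (1 / c n) * y) * (c n * S' (c n * (a + (1 / c n) * y) + (- c n * a))))
        = (\<lambda>y. c n * (F (a + (1 / c n) * y) * S' y))"
      using c[of n] by (auto simp: fun_eq_iff distrib_left)
    finally show ?thesis using c[of n] by simp
  qed
  have "bounded (F ` {a..a + 1})"
    by (intro compact_imp_bounded compact_continuous_image continuous_on_subset[OF F]) auto
  then obtain K where K: "\<And>x. x \<in> {a..a + 1} \<Longrightarrow> \<bar>F x\<bar> \<le> K"
    unfolding bounded_iff by (metis image_eqI real_norm_def)
  have "(\<lambda>n. LINT y|lborel. F (a + (1 / c n) * y) * S' y) \<longlonglongrightarrow> (LINT y|lborel. F a * S' y)"
  proof (rule integral_dominated_convergence[where w = "\<lambda>y. K * S' y"])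
    have "integrable lborel S'"
      by (rule integrable_compact_support[where K = "{0..1}"]) (use S' in auto)
    then show "integrable lborel (\<lambda>y. K * S' y)" by simp
    show "(\<lambda>y. F a * S' y) \<in> borel_measurable lborel"
      "(\<lambda>y. F (a + (1 / c n) * y) * S' y) \<in> borel_measurable lborel" for n
      by (auto intro!: borel_measurable_continuous_onI continuous_intros S' continuous_on_compose2[OF F])
    have "(\<lambda>n. F (a + (1 / c n) * y) * S' y) \<longlonglongrightarrow> F (a + 0 * y) * S' y" for y
    proof (intro tendsto_mult tendsto_const)
      have "(\<lambda>n. 1 / c n) \<longlonglongrightarrow> 0"
        unfolding c_def using LIMSEQ_inverse_real_of_nat by (simp add: inverse_eq_divide)
      then have "(\<lambda>n. a + (1 / c n) * y) \<longlonglongrightarrow> a + 0 * y" by (intro tendsto_intros)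
      moreover have "isCont F (a + 0 * y)" using F by (simp add: continuous_on_eq_continuous_at)
      ultimately show "(\<lambda>n. F (a + (1 / c n) * y)) \<longlonglongrightarrow> F (a + 0 * y)"
        using isCont_tendsto_compose by blast
    qed
    then show "AE y in lborel. (\<lambda>n. F (a + (1 / c n) * y) * S' y) \<longlonglongrightarrow> F a * S' y"
      by simp
    show "AE y in lborel. norm (F (a + (1 / c n) * y) * S' y) \<le> K * S' y" for n
    proof (rule AE_I2)
      fix y
      show "norm (F (a + (1 / c n) * y) * S' y) \<le> K * S' y"
      proof (cases "y \<le> 0 \<or> y \<ge> 1")
        case False
        then have "(1 / c n) * y \<le> 1 * 1" using c[of n] by (intro mult_mono) auto
        then have "\<bar>F (a + (1 / c n) * y)\<bar> \<le> K"
          using False c[of n] by (intro K) auto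
        then show ?thesis using S'(2)[of y] by (auto simp: abs_mult intro!: mult_right_mono)
      qed (use S'(3) in auto)
    qed
  qed
  then show "(\<lambda>n. LINT x|lborel. F x * (c n * S' (c n * x + (- c n * a)))) \<longlonglongrightarrow> F a"
    unfolding eq by (simp add: S'(4))
qed

text \<open>Testing with smoothed indicators of the interval turns the left side into a difference
  of two approximate identities at the endpoints, while the right side tends to the integral of
  \<open>H\<close> by dominated convergence.\<close>

lemma du_Bois_Reymond:
  fixes F H :: "real \<Rightarrow> real"
  assumes F: "continuous_on UNIV F"
    and H: "\<And>a b. set_integrable lborel {a..b} H"
    and weak: "\<And>P P'. bump P P' \<Longrightarrow> (LINT x|lborel. F x * P' x) = - (LINT x|lborel. H x * P x)"
    and ab: "a \<le> b"
  shows "F b - F a = (LINT x:{a..b}|lborel. H x)"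
proof -
  obtain S S' where S: "S \<in> smooth_fun" "\<And>x. (S has_real_derivative S' x) (at x)"
    "\<And>x. S' x \<ge> 0" "\<And>x. x \<le> 0 \<Longrightarrow> S x = 0" "\<And>x. x \<ge> 1 \<Longrightarrow> S x = 1"
    "\<And>x. x \<le> 0 \<or> x \<ge> 1 \<Longrightarrow> S' x = 0" using smooth_step_exists by metis
  have S'c: "continuous_on A S'" for A by (rule smooth_fun_continuous[OF smooth_fun_derivative_unique[OF S(1,2)]])
  have "mono S" using S(2,3) DERIV_nonneg_imp_nondecreasing[of _ _ S] unfolding mono_def by metis
  then have S01: "0 \<le> S x" "S x \<le> 1" for x
    using S(4)[of "min x 0"] S(5)[of "max x 1"] monoD[of S "min x 0" x] monoD[of S x "max x 1"] by auto
  have S'0: "S' x = 0" if "\<not> 0 \<le> x \<or> \<not> x \<le> 1" for x using S(6)[of x] that by linarith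
  have S'1: "(LINT x|lborel. S' x) = 1"
  proof -
    have "(LINT x|lborel. S' x * indicator {0..1} x) = S 1 - S 0"
      by (rule integral_FTC_Icc_real) (use S smooth_fun_isCont[OF smooth_fun_derivative_unique[OF S(1,2)]] in auto)
    moreover have "(\<lambda>x. S' x * indicator {0..1} x) = S'"
      using S'0 by (intro ext) (auto simp: indicator_def simp del: not_le)
    ultimately show ?thesis using S(4)[of 0] S(5)[of 1] by simp
  qed
  define c where "c = (\<lambda>n. real (Suc n))"
  have c: "c n > 0" "c n \<ge> 1" for n by (auto simp: c_def)
  \<comment> \<open>Two steps of growing steepness, at \<open>a\<close> and at \<open>b\<close>;
    their difference approximates the indicator of {a<..b}.\<close>
  define P where "P = (\<lambda>n x. S (c n * x + (- c n * a)) + (- 1) * S (c n * x + (- c n * b)))"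
  define P' where "P' = (\<lambda>n x. c n * S' (c n * x + (- c n * a)) - c n * S' (c n * x + (- c n * b)))"
  have ai: "integrable lborel (\<lambda>x. F x * (c n * S' (c n * x + (- c n * d))))"
    "(\<lambda>n. LINT x|lborel. F x * (c n * S' (c n * x + (- c n * d)))) \<longlonglongrightarrow> F d" for n d
    unfolding c_def by (rule approximate_identity[OF F S'c S(3) S(6) S'1]; assumption)+
  have P0: "P n x = 0 \<and> P' n x = 0" if "x \<notin> {a..b + 1}" for n x
  proof (cases "x < a")
    case True
    then have "c n * x \<le> c n * a" "c n * x \<le> c n * b" using c[of n] ab by (auto intro!: mult_left_mono)
    then show ?thesis by (auto simp: P_def P'_def S)
  next
    case False
    then have "x - a \<ge> 1" "x - b \<ge> 1" using that ab by auto
    then have "c n * (x - a) \<ge> 1 * 1" "c n * (x - b) \<ge> 1 * 1" using c[of n] by (intro mult_mono; simp)+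
    then show ?thesis by (auto simp: P_def P'_def algebra_simps S)
  qed
  have DP: "(P n has_real_derivative P' n x) (at x)" for n x
    unfolding P_def P'_def
    by (rule DERIV_cong[OF DERIV_add[OF DERIV_chain2[OF S(2)] DERIV_cmult[OF DERIV_chain2[OF S(2)]]]])
       (auto intro!: derivative_eq_intros)
  have Psm: "P n \<in> smooth_fun" for n
    unfolding P_def by (intro smooth_intros S)
  have bump: "bump (P n) (P' n)" for n
    unfolding bump_def using Psm DP
    by (intro conjI allI exI[of _ "\<bar>a\<bar> + \<bar>b\<bar> + 1"] impI) (auto intro!: conjunct1[OF P0] conjunct2[OF P0])
  have "(\<lambda>n. (LINT x|lborel. F x * (c n * S' (c n * x + (- c n * a)))) -
      (LINT x|lborel. F x * (c n * S' (c n * x + (- c n * b))))) \<longlonglongrightarrow> F a - F b"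
    by (intro tendsto_diff ai)
  also have "(\<lambda>n. (LINT x|lborel. F x * (c n * S' (c n * x + (- c n * a)))) -
      (LINT x|lborel. F x * (c n * S' (c n * x + (- c n * b))))) = (\<lambda>n. LINT x|lborel. F x * P' n x)"
    unfolding P'_def right_diff_distrib by (subst Bochner_Integration.integral_diff) (use ai in auto)
  also have "\<dots> = (\<lambda>n. - (LINT x|lborel. H x * P n x))" using weak[OF bump] by simp
  finally have lim1: "(\<lambda>n. - (LINT x|lborel. H x * P n x)) \<longlonglongrightarrow> F a - F b" .
  define h where "h = (\<lambda>x. indicator {a..b + 1} x *\<^sub>R H x)"
  have h: "integrable lborel h" using H[of a "b + 1"] by (simp add: h_def set_integrable_def)
  have hP: "H x * P n x = h x * P n x" for n x using P0[of x n] by (auto simp: h_def indicator_def)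
  have "(\<lambda>n. LINT x|lborel. h x * P n x) \<longlonglongrightarrow> (LINT x|lborel. h x * indicator {a<..b} x)"
  proof (rule integral_dominated_convergence[where w = "\<lambda>x. \<bar>h x\<bar>"])
    show "(\<lambda>x. h x * indicator {a<..b} x) \<in> borel_measurable lborel" using h by measurable
    have "P n \<in> borel_measurable borel" for n
      using smooth_fun_continuous[OF Psm] by (rule borel_measurable_continuous_onI)
    then show "(\<lambda>x. h x * P n x) \<in> borel_measurable lborel" for n using h by measurable
    show "integrable lborel (\<lambda>x. \<bar>h x\<bar>)" using h by simp
    \<comment> \<open>\<open>S\<close> vanishes at 0, so the limit at x = d is 0. This is why the
      half-open interval appears; its left endpoint is a null set and is restored at the
      end.\<close>
    have step: "(\<lambda>n. S (c n * x + (- c n * d))) \<longlonglongrightarrow> indicator {d<..} x" for x d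
    proof (cases "x \<le> d")
      case True
      then have "c n * x \<le> c n * d" for n using c[of n] by (auto intro!: mult_left_mono)
      then have "S (c n * x + (- c n * d)) = indicator {d<..} x" for n using True S(4) by auto
      then show ?thesis by simp
    next
      case False
      obtain N where N: "real N * (x - d) > 1" using reals_Archimedean3[of "x - d"] False by auto
      have "S (c n * x + (- c n * d)) = indicator {d<..} x" if "n \<ge> N" for n
      proof -
        have "real N * (x - d) \<le> c n * (x - d)" using that False by (intro mult_right_mono) (auto simp: c_def)
        then show ?thesis using N False S(5) by (auto simp: algebra_simps)
      qed
      then have "\<forall>\<^sub>F n in sequentially. indicator {d<..} x = S (c n * x + (- c n * d))"
        using eventually_sequentially by force
      then show ?thesis by (rule Lim_transform_eventually[OF tendsto_const])
    qed
    have "(\<lambda>n. h x * P n x) \<longlonglongrightarrow> h x * (indicator {a<..} x + (- 1) * indicator {b<..} x)" for x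
      unfolding P_def by (intro tendsto_intros step)
    moreover have "indicator {a<..} x + (- 1) * indicator {b<..} x = (indicator {a<..b} x :: real)" for x
      using ab by (auto simp: indicator_def)
    ultimately show "AE x in lborel. (\<lambda>n. h x * P n x) \<longlonglongrightarrow> h x * indicator {a<..b} x" by simp
    have "\<bar>P n x\<bar> \<le> 1" for n x
      using S01[of "c n * x + (- c n * a)"] S01[of "c n * x + (- c n * b)"] by (auto simp: P_def)
    then show "AE x in lborel. norm (h x * P n x) \<le> \<bar>h x\<bar>" for n
      by (intro AE_I2) (auto simp: abs_mult intro: mult_left_le)
  qed
  then have "(\<lambda>n. - (LINT x|lborel. H x * P n x)) \<longlonglongrightarrow> - (LINT x|lborel. h x * indicator {a<..b} x)"
    unfolding hP by (rule tendsto_minus)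
  then have "F a - F b = - (LINT x|lborel. h x * indicator {a<..b} x)"
    using lim1 LIMSEQ_unique by blast
  also have "(LINT x|lborel. h x * indicator {a<..b} x) = (LINT x:{a..b}|lborel. H x)"
    unfolding set_lebesgue_integral_def
    by (rule integral_cong_AE) (use h H[of a b] in \<open>auto simp: set_integrable_def h_def indicator_def
        intro!: eventually_mono[OF AE_lborel_singleton[of a]]\<close>)
  finally show ?thesis by simp
qed

section \<open>Absolutely continuous functions\<close>

text \<open>Local absolute continuity in integrated form, with the density as explicit data.
  Everything below is done with increments and integrals, never with derivatives almost
  everywhere.\<close>

definition ac_density :: "(real \<Rightarrow> real) \<Rightarrow> (real \<Rightarrow> real) \<Rightarrow> bool" where
  "ac_density \<theta> p \<longleftrightarrow> continuous_on UNIV \<theta> \<and> (\<forall>a b. set_integrable lborel {a..b} p) \<and>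
     (\<forall>a b. a \<le> b \<longrightarrow> \<theta> b - \<theta> a = (LINT x:{a..b}|lborel. p x))"

lemma set_integral_Icc_split:
  fixes f :: "real \<Rightarrow> real"
  assumes "set_integrable lborel {a..c} f" "a \<le> b" "b \<le> c"
  shows "(LINT x:{a..c}|lborel. f x) = (LINT x:{a..b}|lborel. f x) + (LINT x:{b..c}|lborel. f x)"
proof -
  have "{a..c} = {a..b} \<union> {b..c}" using assms by auto
  moreover have "set_integrable lborel {a..b} f" "set_integrable lborel {b..c} f"
    using assms by (auto intro: set_integrable_subset)
  moreover have "AE x in lborel. \<not> (x \<in> {a..b} \<and> x \<in> {b..c})"
    by (rule eventually_mono[OF AE_lborel_singleton[of b]]) auto
  ultimately show ?thesis by (simp add: set_integral_Un_AE)
qed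

lemma set_integrable_mult_continuous:
  fixes f g :: "real \<Rightarrow> real"
  assumes "set_integrable lborel {a..b} p" "continuous_on UNIV g"
  shows "set_integrable lborel {a..b} (\<lambda>x. g x * p x)"
proof -
  have "bounded (g ` {a..b})"
    by (intro compact_imp_bounded compact_continuous_image continuous_on_subset[OF assms(2)]) auto
  then obtain K where K: "\<And>x. x \<in> {a..b} \<Longrightarrow> \<bar>g x\<bar> \<le> K"
    unfolding bounded_iff by (metis image_eqI real_norm_def)
  have g: "g \<in> borel_measurable borel" using assms(2) by (rule borel_measurable_continuous_onI)
  have i: "integrable lborel (\<lambda>x. indicator {a..b} x * p x)"
    using assms(1) by (simp add: set_integrable_def)
  have "integrable lborel (\<lambda>x. g x * (indicator {a..b} x * p x))"
  proof (rule Bochner_Integration.integrable_bound)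
    show "integrable lborel (\<lambda>x. K * (indicator {a..b} x * p x))" using i by simp
    show "(\<lambda>x. g x * (indicator {a..b} x * p x)) \<in> borel_measurable lborel"
      using g borel_measurable_integrable[OF i] by simp
    show "AE x in lborel. norm (g x * (indicator {a..b} x * p x)) \<le> norm (K * (indicator {a..b} x * p x))"
      using K by (force simp: abs_mult indicator_def intro!: AE_I2 mult_right_mono)
  qed
  then show ?thesis by (simp add: set_integrable_def mult.left_commute)
qed

text \<open>On a uniform partition of mesh below \<delta> both \<open>Z\<close> and \<open>M\<close>
  telescope, so a bound on short increments sums to a bound on the whole interval.\<close>

lemma small_increments_sum:
  fixes Z M :: "real \<Rightarrow> real"
  assumes "a \<le> b" "\<delta> > 0"
    and small: "\<And>s t. a \<le> s \<Longrightarrow> s \<le> t \<Longrightarrow> t \<le> b \<Longrightarrow> t - s < \<delta> \<Longrightarrow> \<bar>Z t - Z s\<bar> \<le> M t - M s"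
  shows "\<bar>Z b - Z a\<bar> \<le> M b - M a"
proof -
  obtain N :: nat where N: "(b - a) / \<delta> < real N" using reals_Archimedean2 by blast
  have N0: "real N > 0" using N assms by (meson divide_nonneg_pos diff_ge_0_iff_ge le_less_trans)
  define \<eta> where "\<eta> = (b - a) / real N"
  define x where "x = (\<lambda>i::nat. a + real i * \<eta>)"
  have \<eta>: "\<eta> < \<delta>" "\<eta> \<ge> 0" "real N * \<eta> = b - a"
    using N N0 assms(1,2) by (simp_all add: \<eta>_def field_simps)
  have "\<bar>Z (x i) - Z a\<bar> \<le> M (x i) - M a" if "i \<le> N" for i
    using that
  proof (induction i)
    case (Suc i)
    have "(real i + 1) * \<eta> \<le> real N * \<eta>" "real i * \<eta> \<ge> 0"
      using Suc.prems \<eta>(2) by (intro mult_right_mono mult_nonneg_nonneg; simp)+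
    then have "\<bar>Z (x (Suc i)) - Z (x i)\<bar> \<le> M (x (Suc i)) - M (x i)"
      using \<eta> by (intro small) (auto simp: x_def distrib_right)
    then show ?case using Suc by auto
  qed (simp add: x_def)
  from this[of N] show ?thesis using \<eta>(3) by (simp add: x_def)
qed

lemma ac_densityD:
  assumes "ac_density \<theta> p"
  shows "continuous_on A \<theta>" "set_integrable lborel {a..b} p"
    "a \<le> b \<Longrightarrow> \<theta> b - \<theta> a = (LINT x:{a..b}|lborel. p x)"
  using assms continuous_on_subset unfolding ac_density_def by blast+

lemma ac_density_of_continuous_deriv:
  assumes "\<And>x. (F has_real_derivative f x) (at x)" "continuous_on UNIV f"
  shows "ac_density F f"
  unfolding ac_density_def
proof (intro conjI allI impI)
  show "continuous_on UNIV F"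
    by (intro continuous_at_imp_continuous_on ballI DERIV_isCont[OF assms(1)])
  fix a b :: real
  show "set_integrable lborel {a..b} f"
    by (rule borel_integrable_atLeastAtMost'[OF continuous_on_subset[OF assms(2)]]) auto
  assume "a \<le> b"
  then have "(LINT x|lborel. f x * indicator {a..b} x) = F b - F a"
    by (rule integral_FTC_Icc_real) (use assms in \<open>auto simp: continuous_on_eq_continuous_at\<close>)
  then show "F b - F a = (LINT x:{a..b}|lborel. f x)"
    by (simp add: set_lebesgue_integral_def mult.commute)
qed

lemma ac_density_add:
  assumes "ac_density \<theta> p" "ac_density \<eta> q"
  shows "ac_density (\<lambda>x. \<theta> x + \<eta> x) (\<lambda>x. p x + q x)"
  using ac_densityD[OF assms(1)] ac_densityD[OF assms(2)] unfolding ac_density_def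
  by (auto intro!: continuous_intros simp: set_integral_add)
     (smt (verit))

lemma ac_density_cmult:
  assumes "ac_density \<theta> p"
  shows "ac_density (\<lambda>x. c * \<theta> x) (\<lambda>x. c * p x)"
  using ac_densityD[OF assms] unfolding ac_density_def
  by (auto intro!: continuous_intros) (metis right_diff_distrib)

text \<open>On intervals so short that \<open>f (\<theta> x)\<close> oscillates by less than
  \<epsilon>, the increment of \<open>F (\<theta> x)\<close> and the integral of
  \<open>f (\<theta> x) * p x\<close> differ by at most \<epsilon> times the integral of
  \<bar>p\<bar>. Summation over a partition and \<epsilon> \<rightarrow> 0 give equality.
  \<open>Z\<close> is the discrepancy, \<open>M\<close> the total variation bound.\<close>

lemma ac_density_compose:
  assumes \<theta>: "ac_density \<theta> p"
    and F: "\<And>x. (F has_real_derivative f x) (at x)" and f: "continuous_on UNIV f"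
  shows "ac_density (\<lambda>x. F (\<theta> x)) (\<lambda>x. f (\<theta> x) * p x)"
  unfolding ac_density_def
proof (intro conjI allI impI)
  note p = ac_densityD[OF \<theta>]
  have f\<theta>: "continuous_on A (\<lambda>x. f (\<theta> x))" for A
    by (rule continuous_on_compose2[OF f]) (use p(1) in auto)
  show "continuous_on UNIV (\<lambda>x. F (\<theta> x))"
    by (rule continuous_on_compose2[OF continuous_at_imp_continuous_on p(1)]) (use DERIV_isCont[OF F] in auto)
  show int: "set_integrable lborel {a..b} (\<lambda>x. f (\<theta> x) * p x)" for a b
    using p(2) f\<theta> by (intro set_integrable_mult_continuous)
  fix a b :: real assume ab: "a \<le> b"
  define Z where "Z = (\<lambda>x. F (\<theta> x) - (LINT y:{a..x}|lborel. f (\<theta> y) * p y))"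
  define M where "M = (\<lambda>x. LINT y:{a..x}|lborel. \<bar>p y\<bar>)"
  have pabs: "set_integrable lborel {s..t} (\<lambda>y. \<bar>p y\<bar>)" for s t
    using set_integrable_abs[OF p(2)] .
  have "\<bar>Z b - Z a\<bar> \<le> \<epsilon> * M b - \<epsilon> * M a" if "\<epsilon> > 0" for \<epsilon>
  proof -
    have "uniformly_continuous_on {a..b} (\<lambda>x. f (\<theta> x))"
      by (rule compact_uniformly_continuous[OF f\<theta>]) auto
    from this[unfolded uniformly_continuous_on_def dist_real_def, rule_format, OF that]
    obtain \<delta> where \<delta>: "\<delta> > 0" "\<And>x y. x \<in> {a..b} \<Longrightarrow> y \<in> {a..b} \<Longrightarrow> \<bar>y - x\<bar> < \<delta> \<Longrightarrow> \<bar>f (\<theta> y) - f (\<theta> x)\<bar> < \<epsilon>"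
      by blast
    show ?thesis
    proof (rule small_increments_sum[OF ab \<delta>(1)])
      fix s t assume st: "a \<le> s" "s \<le> t" "t \<le> b" "t - s < \<delta>"
      \<comment> \<open>The mean value theorem yields a value between \<theta> s and \<theta> t; by
        the intermediate value theorem it is attained at some \<open>r\<close> in {s..t}, where the
        uniform continuity of \<open>f (\<theta> x)\<close> can be applied.\<close>
      have "\<exists>r\<in>{s..t}. F (\<theta> t) - F (\<theta> s) = f (\<theta> r) * (\<theta> t - \<theta> s)"
      proof -
        consider "\<theta> s = \<theta> t" | "\<theta> s < \<theta> t" | "\<theta> t < \<theta> s" by linarith
        then show ?thesis
        proof cases
          case 1 then show ?thesis using st by auto
        next
          case 2
          obtain z where z: "\<theta> s < z" "z < \<theta> t" "F (\<theta> t) - F (\<theta> s) = (\<theta> t - \<theta> s) * f z"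
            using MVT2[OF 2, of F f] F by blast
          obtain r where "s \<le> r" "r \<le> t" "\<theta> r = z"
            using IVT'[of \<theta> s z t] z st p(1) by auto
          then show ?thesis using z by (intro bexI[of _ r]) auto
        next
          case 3
          obtain z where z: "\<theta> t < z" "z < \<theta> s" "F (\<theta> s) - F (\<theta> t) = (\<theta> s - \<theta> t) * f z"
            using MVT2[OF 3, of F f] F by blast
          obtain r where "s \<le> r" "r \<le> t" "\<theta> r = z"
            using IVT2'[of \<theta> t z s] z st p(1) by auto
          then show ?thesis using z by (intro bexI[of _ r]) (auto simp: algebra_simps)
        qed
      qed
      then obtain r where r: "r \<in> {s..t}" "F (\<theta> t) - F (\<theta> s) = f (\<theta> r) * (\<theta> t - \<theta> s)" by blast
      have "Z t - Z s = f (\<theta> r) * (LINT y:{s..t}|lborel. p y) - (LINT y:{s..t}|lborel. f (\<theta> y) * p y)"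
        using r(2) p(3)[of s t] st set_integral_Icc_split[OF int[of a t], of s] by (simp add: Z_def)
      also have "\<dots> = (LINT y:{s..t}|lborel. f (\<theta> r) * p y - f (\<theta> y) * p y)"
        using p(2) int by (subst set_integral_diff) auto
      finally have Z: "Z t - Z s = (LINT y:{s..t}|lborel. f (\<theta> r) * p y - f (\<theta> y) * p y)" .
      have "\<bar>Z t - Z s\<bar> \<le> (LINT y:{s..t}|lborel. \<epsilon> * \<bar>p y\<bar>)"
        unfolding Z set_lebesgue_integral_def
      proof (rule integral_abs_bound_integral)
        show "integrable lborel (\<lambda>y. indicat_real {s..t} y *\<^sub>R (f (\<theta> r) * p y - f (\<theta> y) * p y))"
          unfolding set_integrable_def[symmetric]
          by (intro set_integral_diff(1) set_integrable_mult_right p(2) int)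
        show "integrable lborel (\<lambda>y. indicat_real {s..t} y *\<^sub>R (\<epsilon> * \<bar>p y\<bar>))"
          using pabs[of s t] by (simp add: set_integrable_def mult.left_commute)
        fix y
        have "\<bar>f (\<theta> r) - f (\<theta> y)\<bar> * \<bar>p y\<bar> \<le> \<epsilon> * \<bar>p y\<bar>" if "y \<in> {s..t}"
        proof -
          have "\<bar>r - y\<bar> < \<delta>" using that r(1) st by (auto simp: abs_if)
          then have "\<bar>f (\<theta> r) - f (\<theta> y)\<bar> < \<epsilon>" using that r(1) st by (intro \<delta>(2)) auto
          then show ?thesis by (intro mult_right_mono) auto
        qed
        then show "\<bar>indicat_real {s..t} y *\<^sub>R (f (\<theta> r) * p y - f (\<theta> y) * p y)\<bar>
            \<le> indicat_real {s..t} y *\<^sub>R (\<epsilon> * \<bar>p y\<bar>)"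
          by (auto simp: indicator_def abs_mult left_diff_distrib[symmetric])
      qed
      also have "\<dots> = \<epsilon> * M t - \<epsilon> * M s"
        using set_integral_Icc_split[OF pabs[of a t], of s] st by (simp add: M_def algebra_simps)
      finally show "\<bar>Z t - Z s\<bar> \<le> \<epsilon> * M t - \<epsilon> * M s" .
    qed
  qed
  then have bound: "\<bar>Z b - Z a\<bar> \<le> \<epsilon> * (M b - M a)" if "\<epsilon> > 0" for \<epsilon>
    using that by (simp add: right_diff_distrib)
  have "\<bar>Z b - Z a\<bar> \<le> 0"
  proof (rule field_le_epsilon)
    fix e :: real assume e: "e > 0"
    \<comment> \<open>The sign comes from the bound at \<epsilon> = 1; the summand 1 in the next
      denominator covers the case M b = M a.\<close>
    have "M b - M a \<ge> 0" using bound[of 1] abs_ge_zero[of "Z b - Z a"] by (simp del: abs_ge_zero)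
    then have "e / (M b - M a + 1) * (M b - M a) \<le> e" using e by (simp add: field_simps)
    then show "\<bar>Z b - Z a\<bar> \<le> 0 + e" using bound[of "e / (M b - M a + 1)"] e \<open>M b - M a \<ge> 0\<close> by simp
  qed
  moreover have "(LINT y:{a..a}|lborel. f (\<theta> y) * p y) = 0"
    unfolding set_lebesgue_integral_def
    by (rule integral_eq_zero_AE) (auto intro!: eventually_mono[OF AE_lborel_singleton[of a]])
  ultimately show "F (\<theta> b) - F (\<theta> a) = (LINT x:{a..b}|lborel. f (\<theta> x) * p x)"
    by (simp add: Z_def)
qed

text \<open>Polarisation: a product is a quarter of a difference of two squares, and squares fall
  under the chain rule.\<close>

lemma ac_density_mult:
  assumes "ac_density \<theta> p" "ac_density \<eta> q"
  shows "ac_density (\<lambda>x. \<theta> x * \<eta> x) (\<lambda>x. p x * \<eta> x + \<theta> x * q x)"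
proof -
  have sq: "((\<lambda>x::real. x\<^sup>2) has_real_derivative 2 * x) (at x)" for x
    by (auto intro!: derivative_eq_intros)
  have "continuous_on UNIV (\<lambda>x::real. 2 * x)" by (intro continuous_intros)
  note sq = ac_density_compose[OF _ sq this]
  have 1: "ac_density (\<lambda>x. (\<theta> x + \<eta> x)\<^sup>2) (\<lambda>x. 2 * (\<theta> x + \<eta> x) * (p x + q x))"
    by (intro sq ac_density_add assms)
  have 2: "ac_density (\<lambda>x. (\<theta> x + (- 1) * \<eta> x)\<^sup>2) (\<lambda>x. 2 * (\<theta> x + (- 1) * \<eta> x) * (p x + (- 1) * q x))"
    by (intro sq ac_density_add ac_density_cmult assms)
  have "ac_density (\<lambda>x. (1/4) * ((\<theta> x + \<eta> x)\<^sup>2 + (- 1) * (\<theta> x + (- 1) * \<eta> x)\<^sup>2))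
     (\<lambda>x. (1/4) * (2 * (\<theta> x + \<eta> x) * (p x + q x) + (- 1) * (2 * (\<theta> x + (- 1) * \<eta> x) * (p x + (- 1) * q x))))"
    by (intro ac_density_add ac_density_cmult 1 2)
  then show ?thesis by (simp add: power2_eq_square algebra_simps)
qed

lemma ac_density_integral_zero:
  assumes "ac_density \<theta> p" "\<And>x. \<bar>x\<bar> > B \<Longrightarrow> \<theta> x = 0 \<and> p x = 0"
  shows "integrable lborel p" "(LINT x|lborel. p x) = 0"
proof -
  \<comment> \<open>The functions vanish only for \<bar>x\<bar> strictly larger than
    \<open>B\<close>; the margin 1 puts the endpoints safely in that region.\<close>
  have p: "(\<lambda>x. indicator {- \<bar>B\<bar> - 1..\<bar>B\<bar> + 1} x *\<^sub>R p x) = p"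
  proof (rule ext)
    fix x show "indicator {- \<bar>B\<bar> - 1..\<bar>B\<bar> + 1} x *\<^sub>R p x = p x"
      using assms(2)[of x] by (cases "\<bar>x\<bar> > B") (auto simp: indicator_def)
  qed
  show "integrable lborel p" using ac_densityD(2)[OF assms(1), of "- \<bar>B\<bar> - 1" "\<bar>B\<bar> + 1"]
    unfolding set_integrable_def p .
  show "(LINT x|lborel. p x) = 0" using ac_densityD(3)[OF assms(1), of "- \<bar>B\<bar> - 1" "\<bar>B\<bar> + 1"]
    assms(2)[of "- \<bar>B\<bar> - 1"] assms(2)[of "\<bar>B\<bar> + 1"]
    unfolding set_lebesgue_integral_def p by simp
qed

text \<open>Two one-dimensional affine substitutions suffice: x = v - t at fixed t, then t = (u + v)
  / 2 at fixed v. Only the second one rescales, which produces the factor 1/2.\<close>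

lemma nn_integral_null_coordinates:
  fixes f :: "real \<times> real \<Rightarrow> ennreal"
  assumes [measurable]: "f \<in> borel_measurable borel"
  shows "(\<integral>\<^sup>+z. f z \<partial>lborel) = ennreal (1/2) * (\<integral>\<^sup>+z. f ((fst z + snd z) / 2, (snd z - fst z) / 2) \<partial>lborel)"
proof -
  have [measurable]: "f \<in> borel_measurable (lborel \<Otimes>\<^sub>M lborel)" by (simp add: lborel_prod)
  have "(\<integral>\<^sup>+z. f z \<partial>lborel) = (\<integral>\<^sup>+t. \<integral>\<^sup>+x. f (t, x) \<partial>lborel \<partial>lborel)"
    by (subst lborel_prod[symmetric], subst lborel.nn_integral_fst) auto
  also have "\<dots> = (\<integral>\<^sup>+t. \<integral>\<^sup>+v. f (t, v - t) \<partial>lborel \<partial>lborel)"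
  proof (rule nn_integral_cong)
    fix t :: real
    show "(\<integral>\<^sup>+x. f (t, x) \<partial>lborel) = (\<integral>\<^sup>+v. f (t, v - t) \<partial>lborel)"
      by (subst nn_integral_real_affine[of _ 1 "- t"]) auto
  qed
  also have "\<dots> = (\<integral>\<^sup>+v. \<integral>\<^sup>+t. f (t, v - t) \<partial>lborel \<partial>lborel)"
    by (rule lborel_pair.Fubini'[symmetric]) measurable
  also have "\<dots> = (\<integral>\<^sup>+v. ennreal (1/2) * (\<integral>\<^sup>+u. f ((u + v) / 2, (v - u) / 2) \<partial>lborel) \<partial>lborel)"
  proof (rule nn_integral_cong)
    fix v :: real
    show "(\<integral>\<^sup>+t. f (t, v - t) \<partial>lborel) = ennreal (1/2) * (\<integral>\<^sup>+u. f ((u + v) / 2, (v - u) / 2) \<partial>lborel)"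
      by (subst nn_integral_real_affine[of _ "1/2" "v/2"])
        (auto simp: field_simps intro!: arg_cong2[where f = "(*)"] nn_integral_cong arg_cong[where f = f])
  qed
  also have "\<dots> = ennreal (1/2) * (\<integral>\<^sup>+v. \<integral>\<^sup>+u. f ((u + v) / 2, (v - u) / 2) \<partial>lborel \<partial>lborel)"
    by (rule nn_integral_cmult) measurable
  also have "(\<integral>\<^sup>+v. \<integral>\<^sup>+u. f ((u + v) / 2, (v - u) / 2) \<partial>lborel \<partial>lborel)
      = (\<integral>\<^sup>+u. \<integral>\<^sup>+v. f ((u + v) / 2, (v - u) / 2) \<partial>lborel \<partial>lborel)"
    by (rule lborel_pair.Fubini') measurable
  also have "\<dots> = (\<integral>\<^sup>+z. f ((fst z + snd z) / 2, (snd z - fst z) / 2) \<partial>lborel)"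
    by (subst lborel_prod[symmetric], subst lborel.nn_integral_fst[symmetric]) auto
  finally show ?thesis .
qed

lemma ac_densityI:
  assumes "\<And>a b. set_integrable lborel {a..b} p"
    and "\<And>a b. a \<le> b \<Longrightarrow> \<theta> b - \<theta> a = (LINT x:{a..b}|lborel. p x)"
  shows "ac_density \<theta> p"
proof -
  have "isCont \<theta> x" for x
  proof -
    have "p integrable_on {x - 1..x + 1}"
      using set_borel_integral_eq_integral(1)[OF assms(1)] .
    then have "continuous_on {x - 1..x + 1} (\<lambda>y. integral {x - 1..y} p)"
      by (rule indefinite_integral_continuous_1)
    then have "continuous_on {x - 1..x + 1} (\<lambda>y. \<theta> (x - 1) + integral {x - 1..y} p)"
      by (intro continuous_intros)
    moreover have "\<theta> (x - 1) + integral {x - 1..y} p = \<theta> y" if "y \<in> {x - 1..x + 1}" for y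
      using assms(2)[of "x - 1" y] that set_borel_integral_eq_integral(2)[OF assms(1)[of "x - 1" y]] by simp
    ultimately have "continuous_on {x - 1..x + 1} \<theta>" using continuous_on_eq by blast
    then show ?thesis using continuous_on_interior[of "{x - 1..x + 1}" \<theta> x] by simp
  qed
  then show ?thesis
    unfolding ac_density_def using assms by (auto intro: continuous_at_imp_continuous_on)
qed

section \<open>Integrals in null coordinates\<close>

abbreviation null_map :: "real \<times> real \<Rightarrow> real \<times> real" where
  "null_map z \<equiv> ((fst z + snd z) / 2, (snd z - fst z) / 2)"

lemma null_map_measurable [measurable]: "null_map \<in> borel_measurable borel"
  by (auto intro!: borel_measurable_continuous_onI continuous_intros)

text \<open>Stated for measures, the substitution transfers integrability as well as the values of
  integrals of either sign.\<close>

lemma lborel_null_map: "(lborel :: (real \<times> real) measure) = density (distr lborel borel null_map) (\<lambda>_. 1/2)"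
proof (rule measure_eqI)
  fix A :: "(real \<times> real) set" assume "A \<in> sets lborel"
  then have [measurable]: "A \<in> sets borel" by simp
  have "emeasure lborel A = (\<integral>\<^sup>+z. indicator A z \<partial>lborel)" by simp
  also have "\<dots> = ennreal (1/2) * (\<integral>\<^sup>+z. indicator A (null_map z) \<partial>lborel)"
    by (rule nn_integral_null_coordinates) measurable
  also have "\<dots> = emeasure (density (distr lborel borel null_map) (\<lambda>_. 1/2)) A"
  proof -
    have "(\<integral>\<^sup>+z. indicator A (null_map z) \<partial>lborel) = (\<integral>\<^sup>+z. indicator A z \<partial>distr lborel borel null_map)"
      by (subst nn_integral_distr) auto
    then show ?thesis
      by (simp add: emeasure_density nn_integral_cmult flip: ennreal_divide_numeral)
        (simp add: divide_ennreal_def)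
  qed
  finally show "emeasure lborel A = emeasure (density (distr lborel borel null_map) (\<lambda>_. 1/2)) A" .
qed simp

lemma integrable_null_map:
  fixes f :: "real \<times> real \<Rightarrow> real"
  assumes [measurable]: "f \<in> borel_measurable borel"
  shows "integrable lborel f \<longleftrightarrow> integrable lborel (\<lambda>z. f (null_map z))"
proof -
  have "integrable lborel f \<longleftrightarrow> integrable (density (distr lborel borel null_map) (\<lambda>_. ennreal (1/2))) f"
    by (subst lborel_null_map) (simp flip: ennreal_divide_numeral add: divide_ennreal_def)
  also have "\<dots> \<longleftrightarrow> integrable (distr lborel borel null_map) (\<lambda>z. (1/2) *\<^sub>R f z)"
    by (rule integrable_density) auto
  also have "\<dots> \<longleftrightarrow> integrable lborel (\<lambda>z. (1/2) *\<^sub>R f (null_map z))"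
    by (rule integrable_distr_eq) auto
  also have "\<dots> \<longleftrightarrow> integrable lborel (\<lambda>z. f (null_map z))"
    using integrable_mult_right_iff[of lborel "\<lambda>z. f (null_map z)" "1/2"] by (simp del: integrable_mult_right_iff)
  finally show ?thesis .
qed

lemma integral_null_map:
  fixes f :: "real \<times> real \<Rightarrow> real"
  assumes [measurable]: "f \<in> borel_measurable borel"
  shows "(LINT z|lborel. f z) = (LINT z|lborel. f (null_map z)) / 2"
proof -
  have "(LINT z|lborel. f z) = (LINT z|density (distr lborel borel null_map) (\<lambda>_. ennreal (1/2)). f z)"
    by (subst lborel_null_map) (simp flip: ennreal_divide_numeral add: divide_ennreal_def)
  also have "\<dots> = (LINT z|lborel. f (null_map z)) / 2"
    by (subst integral_density) (auto simp: integral_distr)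
  finally show ?thesis .
qed

section \<open>Fubini in the plane and local integrability\<close>

lemma plane_integral_fst:
  fixes f :: "real \<times> real \<Rightarrow> real"
  assumes "integrable lborel f"
  shows "(LINT u|lborel. LINT v|lborel. f (u, v)) = (LINT z|lborel. f z)"
    and "integrable lborel (\<lambda>u. LINT v|lborel. f (u, v))"
  using lborel_pair.integral_fst'[of f] lborel_pair.integrable_fst'[of f] assms by (simp_all add: lborel_prod)

lemma plane_swap:
  fixes f :: "real \<times> real \<Rightarrow> real"
  assumes "integrable lborel f"
  shows "integrable lborel (\<lambda>z. f (snd z, fst z))"
    and "(LINT z|lborel. f (snd z, fst z)) = (LINT z|lborel. f z)"
  using lborel_pair.integrable_product_swap[of f] lborel_pair.integral_product_swap[of f] assms
  by (simp_all add: lborel_prod case_prod_unfold borel_measurable_integrable)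

lemma plane_integral_snd:
  fixes f :: "real \<times> real \<Rightarrow> real"
  assumes "integrable lborel f"
  shows "(LINT v|lborel. LINT u|lborel. f (u, v)) = (LINT z|lborel. f z)"
    and "integrable lborel (\<lambda>v. LINT u|lborel. f (u, v))"
  using plane_integral_fst[OF plane_swap(1)[OF assms]] plane_swap(2)[OF assms] by simp_all

lemma locally_integrable_mult:
  fixes f g :: "'a::euclidean_space \<Rightarrow> real"
  assumes f: "locally_integrable f" and g: "g \<in> borel_measurable borel"
    and K: "compact K" "\<And>z. z \<notin> K \<Longrightarrow> g z = 0" and C: "\<And>z. \<bar>g z\<bar> \<le> C"
  shows "integrable lborel (\<lambda>z. f z * g z)"
proof -
  have i: "integrable lborel (\<lambda>z. indicator K z * f z)"
    using f K(1) by (simp add: locally_integrable_def set_integrable_def)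
  have "integrable lborel (\<lambda>z. g z * (indicator K z * f z))"
  proof (rule Bochner_Integration.integrable_bound)
    show "integrable lborel (\<lambda>z. C * (indicator K z * f z))" using i by simp
    show "(\<lambda>z. g z * (indicator K z * f z)) \<in> borel_measurable lborel"
      using g borel_measurable_integrable[OF i] by simp
    show "AE z in lborel. norm (g z * (indicator K z * f z)) \<le> norm (C * (indicator K z * f z))"
    proof (rule AE_I2)
      fix z
      have "\<bar>g z\<bar> \<le> \<bar>C\<bar>" using C[of z] by simp
      then show "norm (g z * (indicator K z * f z)) \<le> norm (C * (indicator K z * f z))"
        unfolding norm_mult[of "g z"] norm_mult[of C] by (intro mult_right_mono) auto
    qed
  qed
  also have "(\<lambda>z. g z * (indicator K z * f z)) = (\<lambda>z. f z * g z)"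
    using K(2) by (auto simp: fun_eq_iff indicator_def)
  finally show ?thesis .
qed

lemma continuous_compact_support_bounded:
  fixes g :: "'a::euclidean_space \<Rightarrow> real"
  assumes "continuous_on UNIV g" "compact K" "\<And>z. z \<notin> K \<Longrightarrow> g z = 0"
  obtains C where "\<And>z. \<bar>g z\<bar> \<le> C"
proof -
  have "bounded (g ` K)"
    by (intro compact_imp_bounded compact_continuous_image continuous_on_subset[OF assms(1)] assms) auto
  then obtain C where C: "\<And>z. z \<in> K \<Longrightarrow> \<bar>g z\<bar> \<le> C"
    unfolding bounded_iff by (metis image_eqI real_norm_def)
  have "\<bar>g z\<bar> \<le> \<bar>C\<bar>" for z using C[of z] assms(3)[of z] by (cases "z \<in> K") auto
  then show ?thesis using that by blast
qed

lemma locally_integrable_mult_continuous: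
  fixes f g :: "'a::euclidean_space \<Rightarrow> real"
  assumes f: "locally_integrable f" and g: "continuous_on UNIV g"
    and K: "compact K" "\<And>z. z \<notin> K \<Longrightarrow> g z = 0"
  shows "integrable lborel (\<lambda>z. f z * g z)"
proof -
  obtain C where "\<And>z. \<bar>g z\<bar> \<le> C" using continuous_compact_support_bounded[OF g K] by blast
  then show ?thesis using locally_integrable_mult[OF f borel_measurable_continuous_onI[OF g] K] by blast
qed

lemma locally_integrable_continuous:
  "continuous_on UNIV f \<Longrightarrow> locally_integrable (f :: 'a::euclidean_space \<Rightarrow> real)"
  unfolding locally_integrable_def set_integrable_def
  by (intro allI impI borel_integrable_compact) (auto intro: continuous_on_subset)

text \<open>Truncations to growing balls are integrable, hence measurable, and they converge
  pointwise.\<close>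

lemma locally_integrable_measurable:
  fixes f :: "'a::euclidean_space \<Rightarrow> real"
  assumes "locally_integrable f"
  shows "f \<in> borel_measurable borel"
proof (rule borel_measurable_LIMSEQ_real)
  show "(\<lambda>n. indicator (cball 0 (real n)) z * f z) \<longlonglongrightarrow> f z" for z :: 'a
  proof (rule Lim_transform_eventually[OF tendsto_const])
    obtain N where "norm z \<le> real N" using real_arch_simple by blast
    then have "\<forall>n\<ge>N. f z = indicator (cball 0 (real n)) z * f z"
      by (force simp: indicator_def)
    then show "\<forall>\<^sub>F n in sequentially. f z = indicator (cball 0 (real n)) z * f z"
      using eventually_sequentially by blast
  qed
  have "integrable lborel (\<lambda>z. indicator (cball 0 (real n)) z * f z)" for n
    using assms by (simp add: locally_integrable_def set_integrable_def)
  then show "(\<lambda>z. indicator (cball 0 (real n)) z * f z) \<in> borel_measurable borel" for n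
    using borel_measurable_integrable by force
qed

lemma locally_integrable_null_map:
  assumes f: "locally_integrable f"
  shows "locally_integrable (\<lambda>z. f (null_map z))"
  unfolding locally_integrable_def
proof (intro allI impI)
  fix K :: "(real \<times> real) set" assume K: "compact K"
  have "compact (null_map ` K)" by (intro compact_continuous_image continuous_intros K) auto
  then have i: "integrable lborel (\<lambda>z. indicator (null_map ` K) z * f z)"
    using f by (simp add: locally_integrable_def set_integrable_def)
  have "inj null_map" by (auto simp: inj_def)
  then have ind: "indicator (null_map ` K) (null_map z) = (indicator K z :: real)" for z
    by (auto simp: indicator_def inj_image_mem_iff[of null_map] simp del: prod.inject)
  show "set_integrable lborel K (\<lambda>z. f (null_map z))"
    using integrable_null_map[of "\<lambda>z. indicator (null_map ` K) z * f z"] i borel_measurable_integrable[OF i]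
    by (simp add: set_integrable_def ind)
qed

lemma locally_integrable_box:
  fixes f :: "real \<times> real \<Rightarrow> real"
  assumes "locally_integrable f"
  shows "integrable lborel (\<lambda>z. indicator {a..b} (fst z) * (indicator {c..d} (snd z) * f z :: real))"
proof -
  have "integrable lborel (\<lambda>z. indicator (cbox (a, c) (b, d)) z * f z)"
    using assms compact_cbox unfolding locally_integrable_def set_integrable_def by fastforce
  also have "(\<lambda>z. indicator (cbox (a, c) (b, d)) z * f z) = (\<lambda>z. indicator {a..b} (fst z) * (indicator {c..d} (snd z) * f z))"
    by (auto simp: fun_eq_iff indicator_def cbox_Pair_eq cbox_interval)
  finally show ?thesis .
qed

section \<open>Functions determined by their integrals over boxes\<close>

lemma sets_borel_eq_cbox:
  "sets (borel :: 'a::euclidean_space measure) = sigma_sets UNIV (range (\<lambda>(a, b). cbox a b))"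
proof -
  have "sigma_sets (UNIV :: 'a set) {S. open S} = sigma_sets UNIV (range (\<lambda>(a, b). cbox a b))"
  proof (rule sigma_sets_eqI)
    fix S :: "'a set" assume "S \<in> {S. open S}"
    then obtain D where D: "countable D" "\<And>X. X \<in> D \<Longrightarrow> \<exists>a b. X = cbox a b" "\<Union>D = S"
      using open_countable_Union_open_cbox[of S] by (metis mem_Collect_eq)
    have "\<Union>D \<in> sigma_sets UNIV (range (\<lambda>(a, b). cbox a b))"
    proof (rule sigma_sets_UNION[OF D(1)])
      fix X assume "X \<in> D"
      then obtain a b where "X = cbox a b" using D(2) by blast
      then show "X \<in> sigma_sets UNIV (range (\<lambda>(a, b). cbox a b))"
        by (auto intro!: sigma_sets.Basic)
    qed
    then show "S \<in> sigma_sets UNIV (range (\<lambda>(a, b). cbox a b))" using D(3) by simp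
  next
    fix S :: "'a set" assume "S \<in> range (\<lambda>(a, b). cbox a b)"
    then have "S \<in> sets borel" by auto
    then show "S \<in> sigma_sets UNIV {S. open S}" unfolding borel_def by simp
  qed
  then show ?thesis unfolding borel_def by simp
qed

text \<open>Closed boxes are stable under intersection and generate the Borel sets, and the sets
  over which the integral vanishes form a Dynkin system. The restriction to a bounded box
  \<open>B\<close> makes the function integrable, as complements and countable unions
  require.\<close>

lemma AE_zero_of_boxes:
  fixes f :: "real \<times> real \<Rightarrow> real"
  assumes f: "locally_integrable f"
    and box: "\<And>a b c d. a \<le> b \<Longrightarrow> c \<le> d \<Longrightarrow>
      (LINT z|lborel. indicator {a..b} (fst z) * (indicator {c..d} (snd z) * f z)) = 0"
  shows "AE z in lborel. f z = 0"
proof -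
  have "AE z in lborel. z \<in> cbox (- real n, - real n) (real n, real n) \<longrightarrow> f z = 0" for n
  proof -
    define B where "B = cbox (- real n, - real n) (real n, real n)"
    define g where "g = (\<lambda>z. indicator B z * f z)"
    have g: "integrable lborel g"
      using f by (simp add: locally_integrable_def set_integrable_def g_def B_def)
    have [measurable]: "g \<in> borel_measurable borel" using borel_measurable_integrable[OF g] by simp
    have gbox: "(LINT z|lborel. indicator (cbox a b) z * g z) = 0" for a b
    proof -
      obtain a1 a2 b1 b2 where ab: "a = (a1, a2)" "b = (b1, b2)" by fastforce
      \<comment> \<open>The hypothesis concerns \<open>f\<close> and not its truncation, so the box
        is clipped to \<open>B\<close>; a degenerate clipped box carries no integral at all.\<close>
      let ?l1 = "max a1 (- real n)" and ?r1 = "min b1 (real n)" and ?l2 = "max a2 (- real n)" and ?r2 = "min b2 (real n)"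
      have eq: "indicator (cbox a b) z * g z = indicator {?l1..?r1} (fst z) * (indicator {?l2..?r2} (snd z) * f z)" for z
        by (cases z) (auto simp: g_def B_def ab indicator_def cbox_Pair_eq cbox_interval)
      show ?thesis
      proof (cases "?l1 \<le> ?r1 \<and> ?l2 \<le> ?r2")
        case True
        then show ?thesis unfolding eq using box[of ?l1 ?r1 ?l2 ?r2] by blast
      next
        case False
        then have "(\<lambda>z. indicator (cbox a b) z * g z) = (\<lambda>z. 0)"
          unfolding eq by (auto simp: indicator_def fun_eq_iff)
        then show ?thesis by simp
      qed
    qed
    have set: "(LINT z|lborel. indicator A z * g z) = 0" if "A \<in> sets borel" for A
    proof -
      have gi: "integrable lborel (\<lambda>z. indicator A z * g z)" if "A \<in> sets borel" for A
        using integrable_mult_indicator[of A lborel g] g that by simp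
      have top: "(LINT z|lborel. g z) = 0"
      proof -
        have "(\<lambda>z. indicator (cbox (- real n, - real n) (real n, real n)) z * g z) = g"
          by (auto simp: g_def B_def indicator_def fun_eq_iff)
        then show ?thesis using gbox[of "(- real n, - real n)" "(real n, real n)"] by simp
      qed
      have "A \<in> sigma_sets UNIV (range (\<lambda>(a, b). cbox a b))"
        using that by (simp add: sets_borel_eq_cbox)
      have IS: "Int_stable (range (\<lambda>(a, b). cbox a b :: (real \<times> real) set))"
        by (auto simp: Int_stable_def Int_interval)
      have SP: "range (\<lambda>(a, b). cbox a b :: (real \<times> real) set) \<subseteq> Pow UNIV" by simp
      show ?thesis using IS SP \<open>A \<in> sigma_sets _ _\<close>
      proof (induction rule: sigma_sets_induct_disjoint)
        case (basic A) then show ?case using gbox by auto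
      next
        case empty show ?case by simp
      next
        case (compl A)
        then have A: "A \<in> sets borel" by (simp add: sets_borel_eq_cbox)
        have "indicator (UNIV - A) z * g z = g z - indicator A z * g z" for z by (auto simp: indicator_def)
        then show ?case using compl gi[OF A] g top by simp
      next
        case (union A)
        then have A: "A i \<in> sets borel" for i
          by (auto simp add: sets_borel_eq_cbox)
        have "set_lebesgue_integral lborel (\<Union>i. A i) g = (\<Sum>i. set_lebesgue_integral lborel (A i) g)"
          using A union gi[of "\<Union>i. A i"] by (intro lebesgue_integral_countable_add)
            (auto simp: set_integrable_def disjoint_family_on_def)
        then show ?case using union by (simp add: set_lebesgue_integral_def)
      qed
    qed
    have "AE z in lborel. g z = 0"
    proof (rule density_unique_real[OF g])
      show "(LINT z:A|lborel. g z) = (LINT z:A|lborel. 0)" if "A \<in> sets lborel" for A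
        using set[of A] that by (simp add: set_lebesgue_integral_def)
    qed simp
    then show ?thesis by (rule eventually_mono) (auto simp: g_def B_def indicator_def)
  qed
  then have "AE z in lborel. \<forall>n. z \<in> cbox (- real n, - real n) (real n, real n) \<longrightarrow> f z = 0"
    by (subst AE_all_countable) blast
  then show ?thesis
  proof (rule eventually_mono)
    fix z assume *: "\<forall>n. z \<in> cbox (- real n, - real n) (real n, real n) \<longrightarrow> f z = 0"
    obtain n where "\<bar>fst z\<bar> + \<bar>snd z\<bar> \<le> real n" using real_arch_simple by blast
    then have "z \<in> cbox (- real n, - real n) (real n, real n)" by (cases z) auto
    then show "f z = 0" using * by blast
  qed
qed

section \<open>Weak derivatives in null coordinates\<close>

lemma continuous_parameter_integral:
  fixes \<theta> :: "real \<times> real \<Rightarrow> real"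
  assumes \<theta>: "continuous_on UNIV \<theta>" and g: "continuous_on UNIV g" "\<And>v. \<bar>v\<bar> > B \<Longrightarrow> g v = 0"
  shows "continuous_on UNIV (\<lambda>u. LINT v|lborel. \<theta> (u, v) * g v)"
proof -
  have eq: "(LINT v|lborel. \<theta> (u, v) * g v) = integral (cbox (- B) B) (\<lambda>v. \<theta> (u, v) * g v)" for u
  proof -
    have c: "continuous_on A (\<lambda>v. \<theta> (u, v) * g v)" for A
      by (intro continuous_on_mult continuous_on_compose2[OF \<theta>] continuous_on_subset[OF g(1)] continuous_intros) auto
    have "set_integrable lborel {- B..B} (\<lambda>v. \<theta> (u, v) * g v)"
      by (rule borel_integrable_atLeastAtMost'[OF c])
    from set_borel_integral_eq_integral(2)[OF this]
    have "integral (cbox (- B) B) (\<lambda>v. \<theta> (u, v) * g v) = (LINT v:{- B..B}|lborel. \<theta> (u, v) * g v)"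
      by (simp add: cbox_interval)
    moreover have "(\<lambda>v. indicator {- B..B} v *\<^sub>R (\<theta> (u, v) * g v)) = (\<lambda>v. \<theta> (u, v) * g v)"
    proof (rule ext)
      fix v show "indicator {- B..B} v *\<^sub>R (\<theta> (u, v) * g v) = \<theta> (u, v) * g v"
        using g(2)[of v] by (cases "\<bar>v\<bar> > B") (auto simp: indicator_def)
    qed
    ultimately show ?thesis unfolding set_lebesgue_integral_def by metis
  qed
  have "continuous_on (UNIV \<times> cbox (- B) B) (\<lambda>(u, v). \<theta> (u, v) * g v)"
    unfolding case_prod_unfold
    by (intro continuous_on_mult continuous_on_compose2[OF \<theta>] continuous_on_compose2[OF g(1)] continuous_intros) auto
  then have "continuous_on UNIV (\<lambda>u. integral (cbox (- B) B) (\<lambda>v. \<theta> (u, v) * g v))"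
    by (rule integral_continuous_on_param)
  then show ?thesis unfolding eq .
qed

lemma bumpD:
  assumes "bump P P'"
  shows "continuous_on A P" "continuous_on A P'" "\<exists>B. \<forall>x. \<bar>x\<bar> > B \<longrightarrow> P x = 0 \<and> P' x = 0"
  using assms smooth_fun_continuous smooth_fun_derivative_unique unfolding bump_def by blast+

lemma locally_integrable_mult_product:
  fixes w :: "real \<times> real \<Rightarrow> real"
  assumes w: "locally_integrable w" and P: "continuous_on UNIV P" "\<And>x. \<bar>x\<bar> > B \<Longrightarrow> P x = 0"
    and g: "continuous_on UNIV g" "\<And>x. \<bar>x\<bar> > C \<Longrightarrow> g x = 0"
  shows "integrable lborel (\<lambda>z. w z * (P (fst z) * g (snd z)))"
proof (rule locally_integrable_mult_continuous[OF w])
  show "continuous_on UNIV (\<lambda>z. P (fst z) * g (snd z))"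
    by (intro continuous_on_mult continuous_on_compose2[OF P(1)] continuous_on_compose2[OF g(1)] continuous_intros) auto
  show "compact (cbox (- B, - C) (B, C))" by (rule compact_cbox)
  show "P (fst z) * g (snd z) = 0" if "z \<notin> cbox (- B, - C) (B, C)" for z
    using that P(2)[of "fst z"] g(2)[of "snd z"] by (cases z) (force simp: cbox_Pair_eq cbox_interval)
qed

text \<open>Freezing the v-profile reduces the weak equation to one variable: u \<mapsto>
  \<integral> \<theta> g dv has the density u \<mapsto> \<integral> w g' dv by
  \<open>du_Bois_Reymond\<close>. Here \<open>g'\<close> is just a second profile. It equals
  \<open>g\<close> in the application to first derivatives; for the mixed derivative
  \<open>g\<close> is the derivative of \<open>g'\<close>.\<close>

lemma weak_partial_integrated:
  fixes \<theta> w :: "real \<times> real \<Rightarrow> real"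
  assumes \<theta>: "continuous_on UNIV \<theta>" and w: "locally_integrable w"
    and g: "continuous_on UNIV g" "\<And>v. \<bar>v\<bar> > B \<Longrightarrow> g v = 0"
    and g': "continuous_on UNIV g'" "\<And>v. \<bar>v\<bar> > C \<Longrightarrow> g' v = 0"
    and weak: "\<And>P P'. bump P P' \<Longrightarrow>
      (LINT z|lborel. \<theta> z * (P' (fst z) * g (snd z))) = - (LINT z|lborel. w z * (P (fst z) * g' (snd z)))"
    and u: "u0 \<le> u1"
  shows "(LINT v|lborel. (\<theta> (u1, v) - \<theta> (u0, v)) * g v) = (LINT v|lborel. (LINT u:{u0..u1}|lborel. w (u, v)) * g' v)"
    and "integrable lborel (\<lambda>v. (LINT u:{u0..u1}|lborel. w (u, v)) * g' v)"
proof -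
  define F where "F = (\<lambda>u. LINT v|lborel. \<theta> (u, v) * g v)"
  define H where "H = (\<lambda>u. LINT v|lborel. w (u, v) * g' v)"
  have F: "continuous_on UNIV F" unfolding F_def by (rule continuous_parameter_integral[OF \<theta> g])
  have box: "integrable lborel (\<lambda>z. indicator {a..b} (fst z) * (w z * g' (snd z)))" for a b
  proof -
    have "bounded (g' ` {- C..C})"
      by (intro compact_imp_bounded compact_continuous_image continuous_on_subset[OF g'(1)]) auto
    then obtain K where K: "\<And>x. x \<in> {- C..C} \<Longrightarrow> \<bar>g' x\<bar> \<le> K"
      unfolding bounded_iff by (metis image_eqI real_norm_def)
    have g'0: "g' v = 0" if "v \<notin> {- C..C}" for v using that g'(2)[of v] by force
    have gK: "\<bar>g' v\<bar> \<le> \<bar>K\<bar>" for v using K[of v] g'0[of v] by (cases "v \<in> {- C..C}") auto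
    have [measurable]: "g' \<in> borel_measurable borel" by (rule borel_measurable_continuous_onI[OF g'(1)])
    have "integrable lborel (\<lambda>z. w z * (indicator {a..b} (fst z) * g' (snd z)))"
    proof (rule locally_integrable_mult[OF w])
      show "(\<lambda>z. indicator {a..b} (fst z) * g' (snd z)) \<in> borel_measurable borel"
        by (simp add: borel_prod[symmetric])
      show "compact (cbox (a, - C) (b, C))" by (rule compact_cbox)
      show "indicator {a..b} (fst z) * g' (snd z) = 0" if "z \<notin> cbox (a, - C) (b, C)" for z
        using that g'0[of "snd z"] by (cases z) (auto simp: cbox_Pair_eq cbox_interval)
      show "\<bar>indicator {a..b} (fst z) * g' (snd z)\<bar> \<le> \<bar>K\<bar>" for z
        using gK[of "snd z"] by (auto simp: abs_mult indicator_def)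
    qed
    then show ?thesis by (simp add: mult.left_commute)
  qed
  have H: "set_integrable lborel {a..b} H" for a b
    using plane_integral_fst(2)[OF box[of a b]] by (simp add: set_integrable_def H_def)
  have "F u1 - F u0 = (LINT u:{u0..u1}|lborel. H u)"
  proof (rule du_Bois_Reymond[OF F H _ u])
    fix P P' assume P: "bump P P'"
    obtain B' where B': "\<And>x. \<bar>x\<bar> > B' \<Longrightarrow> P x = 0" "\<And>x. \<bar>x\<bar> > B' \<Longrightarrow> P' x = 0" using bumpD(3)[OF P] by blast
    have "(LINT u|lborel. F u * P' u) = (LINT u|lborel. LINT v|lborel. \<theta> (u, v) * (P' u * g v))"
      by (simp add: F_def mult.left_commute mult.commute[of "P' _"] mult.assoc flip: integral_mult_left_zero integral_mult_right_zero)
    also have "\<dots> = (LINT z|lborel. \<theta> z * (P' (fst z) * g (snd z)))"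
      using plane_integral_fst(1)[OF locally_integrable_mult_product[OF locally_integrable_continuous[OF \<theta>] bumpD(2)[OF P] B'(2) g]]
      by simp
    also have "\<dots> = - (LINT z|lborel. w z * (P (fst z) * g' (snd z)))" by (rule weak[OF P])
    also have "(LINT z|lborel. w z * (P (fst z) * g' (snd z))) = (LINT u|lborel. LINT v|lborel. w (u, v) * (P u * g' v))"
      using plane_integral_fst(1)[OF locally_integrable_mult_product[OF w bumpD(1)[OF P] B'(1) g']]
      by simp
    also have "\<dots> = (LINT u|lborel. H u * P u)"
      by (simp add: H_def mult.left_commute mult.commute[of "P _"] mult.assoc flip: integral_mult_left_zero integral_mult_right_zero)
    finally show "(LINT u|lborel. F u * P' u) = - (LINT u|lborel. H u * P u)" .
  qed
  also have "F u1 - F u0 = (LINT v|lborel. (\<theta> (u1, v) - \<theta> (u0, v)) * g v)"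
  proof -
    have "integrable lborel (\<lambda>v. \<theta> (u, v) * g v)" for u
    proof (rule integrable_compact_support)
      show "continuous_on UNIV (\<lambda>v. \<theta> (u, v) * g v)"
        by (intro continuous_on_mult continuous_on_compose2[OF \<theta>] g(1) continuous_intros) auto
      show "compact {- B..B}" by simp
      show "\<theta> (u, v) * g v = 0" if "v \<notin> {- B..B}" for v using that g(2)[of v] by force
    qed
    then show ?thesis by (simp add: F_def left_diff_distrib)
  qed
  also have "(LINT u:{u0..u1}|lborel. H u) = (LINT u|lborel. LINT v|lborel. indicator {u0..u1} u * (w (u, v) * g' v))"
    by (simp add: set_lebesgue_integral_def H_def)
  also have "\<dots> = (LINT v|lborel. LINT u|lborel. indicator {u0..u1} u * (w (u, v) * g' v))"
    using plane_integral_fst(1)[OF box] plane_integral_snd(1)[OF box] by simp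
  also have "\<dots> = (LINT v|lborel. (LINT u:{u0..u1}|lborel. w (u, v)) * g' v)"
    by (simp add: set_lebesgue_integral_def mult.assoc flip: integral_mult_left_zero)
  finally show "(LINT v|lborel. (\<theta> (u1, v) - \<theta> (u0, v)) * g v) = (LINT v|lborel. (LINT u:{u0..u1}|lborel. w (u, v)) * g' v)" .
  show "integrable lborel (\<lambda>v. (LINT u:{u0..u1}|lborel. w (u, v)) * g' v)"
    using plane_integral_snd(2)[OF box[of u0 u1]]
    by (simp add: set_lebesgue_integral_def mult.assoc flip: integral_mult_left_zero)
qed

lemma set_integrable_slice_integral:
  fixes w :: "real \<times> real \<Rightarrow> real"
  assumes "locally_integrable w"
  shows "set_integrable lborel {c..d} (\<lambda>v. LINT u:{a..b}|lborel. w (u, v))"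
    and "(LINT v:{c..d}|lborel. LINT u:{a..b}|lborel. w (u, v))
      = (LINT z|lborel. indicator {a..b} (fst z) * (indicator {c..d} (snd z) * w z))"
    and "set_integrable lborel {a..b} (\<lambda>u. LINT v:{c..d}|lborel. w (u, v))"
    and "(LINT u:{a..b}|lborel. LINT v:{c..d}|lborel. w (u, v))
      = (LINT z|lborel. indicator {a..b} (fst z) * (indicator {c..d} (snd z) * w z))"
proof -
  note b = locally_integrable_box[OF assms, of a b c d]
  show "set_integrable lborel {c..d} (\<lambda>v. LINT u:{a..b}|lborel. w (u, v))"
    "(LINT v:{c..d}|lborel. LINT u:{a..b}|lborel. w (u, v))
      = (LINT z|lborel. indicator {a..b} (fst z) * (indicator {c..d} (snd z) * w z))"
    using plane_integral_snd[OF b]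
    by (simp_all add: set_integrable_def set_lebesgue_integral_def mult.left_commute[of "indicator {a..b} _"])
  show "set_integrable lborel {a..b} (\<lambda>u. LINT v:{c..d}|lborel. w (u, v))"
    "(LINT u:{a..b}|lborel. LINT v:{c..d}|lborel. w (u, v))
      = (LINT z|lborel. indicator {a..b} (fst z) * (indicator {c..d} (snd z) * w z))"
    using plane_integral_fst[OF b]
    by (simp_all add: set_integrable_def set_lebesgue_integral_def)
qed

lemma set_integrable_continuous:
  fixes f :: "real \<Rightarrow> real"
  shows "continuous_on UNIV f \<Longrightarrow> set_integrable lborel {a..b} f"
  by (rule borel_integrable_atLeastAtMost'[OF continuous_on_subset]) auto

text \<open>The weak equation, already integrated in u, says that a function of v is orthogonal to
  all bumps. \<open>du_Bois_Reymond\<close> with F = 0 is then the fundamental lemma: the integral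
  of that function over every interval is 0.\<close>

lemma weak_derivative_increment:
  fixes \<theta> w :: "real \<times> real \<Rightarrow> real"
  assumes \<theta>: "continuous_on UNIV \<theta>" and w: "locally_integrable w"
    and weak: "\<And>P P' Q Q'. bump P P' \<Longrightarrow> bump Q Q' \<Longrightarrow>
      (LINT z|lborel. \<theta> z * (P' (fst z) * Q (snd z))) = - (LINT z|lborel. w z * (P (fst z) * Q (snd z)))"
    and uv: "u0 \<le> u1" "v0 \<le> v1"
  shows "(LINT v:{v0..v1}|lborel. \<theta> (u1, v) - \<theta> (u0, v))
      = (LINT z|lborel. indicator {u0..u1} (fst z) * (indicator {v0..v1} (snd z) * w z))"
proof -
  define W where "W = (\<lambda>v. LINT u:{u0..u1}|lborel. w (u, v))"
  have D: "continuous_on UNIV (\<lambda>v. \<theta> (u1, v) - \<theta> (u0, v))"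
    by (intro continuous_on_diff continuous_on_compose2[OF \<theta>] continuous_intros) auto
  have W: "set_integrable lborel {a..b} W" for a b
    unfolding W_def by (rule set_integrable_slice_integral(1)[OF w])
  have "(0::real) - 0 = (LINT v:{v0..v1}|lborel. (\<theta> (u1, v) - \<theta> (u0, v)) - W v)"
  proof (rule du_Bois_Reymond[where F = "\<lambda>_. 0", OF _ _ _ uv(2)])
    show "set_integrable lborel {a..b} (\<lambda>v. (\<theta> (u1, v) - \<theta> (u0, v)) - W v)" for a b
      by (intro set_integral_diff(1) set_integrable_continuous D W)
    fix Q Q' assume Q: "bump Q Q'"
    obtain B where B: "\<And>x. \<bar>x\<bar> > B \<Longrightarrow> Q x = 0" using bumpD(3)[OF Q] by blast
    have wpi: "(LINT v|lborel. (\<theta> (u1, v) - \<theta> (u0, v)) * Q v) = (LINT v|lborel. W v * Q v)"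
        "integrable lborel (\<lambda>v. W v * Q v)"
      unfolding W_def
      by (rule weak_partial_integrated[OF \<theta> w bumpD(1)[OF Q] B bumpD(1)[OF Q] B weak[OF _ Q] uv(1)]; assumption)+
    have "integrable lborel (\<lambda>v. (\<theta> (u1, v) - \<theta> (u0, v)) * Q v)"
      by (rule integrable_compact_support[where K = "{- B..B}"])
        (use B in \<open>force intro!: continuous_on_mult D bumpD(1)[OF Q]\<close>)+
    then show "(LINT v|lborel. 0 * Q' v) = - (LINT v|lborel. (\<theta> (u1, v) - \<theta> (u0, v) - W v) * Q v)"
      using wpi by (simp add: left_diff_distrib[of _ "W _"])
  qed auto
  also have "\<dots> = (LINT v:{v0..v1}|lborel. \<theta> (u1, v) - \<theta> (u0, v)) - (LINT v:{v0..v1}|lborel. W v)"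
    by (intro set_integral_diff(2) set_integrable_continuous D W)
  finally show ?thesis
    using set_integrable_slice_integral(2)[OF w, of v0 v1 u0 u1] by (simp add: W_def)
qed

text \<open>The one-dimensional lemma is applied twice, in u through
  \<open>weak_partial_integrated\<close> and then in v. Bump derivatives fall on both variables, so
  the mixed equation determines second differences of \<theta> at every point.\<close>

lemma weak_second_difference:
  fixes \<theta> G :: "real \<times> real \<Rightarrow> real"
  assumes \<theta>: "continuous_on UNIV \<theta>" and G: "continuous_on UNIV G"
    and weak: "\<And>P P' Q Q'. bump P P' \<Longrightarrow> bump Q Q' \<Longrightarrow>
      (LINT z|lborel. \<theta> z * (P' (fst z) * Q' (snd z))) = (LINT z|lborel. G z * (P (fst z) * Q (snd z)))"
    and uv: "u0 \<le> u1" "v0 \<le> v1"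
  shows "\<theta> (u1, v1) - \<theta> (u0, v1) - (\<theta> (u1, v0) - \<theta> (u0, v0))
      = (LINT v:{v0..v1}|lborel. LINT u:{u0..u1}|lborel. G (u, v))"
proof -
  have G': "locally_integrable (\<lambda>z. - G z)" and Gl: "locally_integrable G"
    using G by (auto intro!: locally_integrable_continuous continuous_intros)
  have D: "continuous_on UNIV (\<lambda>v. \<theta> (u1, v) - \<theta> (u0, v))"
    by (intro continuous_on_diff continuous_on_compose2[OF \<theta>] continuous_intros) auto
  show ?thesis
  proof (rule du_Bois_Reymond[OF D set_integrable_slice_integral(1)[OF Gl] _ uv(2)])
    fix Q Q' assume Q: "bump Q Q'"
    obtain B where B: "\<And>x. \<bar>x\<bar> > B \<Longrightarrow> Q x = 0" "\<And>x. \<bar>x\<bar> > B \<Longrightarrow> Q' x = 0" using bumpD(3)[OF Q] by blast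
    have "(LINT v|lborel. (\<theta> (u1, v) - \<theta> (u0, v)) * Q' v) = (LINT v|lborel. (LINT u:{u0..u1}|lborel. - G (u, v)) * Q v)"
      by (rule weak_partial_integrated(1)[OF \<theta> G' bumpD(2)[OF Q] B(2) bumpD(1)[OF Q] B(1) _ uv(1)])
        (use weak[OF _ Q] in auto)
    then show "(LINT v|lborel. (\<theta> (u1, v) - \<theta> (u0, v)) * Q' v) = - (LINT v|lborel. (LINT u:{u0..u1}|lborel. G (u, v)) * Q v)"
      by (simp add: set_lebesgue_integral_def)
  qed
qed

lemma locally_integrable_fst:
  assumes \<alpha>: "\<And>a b. set_integrable lborel {a..b} \<alpha>" and [measurable]: "\<alpha> \<in> borel_measurable borel"
  shows "locally_integrable (\<lambda>z :: real \<times> real. \<alpha> (fst z) :: real)"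
  unfolding locally_integrable_def
proof (intro allI impI)
  fix K :: "(real \<times> real) set" assume K: "compact K"
  obtain a b where "K \<subseteq> cbox a b" using bounded_subset_cbox_symmetric[OF compact_imp_bounded[OF K]] by blast
  then obtain a1 a2 b1 b2 where KB: "K \<subseteq> cbox (a1, a2) (b1, b2)" by (metis surj_pair)
  have "integrable (lborel \<Otimes>\<^sub>M lborel) (\<lambda>z. indicator {a1..b1} (fst z) * \<alpha> (fst z) * indicator {a2..b2} (snd z))"
  proof (rule lborel_pair.Fubini_integrable)
    have i: "integrable lborel (\<lambda>u. indicator {a1..b1} u * \<alpha> u)"
      using \<alpha>[of a1 b1] by (simp add: set_integrable_def)
    have "(LINT v|lborel. norm (indicator {a1..b1} u * \<alpha> u * indicator {a2..b2} v))
        = \<bar>indicator {a1..b1} u * \<alpha> u\<bar> * measure lborel {a2..b2}" for u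
      by (simp add: abs_mult)
    then show "integrable lborel (\<lambda>u. LINT v|lborel. norm (indicator {a1..b1} (fst (u, v)) * \<alpha> (fst (u, v)) * indicator {a2..b2} (snd (u, v))))"
      using i by (simp only: fst_conv snd_conv) auto
    show "AE u in lborel. integrable lborel (\<lambda>v. indicator {a1..b1} (fst (u, v)) * \<alpha> (fst (u, v)) * indicator {a2..b2} (snd (u, v)))"
      by (intro AE_I2) (auto intro!: integrable_mult_right simp: emeasure_lborel_Icc_eq)
  qed simp
  then have "set_integrable lborel (cbox (a1, a2) (b1, b2)) (\<lambda>z. \<alpha> (fst z))"
    unfolding lborel_prod set_integrable_def
    by (rule Bochner_Integration.integrable_cong[THEN iffD1, rotated 2])
      (auto simp: indicator_def cbox_Pair_eq cbox_interval)
  then show "set_integrable lborel K (\<lambda>z. \<alpha> (fst z))"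
    by (rule set_integrable_subset) (use KB K in \<open>auto intro: borel_compact\<close>)
qed

text \<open>Second differences of \<theta> are integrals of \<open>G\<close>, so the v-dependence of
  \<theta>_u must be \<open>J\<close>, the integral of \<open>G\<close> from 0 to v, plus a function
  \<alpha> of u alone. The sum \<alpha> + \<open>J\<close> is a representative of \<open>w\<close>
  that is a density on every line v = const and continuously differentiable in v for every u, which
  no arbitrary representative of a weak derivative would be.\<close>

lemma null_density_exists:
  fixes \<theta> w G :: "real \<times> real \<Rightarrow> real"
  assumes \<theta>: "continuous_on UNIV \<theta>" and G: "continuous_on UNIV G" and w: "locally_integrable w"
    and weak1: "\<And>P P' Q Q'. bump P P' \<Longrightarrow> bump Q Q' \<Longrightarrow>
      (LINT z|lborel. \<theta> z * (P' (fst z) * Q (snd z))) = - (LINT z|lborel. w z * (P (fst z) * Q (snd z)))"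
    and weak2: "\<And>P P' Q Q'. bump P P' \<Longrightarrow> bump Q Q' \<Longrightarrow>
      (LINT z|lborel. \<theta> z * (P' (fst z) * Q' (snd z))) = (LINT z|lborel. G z * (P (fst z) * Q (snd z)))"
  obtains p where "p \<in> borel_measurable borel" "AE z in lborel. p z = w z"
    "\<And>v. ac_density (\<lambda>u. \<theta> (u, v)) (\<lambda>u. p (u, v))"
    "\<And>u v. ((\<lambda>v. p (u, v)) has_real_derivative G (u, v)) (at v)"
proof -
  \<comment> \<open>The integral of \<open>G (u, y)\<close> over y from 0 to v, rescaled to {0..1}:
    this covers negative v with the correct sign and makes \<open>J\<close> jointly continuous as a
    parameter integral.\<close>
  define J where "J = (\<lambda>z. integral {0..1} (\<lambda>s. snd z * G (fst z, s * snd z)))"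
  have "continuous_on (UNIV \<times> cbox 0 1) (\<lambda>(z, s::real). snd z * G (fst z, s * snd z))"
    unfolding case_prod_unfold
    by (intro continuous_on_mult continuous_on_compose2[OF G] continuous_intros) auto
  then have J: "continuous_on UNIV J"
    unfolding J_def cbox_interval[symmetric] by (rule integral_continuous_on_param)
  have Jd: "((\<lambda>v. J (u, v)) has_real_derivative G (u, v)) (at v)" and J0: "J (u, 0) = 0" for u v
  proof -
    have cG: "isCont (\<lambda>y. G (u, y)) y" for y
      by (rule continuous_on_interior[of UNIV]) (auto intro!: continuous_on_compose2[OF G] continuous_intros)
    obtain F where F: "\<And>y. (F has_real_derivative G (u, y)) (at y)"
      using einterval_antiderivative[of "-\<infinity>" "\<infinity>" "\<lambda>y. G (u, y)"] cG
      by (auto simp: has_real_derivative_iff_has_vector_derivative)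
    have "J (u, y) = F y - F 0" for y
    proof -
      have "((\<lambda>s. y * G (u, s * y)) has_integral F (1 * y) - F (0 * y)) {0..1}"
      proof (rule fundamental_theorem_of_calculus)
        fix s :: real
        have "((\<lambda>s. F (s * y)) has_real_derivative G (u, s * y) * y) (at s)"
          by (rule DERIV_chain2[OF F]) (auto intro!: derivative_eq_intros)
        then show "((\<lambda>s. F (s * y)) has_vector_derivative y * G (u, s * y)) (at s within {0..1})"
          by (simp add: has_real_derivative_iff_has_vector_derivative[symmetric] mult.commute
              has_field_derivative_at_within)
      qed simp
      from integral_unique[OF this] show ?thesis by (simp add: J_def)
    qed
    then show "((\<lambda>v. J (u, v)) has_real_derivative G (u, v)) (at v)" "J (u, 0) = 0"
      by (auto intro!: derivative_eq_intros F)
  qed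
  have GJ: "(LINT y:{v0..v1}|lborel. G (u, y)) = J (u, v1) - J (u, v0)" if "v0 \<le> v1" for u v0 v1
    using ac_densityD(3)[OF ac_density_of_continuous_deriv[OF Jd] that]
    by (simp add: continuous_on_compose2[OF G] continuous_intros)
  have Jl: "locally_integrable J" by (rule locally_integrable_continuous[OF J])
  have Ju: "continuous_on A (\<lambda>u. J (u, v))" for A v
    by (intro continuous_on_compose2[OF J] continuous_intros) auto
  define \<Delta> where "\<Delta> = (\<lambda>u0 u1 v. \<theta> (u1, v) - \<theta> (u0, v))"
  have \<Delta>c: "continuous_on A (\<Delta> u0 u1)" for A u0 u1
    unfolding \<Delta>_def by (intro continuous_intros continuous_on_compose2[OF \<theta>]) auto
  have diff: "\<Delta> u0 u1 v1 - \<Delta> u0 u1 v0 = (LINT u:{u0..u1}|lborel. J (u, v1)) - (LINT u:{u0..u1}|lborel. J (u, v0))"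
    if "u0 \<le> u1" "v0 \<le> v1" for u0 u1 v0 v1
  proof -
    have "\<Delta> u0 u1 v1 - \<Delta> u0 u1 v0 = (LINT v:{v0..v1}|lborel. LINT u:{u0..u1}|lborel. G (u, v))"
      unfolding \<Delta>_def by (rule weak_second_difference[OF \<theta> G weak2 that])
    also have "\<dots> = (LINT u:{u0..u1}|lborel. LINT v:{v0..v1}|lborel. G (u, v))"
      unfolding set_integrable_slice_integral(2,4)[OF locally_integrable_continuous[OF G]] ..
    also have "\<dots> = (LINT u:{u0..u1}|lborel. J (u, v1) - J (u, v0))"
      using GJ[OF that(2)] by simp
    also have "\<dots> = (LINT u:{u0..u1}|lborel. J (u, v1)) - (LINT u:{u0..u1}|lborel. J (u, v0))"
      by (intro set_integral_diff(2) set_integrable_continuous Ju)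
    finally show ?thesis .
  qed
  have \<Delta>J: "\<Delta> u0 u1 v - \<Delta> u0 u1 0 = (LINT u:{u0..u1}|lborel. J (u, v))" if "u0 \<le> u1" for u0 u1 v
  proof -
    have "(LINT u:{u0..u1}|lborel. J (u, 0)) = 0" by (simp add: J0 set_lebesgue_integral_def)
    then show ?thesis using diff[OF that, of 0 v] diff[OF that, of v 0] by (cases "0 \<le> v") auto
  qed
  \<comment> \<open>As w - J turns out not to depend on v, its mean over an interval of length 1
    recovers it.\<close>
  define \<alpha> where "\<alpha> = (\<lambda>u. LINT v:{0..1}|lborel. w (u, v) - J (u, v))"
  have wJ: "locally_integrable (\<lambda>z. w z - J z)"
    using w Jl unfolding locally_integrable_def by (auto intro: set_integral_diff)
  have boxint: "integrable lborel (\<lambda>z. indicator {a..b} (fst z) * (indicator {c..d} (snd z) * w z))"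
      "integrable lborel (\<lambda>z. indicator {a..b} (fst z) * (indicator {c..d} (snd z) * J z))" for a b c d
    by (intro locally_integrable_box w Jl)+
  \<comment> \<open>Over a box, w - J integrates to the length in v times a quantity depending on
    the u-interval only; this expresses that w - J is a function of u.\<close>
  have box: "(LINT z|lborel. indicator {u0..u1} (fst z) * (indicator {v0..v1} (snd z) * (w z - J z)))
      = (v1 - v0) * \<Delta> u0 u1 0" if "u0 \<le> u1" "v0 \<le> v1" for u0 u1 v0 v1
  proof -
    have "(LINT z|lborel. indicator {u0..u1} (fst z) * (indicator {v0..v1} (snd z) * (w z - J z)))
      = (LINT z|lborel. indicator {u0..u1} (fst z) * (indicator {v0..v1} (snd z) * w z))
        - (LINT z|lborel. indicator {u0..u1} (fst z) * (indicator {v0..v1} (snd z) * J z))"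
      unfolding right_diff_distrib by (rule Bochner_Integration.integral_diff[OF boxint])
    also have "\<dots> = (LINT v:{v0..v1}|lborel. \<Delta> u0 u1 v) - (LINT v:{v0..v1}|lborel. LINT u:{u0..u1}|lborel. J (u, v))"
    proof -
      have "(LINT v:{v0..v1}|lborel. \<Delta> u0 u1 v) = (LINT z|lborel. indicator {u0..u1} (fst z) * (indicator {v0..v1} (snd z) * w z))"
        unfolding \<Delta>_def by (rule weak_derivative_increment[OF \<theta> w weak1 that])
      then show ?thesis using set_integrable_slice_integral(2)[OF Jl, of v0 v1 u0 u1] by presburger
    qed
    also have "\<dots> = (LINT v:{v0..v1}|lborel. \<Delta> u0 u1 v - (LINT u:{u0..u1}|lborel. J (u, v)))"
      by (intro set_integral_diff(2)[symmetric] set_integrable_continuous \<Delta>c set_integrable_slice_integral(1)[OF Jl])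
    also have "\<dots> = (LINT v:{v0..v1}|lborel. \<Delta> u0 u1 0)"
      using \<Delta>J[OF that(1)] by (simp flip: \<Delta>J[OF that(1)])
    also have "\<dots> = (v1 - v0) * \<Delta> u0 u1 0"
      using that by (simp add: set_lebesgue_integral_def)
    finally show ?thesis .
  qed
  have \<alpha>i: "set_integrable lborel {a..b} \<alpha>" for a b
    unfolding \<alpha>_def by (rule set_integrable_slice_integral(3)[OF wJ])
  have \<alpha>\<Delta>: "(LINT u:{u0..u1}|lborel. \<alpha> u) = \<Delta> u0 u1 0" if "u0 \<le> u1" for u0 u1
    unfolding \<alpha>_def using set_integrable_slice_integral(4)[OF wJ] box[OF that, of 0 1] by simp
  have wm [measurable]: "w \<in> borel_measurable borel" by (rule locally_integrable_measurable[OF w])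
  have Jm [measurable]: "J \<in> borel_measurable borel" by (rule borel_measurable_continuous_onI[OF J])
  have \<alpha>m [measurable]: "\<alpha> \<in> borel_measurable borel"
  proof -
    have "(\<lambda>u. LINT v|lborel. indicator {0..1} v *\<^sub>R (w (u, v) - J (u, v))) \<in> borel_measurable borel"
      by (rule lborel.borel_measurable_lebesgue_integral) measurable
    then show ?thesis by (simp add: \<alpha>_def set_lebesgue_integral_def)
  qed
  have \<alpha>l: "locally_integrable (\<lambda>z :: real \<times> real. \<alpha> (fst z))"
    by (rule locally_integrable_fst[OF \<alpha>i \<alpha>m])
  have ae: "AE z in lborel. (w z - J z) - \<alpha> (fst z) = 0"
  proof (rule AE_zero_of_boxes)
    show "locally_integrable (\<lambda>z. (w z - J z) - \<alpha> (fst z))"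
      using wJ \<alpha>l unfolding locally_integrable_def by (auto intro: set_integral_diff)
    fix a b c d :: real assume ab: "a \<le> b" and cd: "c \<le> d"
    have "(LINT z|lborel. indicator {a..b} (fst z) * (indicator {c..d} (snd z) * \<alpha> (fst z)))
        = (LINT v:{c..d}|lborel. LINT u:{a..b}|lborel. \<alpha> u)"
      using set_integrable_slice_integral(2)[OF \<alpha>l, of c d a b] by simp
    also have "\<dots> = (d - c) * \<Delta> a b 0"
      unfolding \<alpha>\<Delta>[OF ab] using cd by (simp add: set_lebesgue_integral_def)
    finally show "(LINT z|lborel. indicator {a..b} (fst z) * (indicator {c..d} (snd z) * (w z - J z - \<alpha> (fst z)))) = 0"
      using box[OF ab cd] Bochner_Integration.integral_diff[OF locally_integrable_box[OF wJ] locally_integrable_box[OF \<alpha>l], of a b c d a b c d]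
      by (simp add: right_diff_distrib)
  qed
  show ?thesis
  proof
    show "(\<lambda>z. \<alpha> (fst z) + J z) \<in> borel_measurable borel"
      using locally_integrable_measurable[OF \<alpha>l] Jm by (rule borel_measurable_add)
    show "AE z in lborel. \<alpha> (fst z) + J z = w z" using ae by (rule eventually_mono) simp
    show "ac_density (\<lambda>u. \<theta> (u, v)) (\<lambda>u. \<alpha> (fst (u, v)) + J (u, v))" for v
    proof (rule ac_densityI)
      show "set_integrable lborel {a..b} (\<lambda>u. \<alpha> (fst (u, v)) + J (u, v))" for a b
        using \<alpha>i set_integrable_continuous[OF Ju] by (auto intro: set_integral_add)
      fix a b :: real assume ab: "a \<le> b"
      have "(LINT u:{a..b}|lborel. \<alpha> (fst (u, v)) + J (u, v)) = (LINT u:{a..b}|lborel. \<alpha> u) + (LINT u:{a..b}|lborel. J (u, v))"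
        using \<alpha>i set_integrable_continuous[OF Ju] by (simp add: set_integral_add)
      then show "\<theta> (b, v) - \<theta> (a, v) = (LINT u:{a..b}|lborel. \<alpha> (fst (u, v)) + J (u, v))"
        using \<alpha>\<Delta>[OF ab] \<Delta>J[OF ab, of v] by (simp add: \<Delta>_def)
    qed
    show "((\<lambda>v. \<alpha> (fst (u, v)) + J (u, v)) has_real_derivative G (u, v)) (at v)" for u v
      using DERIV_add[OF DERIV_const Jd] by simp
  qed
qed

section \<open>Integrability over time slabs\<close>

lemma abs_add_powr_le:
  fixes a b q :: real
  assumes "q \<ge> 0"
  shows "\<bar>a + b\<bar> powr q \<le> 2 powr q * (\<bar>a\<bar> powr q + \<bar>b\<bar> powr q)"
proof -
  have "\<bar>a + b\<bar> powr q \<le> (2 * max \<bar>a\<bar> \<bar>b\<bar>) powr q"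
    using assms by (intro powr_mono2) auto
  also have "\<dots> = 2 powr q * (max \<bar>a\<bar> \<bar>b\<bar>) powr q" by (simp add: powr_mult)
  also have "\<dots> \<le> 2 powr q * (\<bar>a\<bar> powr q + \<bar>b\<bar> powr q)"
    by (intro mult_left_mono) (auto simp: max_def)
  finally show ?thesis .
qed

text \<open>Continuity at \<open>t0\<close> bounds the norm near \<open>t0\<close>, and bisection of
  {a..b} spreads such local bounds over the whole compact interval.\<close>

lemma C_t_Lp_locally_bounded:
  assumes u: "C_t_Lp q u" and q: "q > 0" and ab: "a \<le> b"
  shows "\<exists>C. \<forall>t\<in>{a..b}. (LINT x|lborel. \<bar>u (t, x)\<bar> powr q) \<le> C"
proof (rule Bolzano[OF ab])
  define N where "N = (\<lambda>t. LINT x|lborel. \<bar>u (t, x)\<bar> powr q)"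
  fix a b c :: real
  assume "\<exists>C. \<forall>t\<in>{a..b}. (LINT x|lborel. \<bar>u (t, x)\<bar> powr q) \<le> C"
    and "\<exists>C. \<forall>t\<in>{b..c}. (LINT x|lborel. \<bar>u (t, x)\<bar> powr q) \<le> C" and "a \<le> b" "b \<le> c"
  then obtain C1 C2 where "\<forall>t\<in>{a..b}. N t \<le> C1" "\<forall>t\<in>{b..c}. N t \<le> C2" unfolding N_def by blast
  then have "\<forall>t\<in>{a..c}. N t \<le> max C1 C2" by (metis atLeastAtMost_iff le_max_iff_disj linear)
  then show "\<exists>C. \<forall>t\<in>{a..c}. (LINT x|lborel. \<bar>u (t, x)\<bar> powr q) \<le> C" unfolding N_def by blast
next
  fix t0 assume "a \<le> t0" "t0 \<le> b"
  have Lq: "in_Lp q (\<lambda>x. u (t, x))" for t using u by (simp add: C_t_Lp_def)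
  have "((\<lambda>t. Lp_norm q (\<lambda>x. u (t, x) - u (t0, x))) \<longlongrightarrow> 0) (at t0)" using u by (simp add: C_t_Lp_def)
  from order_tendstoD(2)[OF this, of 1]
  obtain d where d: "d > 0" "\<And>t. t \<noteq> t0 \<Longrightarrow> dist t t0 < d \<Longrightarrow> Lp_norm q (\<lambda>x. u (t, x) - u (t0, x)) < 1"
    unfolding eventually_at by auto
  \<comment> \<open>Near \<open>t0\<close> the slice lies within distance 1 of the slice at
    \<open>t0\<close>; the crude inequality \<open>abs_add_powr_le\<close> replaces the triangle
    inequality of the norm.\<close>
  define C where "C = 2 powr q * (1 + (LINT x|lborel. \<bar>u (t0, x)\<bar> powr q))"
  have "(LINT x|lborel. \<bar>u (t, x)\<bar> powr q) \<le> C" if t: "dist t t0 < d" for t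
  proof -
    have i: "integrable lborel (\<lambda>x. \<bar>u (s, x)\<bar> powr q)" and m [measurable]: "(\<lambda>x. u (s, x)) \<in> borel_measurable borel" for s
      using Lq[of s] by (auto simp: in_Lp_def)
    have iD: "integrable lborel (\<lambda>x. \<bar>u (t, x) - u (t0, x)\<bar> powr q)"
    proof (rule Bochner_Integration.integrable_bound)
      show "integrable lborel (\<lambda>x. 2 powr q * (\<bar>u (t, x)\<bar> powr q + \<bar>u (t0, x)\<bar> powr q))" using i by simp
      show "AE x in lborel. norm (\<bar>u (t, x) - u (t0, x)\<bar> powr q) \<le> norm (2 powr q * (\<bar>u (t, x)\<bar> powr q + \<bar>u (t0, x)\<bar> powr q))"
        using abs_add_powr_le[of q "u (t, x)" "- u (t0, x)" for x] q by (intro AE_I2) auto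
    qed measurable
    have "(LINT x|lborel. \<bar>u (t, x) - u (t0, x)\<bar> powr q) \<le> 1"
    proof (cases "t = t0")
      case False
      define y where "y = (LINT x|lborel. \<bar>u (t, x) - u (t0, x)\<bar> powr q)"
      have "y powr (1 / q) < 1" using d(2)[OF False t] by (simp add: Lp_norm_def y_def)
      then have "\<not> 1 \<le> y" using ge_one_powr_ge_zero[of y "1 / q"] q by auto
      then show ?thesis by (simp add: y_def)
    qed simp
    have "(LINT x|lborel. \<bar>u (t, x)\<bar> powr q)
        \<le> (LINT x|lborel. 2 powr q * (\<bar>u (t, x) - u (t0, x)\<bar> powr q + \<bar>u (t0, x)\<bar> powr q))"
    proof (rule integral_mono[OF i])
      show "integrable lborel (\<lambda>x. 2 powr q * (\<bar>u (t, x) - u (t0, x)\<bar> powr q + \<bar>u (t0, x)\<bar> powr q))"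
        using iD i by simp
      show "\<bar>u (t, x)\<bar> powr q \<le> 2 powr q * (\<bar>u (t, x) - u (t0, x)\<bar> powr q + \<bar>u (t0, x)\<bar> powr q)" for x
        using abs_add_powr_le[of q "u (t, x) - u (t0, x)" "u (t0, x)"] q by simp
    qed
    also have "\<dots> = 2 powr q * ((LINT x|lborel. \<bar>u (t, x) - u (t0, x)\<bar> powr q) + (LINT x|lborel. \<bar>u (t0, x)\<bar> powr q))"
      using iD i by simp
    also have "\<dots> \<le> C" unfolding C_def using \<open>_ \<le> 1\<close> by (intro mult_left_mono) auto
    finally show ?thesis .
  qed
  then show "\<exists>d>0. \<forall>a b. a \<le> t0 \<and> t0 \<le> b \<and> b - a < d \<longrightarrow>
      (\<exists>C. \<forall>t\<in>{a..b}. (LINT x|lborel. \<bar>u (t, x)\<bar> powr q) \<le> C)"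
    using d(1) by (intro exI[of _ d] conjI allI impI exI[of _ C] ballI) (auto simp: dist_real_def)
qed

lemma C_t_Lp_slab_integrable:
  assumes u: "C_t_Lp q u" and q: "q > 0" and [measurable]: "u \<in> borel_measurable borel"
  shows "set_integrable lborel {z. a \<le> fst z \<and> fst z \<le> b} (\<lambda>z. \<bar>u z\<bar> powr q)"
proof (cases "a \<le> b")
  case False
  then have "{z :: real \<times> real. a \<le> fst z \<and> fst z \<le> b} = {}" by auto
  then show ?thesis by (simp add: set_integrable_def)
next
  case True
  obtain C where C: "\<And>t. t \<in> {a..b} \<Longrightarrow> (LINT x|lborel. \<bar>u (t, x)\<bar> powr q) \<le> C"
    using C_t_Lp_locally_bounded[OF u q True] by blast
  let ?f = "\<lambda>z. indicator {a..b} (fst z) * \<bar>u z\<bar> powr q"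
  have [measurable]: "(\<lambda>z. indicator {a..b} (fst z) :: real) \<in> borel_measurable (borel :: (real \<times> real) measure)"
    by (simp add: borel_prod[symmetric])
  have [measurable]: "?f \<in> borel_measurable borel" by measurable
  have "(\<integral>\<^sup>+z. ennreal (norm (?f z)) \<partial>lborel) = (\<integral>\<^sup>+t. \<integral>\<^sup>+x. ennreal (?f (t, x)) \<partial>lborel \<partial>lborel)"
    by (subst lborel_prod[symmetric], subst lborel.nn_integral_fst[symmetric]) (auto simp: lborel_prod)
  also have "\<dots> \<le> (\<integral>\<^sup>+t. ennreal C * indicator {a..b} t \<partial>lborel)"
  proof (rule nn_integral_mono)
    fix t
    show "(\<integral>\<^sup>+x. ennreal (?f (t, x)) \<partial>lborel) \<le> ennreal C * indicator {a..b} t"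
    proof (cases "t \<in> {a..b}")
      case t: True
      have "integrable lborel (\<lambda>x. \<bar>u (t, x)\<bar> powr q)" using u by (simp add: C_t_Lp_def in_Lp_def)
      then have "(\<integral>\<^sup>+x. ennreal (\<bar>u (t, x)\<bar> powr q) \<partial>lborel) = ennreal (LINT x|lborel. \<bar>u (t, x)\<bar> powr q)"
        by (rule nn_integral_eq_integral) simp
      then show ?thesis using C[OF t] t by (simp add: ennreal_leI)
    qed simp
  qed
  also have "\<dots> < \<infinity>" using True by (simp add: nn_integral_cmult ennreal_mult_less_top)
  finally have "integrable lborel ?f" by (intro integrableI_bounded) auto
  then show ?thesis
    unfolding set_integrable_def
    by (rule Bochner_Integration.integrable_cong[THEN iffD1, rotated 2]) (auto simp: indicator_def)
qed

section \<open>Finite energy solutions in null coordinates\<close>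

lemma null_product_integral:
  fixes f :: "real \<times> real \<Rightarrow> real"
  assumes f: "locally_integrable f" and P: "bump P P'" and Q: "bump Q Q'"
  shows "integrable lborel (\<lambda>z. f z * (P (fst z - snd z) * Q (fst z + snd z)))"
    and "(LINT z|lborel. f z * (P (fst z - snd z) * Q (fst z + snd z)))
      = (LINT z|lborel. f (null_map z) * (P (fst z) * Q (snd z))) / 2"
proof -
  obtain B C where B: "\<And>x. \<bar>x\<bar> > B \<Longrightarrow> P x = 0" and C: "\<And>x. \<bar>x\<bar> > C \<Longrightarrow> Q x = 0"
    using bumpD(3)[OF P] bumpD(3)[OF Q] by metis
  have [measurable]: "f \<in> borel_measurable borel" by (rule locally_integrable_measurable[OF f])
  have [measurable]: "P \<in> borel_measurable borel" "Q \<in> borel_measurable borel"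
    by (intro borel_measurable_continuous_onI bumpD(1)[OF P] bumpD(1)[OF Q])+
  have m: "(\<lambda>z. P (fst z - snd z) * Q (fst z + snd z)) \<in> borel_measurable borel"
    by (intro borel_measurable_continuous_onI continuous_on_mult continuous_on_compose2[OF bumpD(1)[OF P, of UNIV]]
      continuous_on_compose2[OF bumpD(1)[OF Q, of UNIV]] continuous_intros) auto
  have "integrable lborel (\<lambda>z. f (null_map z) * (P (fst z) * Q (snd z)))"
    by (rule locally_integrable_mult_product[OF locally_integrable_null_map[OF f] bumpD(1)[OF P] B bumpD(1)[OF Q] C])
  moreover have "fst (null_map z) - snd (null_map z) = fst z" "fst (null_map z) + snd (null_map z) = snd z" for z :: "real \<times> real"
    by (simp_all add: field_simps)
  ultimately show "integrable lborel (\<lambda>z. f z * (P (fst z - snd z) * Q (fst z + snd z)))"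
    "(LINT z|lborel. f z * (P (fst z - snd z) * Q (fst z + snd z)))
      = (LINT z|lborel. f (null_map z) * (P (fst z) * Q (snd z))) / 2"
    using integrable_null_map[of "\<lambda>z. f z * (P (fst z - snd z) * Q (fst z + snd z))"]
      integral_null_map[of "\<lambda>z. f z * (P (fst z - snd z) * Q (fst z + snd z))"] m by simp_all
qed

definition null_force :: "real \<Rightarrow> real \<Rightarrow> real" where
  "null_force P s = - (1/4) * (\<bar>s\<bar> powr (P - 1) * s)"

lemma continuous_on_powr_abs:
  fixes f :: "'a::topological_space \<Rightarrow> real"
  assumes "continuous_on A f" "q > 0"
  shows "continuous_on A (\<lambda>x. \<bar>f x\<bar> powr q)"
  using assms by (intro continuous_on_powr') (auto intro!: continuous_intros)

lemma continuous_null_force: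
  fixes f :: "'a::topological_space \<Rightarrow> real"
  assumes "continuous_on A f" "P > 1"
  shows "continuous_on A (\<lambda>x. null_force P (f x))"
  unfolding null_force_def using assms by (intro continuous_intros continuous_on_powr_abs) auto

text \<open>The regularity that survives for energy class solutions: \<open>p\<close> and
  \<open>q\<close> stand for \<theta>_u and \<theta>_v, each a mere density in its own direction but
  differentiable in the other one, and on every line rather than almost every line. The condition
  \<open>slab\<close> is the finiteness of the energy integrated over bounded times, as fst z + snd
  z = 2t. The conditions are symmetric in u and v.\<close>

locale null_wave =
  fixes P :: real and \<theta> p q :: "real \<times> real \<Rightarrow> real"
  assumes P: "P > 1"
    and \<theta>: "continuous_on UNIV \<theta>"
    and p_meas [measurable]: "p \<in> borel_measurable borel" and q_meas [measurable]: "q \<in> borel_measurable borel"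
    and \<theta>_u: "\<And>v. ac_density (\<lambda>u. \<theta> (u, v)) (\<lambda>u. p (u, v))"
    and \<theta>_v: "\<And>u. ac_density (\<lambda>v. \<theta> (u, v)) (\<lambda>v. q (u, v))"
    and p_v: "\<And>u v. ((\<lambda>v. p (u, v)) has_real_derivative null_force P (\<theta> (u, v))) (at v)"
    and q_u: "\<And>u v. ((\<lambda>u. q (u, v)) has_real_derivative null_force P (\<theta> (u, v))) (at u)"
    and slab: "\<And>a b. set_integrable lborel {z. a \<le> fst z + snd z \<and> fst z + snd z \<le> b}
        (\<lambda>z. (p z)\<^sup>2 + (q z)\<^sup>2 + \<bar>\<theta> z\<bar> powr (P + 1))"

lemma borel_measurable_swap [measurable]:
  "(\<lambda>z. (snd z, fst z)) \<in> borel_measurable (borel :: (real \<times> real) measure)"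
  by (auto intro!: borel_measurable_continuous_onI continuous_intros)

lemma continuous_on_swap:
  "continuous_on UNIV f \<Longrightarrow> continuous_on UNIV (\<lambda>z :: real \<times> real. f (snd z, fst z) :: real)"
  by (rule continuous_on_compose2) (auto intro!: continuous_intros)

text \<open>This is the reflection x \<mapsto> -x. It yields every statement about \<open>q\<close>
  from the one about \<open>p\<close>.\<close>

lemma (in null_wave) null_wave_swap:
  "null_wave P (\<lambda>z. \<theta> (snd z, fst z)) (\<lambda>z. q (snd z, fst z)) (\<lambda>z. p (snd z, fst z))"
proof
  show "continuous_on UNIV (\<lambda>z. \<theta> (snd z, fst z))" by (rule continuous_on_swap[OF \<theta>])
  show "set_integrable lborel {z. a \<le> fst z + snd z \<and> fst z + snd z \<le> b}
      (\<lambda>z. (q (snd z, fst z))\<^sup>2 + (p (snd z, fst z))\<^sup>2 + \<bar>\<theta> (snd z, fst z)\<bar> powr (P + 1))" for a b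
    using plane_swap(1)[OF slab[of a b, unfolded set_integrable_def]]
    unfolding set_integrable_def
    by (rule Bochner_Integration.integrable_cong[THEN iffD1, rotated 2]) (auto simp: indicator_def)
qed (use P \<theta>_u \<theta>_v p_v q_u in simp_all)

lemma set_integrable_add3:
  assumes "set_integrable M A f" "set_integrable M A g" "set_integrable M A (h :: _ \<Rightarrow> real)"
  shows "set_integrable M A (\<lambda>x. f x + g x + h x)"
  using assms by (intro set_integral_add) auto

text \<open>On products of a function of u and a function of v the weak equations decouple into weak
  derivatives in u and in v and a weak mixed derivative, which are the hypotheses of
  \<open>null_density_exists\<close>.\<close>

lemma finite_energy_solution_null_wave:
  assumes sol: "finite_energy_solution P \<phi> \<phi>0 \<phi>1" and P: "P > 1"
  shows "\<exists>p q. null_wave P (\<lambda>z. \<phi> (null_map z)) p q"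
proof -
  obtain \<phi>t \<phi>x where wt: "has_weak_deriv (1, 0) \<phi> \<phi>t" and wx: "has_weak_deriv (0, 1) \<phi> \<phi>x"
    and Ct: "C_t_Lp 2 \<phi>t" and Cx: "C_t_Lp 2 \<phi>x" and C\<phi>: "C_t_Lp (P + 1) \<phi>"
    and \<phi>: "continuous_on UNIV \<phi>" and dist: "distributional_solution P \<phi>"
    using sol unfolding finite_energy_solution_def by blast
  define \<theta> where "\<theta> = (\<lambda>z. \<phi> (null_map z))"
  define a where "a = (\<lambda>z. (\<phi>t z - \<phi>x z) / 2)"
  define b where "b = (\<lambda>z. (\<phi>t z + \<phi>x z) / 2)"
  define N where "N = (\<lambda>z. \<bar>\<phi> z\<bar> powr (P - 1) * \<phi> z)"
  define G where "G = (\<lambda>z. null_force P (\<theta> z))"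
  have \<theta>: "continuous_on UNIV \<theta>"
    unfolding \<theta>_def by (intro continuous_on_compose2[OF \<phi>] continuous_intros) auto
  have G: "continuous_on UNIV G" unfolding G_def by (rule continuous_null_force[OF \<theta> P])
  have lt: "locally_integrable \<phi>t" and lx: "locally_integrable \<phi>x"
    using wt wx by (auto simp: has_weak_deriv_def)
  have l\<phi>: "locally_integrable \<phi>" by (rule locally_integrable_continuous[OF \<phi>])
  have lN: "locally_integrable N"
    unfolding N_def using P by (intro locally_integrable_continuous continuous_intros continuous_on_powr_abs \<phi>) auto
  have la: "locally_integrable a" and lb: "locally_integrable b"
    using lt lx unfolding a_def b_def locally_integrable_def by (auto intro: set_integral_diff set_integral_add)
  define I where "I = (\<lambda>(f :: real \<times> real \<Rightarrow> real) (P :: real \<Rightarrow> real) Q. LINT z|lborel. f z * (P (fst z - snd z) * Q (fst z + snd z)) :: real)"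
  \<comment> \<open>The time and the space equation contain the same two integrals with different
    signs; half their difference and half their sum isolate them.\<close>
  have weakd: "I \<phi> P' Q = - I a P Q" "I \<phi> P Q' = - I b P Q" if PQ: "bump P P'" "bump Q Q'" for P P' Q Q'
  proof -
    obtain P'' Q'' where PQ': "bump P' P''" "bump Q' Q''" using bump_deriv_exists PQ by metis
    let ?\<psi> = "\<lambda>z. P (fst z - snd z) * Q (fst z + snd z)"
    note np = null_product_integral(1)
    have "(LINT z|lborel. \<phi> z * dir_deriv (1, 0) ?\<psi> z) = - (LINT z|lborel. \<phi>t z * ?\<psi> z)"
      using wt null_product_test_function(1)[OF PQ] unfolding has_weak_deriv_def by blast
    then have 1: "I \<phi> P' Q + I \<phi> P Q' = - I \<phi>t P Q"
      unfolding I_def null_product_test_function(2)[OF PQ]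
      using np[OF l\<phi> PQ'(1) PQ(2)] np[OF l\<phi> PQ(1) PQ'(2)] by (simp add: distrib_left)
    have "(LINT z|lborel. \<phi> z * dir_deriv (0, 1) ?\<psi> z) = - (LINT z|lborel. \<phi>x z * ?\<psi> z)"
      using wx null_product_test_function(1)[OF PQ] unfolding has_weak_deriv_def by blast
    then have 2: "- I \<phi> P' Q + I \<phi> P Q' = - I \<phi>x P Q"
      unfolding I_def null_product_test_function(2)[OF PQ]
      using np[OF l\<phi> PQ'(1) PQ(2)] np[OF l\<phi> PQ(1) PQ'(2)] by (simp add: distrib_left right_diff_distrib)
    have "I a P Q = (I \<phi>t P Q - I \<phi>x P Q) / 2" "I b P Q = (I \<phi>t P Q + I \<phi>x P Q) / 2"
      unfolding I_def a_def b_def using np[OF lt PQ] np[OF lx PQ]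
      by (simp_all add: left_diff_distrib distrib_right diff_divide_distrib add_divide_distrib)
    then show "I \<phi> P' Q = - I a P Q" "I \<phi> P Q' = - I b P Q" using 1 2 by simp_all
  qed
  have weak2: "- 4 * I \<phi> P' Q' = I N P Q" if PQ: "bump P P'" "bump Q Q'" for P P' Q Q'
  proof -
    obtain P'' Q'' where PQ': "bump P' P''" "bump Q' Q''" using bump_deriv_exists PQ by metis
    let ?\<psi> = "\<lambda>z. P (fst z - snd z) * Q (fst z + snd z)"
    \<comment> \<open>In null coordinates the wave operator is -4 times the mixed derivative, so
      only the product of the two first derivatives survives. This -4 is the origin of -1/4 in
      \<open>null_force\<close>.\<close>
    have eq: "- dir_deriv (1, 0) (dir_deriv (1, 0) ?\<psi>) z + dir_deriv (0, 1) (dir_deriv (0, 1) ?\<psi>) z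
        = - 4 * (P' (fst z - snd z) * Q' (fst z + snd z))" for z
    proof -
      have d: "dir_deriv h ?\<psi> = (\<lambda>z. (fst h - snd h) * (P' (fst z - snd z) * Q (fst z + snd z))
         + (fst h + snd h) * (P (fst z - snd z) * Q' (fst z + snd z)))" for h
        by (rule ext) (rule null_product_test_function(2)[OF PQ])
      note hd = has_derivative_add[OF has_derivative_mult_right[OF null_product_has_derivative[OF PQ'(1) PQ(2)]]
          has_derivative_mult_right[OF null_product_has_derivative[OF PQ(1) PQ'(2)]]]
      show ?thesis unfolding d dir_deriv_eq[OF hd] by (simp add: algebra_simps)
    qed
    have "(LINT z|lborel. \<phi> z * (- dir_deriv (1, 0) (dir_deriv (1, 0) ?\<psi>) z + dir_deriv (0, 1) (dir_deriv (0, 1) ?\<psi>) z))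
        = (LINT z|lborel. N z * ?\<psi> z)"
      using dist null_product_test_function(1)[OF PQ] unfolding distributional_solution_def N_def by blast
    then show ?thesis unfolding eq I_def mult.left_commute[of "\<phi> _" "- 4"] integral_mult_right_zero .
  qed
  have nI: "I f P Q = (LINT z|lborel. f (null_map z) * (P (fst z) * Q (snd z))) / 2"
    if "locally_integrable f" "bump P P'" "bump Q Q'" for f P P' Q Q'
    unfolding I_def by (rule null_product_integral(2)[OF that])
  have w1: "(LINT z|lborel. \<theta> z * (P' (fst z) * Q (snd z))) = - (LINT z|lborel. a (null_map z) * (P (fst z) * Q (snd z)))"
    and w1': "(LINT z|lborel. \<theta> z * (P (fst z) * Q' (snd z))) = - (LINT z|lborel. b (null_map z) * (P (fst z) * Q (snd z)))"
    and w2: "(LINT z|lborel. \<theta> z * (P' (fst z) * Q' (snd z))) = (LINT z|lborel. G z * (P (fst z) * Q (snd z)))"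
    if PQ: "bump P P'" "bump Q Q'" for P P' Q Q'
  proof -
    obtain P'' Q'' where PQ': "bump P' P''" "bump Q' Q''" using bump_deriv_exists PQ by metis
    show "(LINT z|lborel. \<theta> z * (P' (fst z) * Q (snd z))) = - (LINT z|lborel. a (null_map z) * (P (fst z) * Q (snd z)))"
      using weakd(1)[OF PQ] nI[OF l\<phi> PQ'(1) PQ(2)] nI[OF la PQ] unfolding \<theta>_def by linarith
    show "(LINT z|lborel. \<theta> z * (P (fst z) * Q' (snd z))) = - (LINT z|lborel. b (null_map z) * (P (fst z) * Q (snd z)))"
      using weakd(2)[OF PQ] nI[OF l\<phi> PQ(1) PQ'(2)] nI[OF lb PQ] unfolding \<theta>_def by linarith
    have "(LINT z|lborel. G z * (P (fst z) * Q (snd z))) = - (1/4) * (LINT z|lborel. N (null_map z) * (P (fst z) * Q (snd z)))"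
      by (simp add: G_def null_force_def N_def \<theta>_def mult.assoc)
    then show "(LINT z|lborel. \<theta> z * (P' (fst z) * Q' (snd z))) = (LINT z|lborel. G z * (P (fst z) * Q (snd z)))"
      using weak2[OF PQ] nI[OF l\<phi> PQ'] nI[OF lN PQ] unfolding \<theta>_def by linarith
  qed
  obtain p where p [measurable]: "p \<in> borel_measurable borel" and pa: "AE z in lborel. p z = a (null_map z)"
    and pu: "\<And>v. ac_density (\<lambda>u. \<theta> (u, v)) (\<lambda>u. p (u, v))"
    and pv: "\<And>u v. ((\<lambda>v. p (u, v)) has_real_derivative G (u, v)) (at v)"
  proof (rule null_density_exists[OF \<theta> G locally_integrable_null_map[OF la]])
    fix P P' Q Q' assume PQ: "bump P P'" "bump Q Q'"
    show "(LINT z|lborel. \<theta> z * (P' (fst z) * Q (snd z))) = - (LINT z|lborel. a (null_map z) * (P (fst z) * Q (snd z)))"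
      by (rule w1[OF PQ])
    show "(LINT z|lborel. \<theta> z * (P' (fst z) * Q' (snd z))) = (LINT z|lborel. G z * (P (fst z) * Q (snd z)))"
      by (rule w2[OF PQ])
  qed auto
  have swapI: "(LINT z|lborel. f (snd z, fst z) * (P (fst z) * Q (snd z))) = (LINT z|lborel. f z * (Q (fst z) * P (snd z)))"
    if F: "locally_integrable f" "bump P P'" "bump Q Q'" for f P P' Q Q'
  proof -
    obtain B C where "\<And>x. \<bar>x\<bar> > B \<Longrightarrow> P x = 0" and "\<And>x. \<bar>x\<bar> > C \<Longrightarrow> Q x = 0"
      using bumpD(3)[OF F(2)] bumpD(3)[OF F(3)] by metis
    then show ?thesis
      using plane_swap(2)[OF locally_integrable_mult_product[OF F(1) bumpD(1)[OF F(3)] _ bumpD(1)[OF F(2)]], of C B]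
      by (simp add: mult.commute)
  qed
  have lswap: "locally_integrable (\<lambda>z. f (snd z, fst z))" if "locally_integrable f" for f :: "real \<times> real \<Rightarrow> real"
    unfolding locally_integrable_def
  proof (intro allI impI)
    fix K :: "(real \<times> real) set" assume "compact K"
    then have "compact ((\<lambda>z. (snd z, fst z)) ` K)" by (intro compact_continuous_image continuous_intros)
    then have "integrable lborel (\<lambda>z. indicator ((\<lambda>z. (snd z, fst z)) ` K) z * f z)"
      using that by (simp add: locally_integrable_def set_integrable_def)
    from plane_swap(1)[OF this] show "set_integrable lborel K (\<lambda>z. f (snd z, fst z))"
      unfolding set_integrable_def
      by (rule Bochner_Integration.integrable_cong[THEN iffD1, rotated 2]) (auto simp: indicator_def image_iff)
  qed
  \<comment> \<open>For \<theta>_v the construction is applied to the reflected function and the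
    result is reflected back.\<close>
  obtain q' where q' [measurable]: "q' \<in> borel_measurable borel" and qb': "AE z in lborel. q' z = b (null_map (snd z, fst z))"
    and qv': "\<And>v. ac_density (\<lambda>u. \<theta> (v, u)) (\<lambda>u. q' (u, v))"
    and qu': "\<And>u v. ((\<lambda>v. q' (u, v)) has_real_derivative G (v, u)) (at v)"
  proof (rule null_density_exists[of "\<lambda>z. \<theta> (snd z, fst z)" "\<lambda>z. G (snd z, fst z)" "\<lambda>z. b (null_map (snd z, fst z))"])
    show "continuous_on UNIV (\<lambda>z. \<theta> (snd z, fst z))" "continuous_on UNIV (\<lambda>z. G (snd z, fst z))"
      by (intro continuous_on_swap \<theta> G)+
    show lb': "locally_integrable (\<lambda>z. b (null_map (snd z, fst z)))"
      by (rule lswap[OF locally_integrable_null_map[OF lb]])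
    fix P P' Q Q' assume PQ: "bump P P'" "bump Q Q'"
    obtain P'' Q'' where PQ': "bump P' P''" "bump Q' Q''" using bump_deriv_exists PQ by metis
    show "(LINT z|lborel. \<theta> (snd z, fst z) * (P' (fst z) * Q (snd z))) = - (LINT z|lborel. b (null_map (snd z, fst z)) * (P (fst z) * Q (snd z)))"
      using swapI[OF locally_integrable_continuous[OF \<theta>] PQ'(1) PQ(2)] swapI[OF locally_integrable_null_map[OF lb] PQ]
        w1'[OF PQ(2,1)] by simp
    show "(LINT z|lborel. \<theta> (snd z, fst z) * (P' (fst z) * Q' (snd z))) = (LINT z|lborel. G (snd z, fst z) * (P (fst z) * Q (snd z)))"
      using swapI[OF locally_integrable_continuous[OF \<theta>] PQ'] swapI[OF locally_integrable_continuous[OF G] PQ]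
        w2[OF PQ(2,1)] by simp
  qed auto
  define q where "q = (\<lambda>z. q' (snd z, fst z))"
  have q [measurable]: "q \<in> borel_measurable borel" unfolding q_def by measurable
  have qb: "AE z in lborel. q z = b (null_map z)"
  proof -
    have [measurable]: "(\<lambda>z. b (null_map z)) \<in> borel_measurable borel"
      by (rule locally_integrable_measurable[OF locally_integrable_null_map[OF lb]])
    have sw: "(lborel :: (real \<times> real) measure) = distr lborel borel (\<lambda>z. (snd z, fst z))"
    proof -
      have "(lborel :: (real \<times> real) measure) = distr lborel lborel (\<lambda>z. (snd z, fst z))"
        using lborel_pair.distr_pair_swap[where ?'a = real and ?'b = real]
        by (simp add: lborel_prod case_prod_unfold)
      also have "\<dots> = distr lborel borel (\<lambda>z. (snd z, fst z))" by (rule distr_cong) auto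
      finally show ?thesis .
    qed
    have "AE z in distr lborel borel (\<lambda>z. (snd z, fst z)). q z = b (null_map z)"
      unfolding q_def by (subst AE_distr_iff) (use qb' in auto)
    then show ?thesis by (subst sw)
  qed
  have "set_integrable lborel {z. c \<le> fst z + snd z \<and> fst z + snd z \<le> d} (\<lambda>z. (p z)\<^sup>2 + (q z)\<^sup>2 + \<bar>\<theta> z\<bar> powr (P + 1))" for c d
  proof -
    have [measurable]: "\<phi>t \<in> borel_measurable borel" "\<phi>x \<in> borel_measurable borel" "\<phi> \<in> borel_measurable borel"
      using lt lx l\<phi> by (auto intro: locally_integrable_measurable)
    let ?A = "{z. c / 2 \<le> fst z \<and> fst z \<le> d / 2}"
    have [measurable]: "?A \<in> sets borel"
      by (intro borel_closed closed_Collect_conj closed_Collect_le continuous_intros)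
    have "set_integrable lborel ?A (\<lambda>z. \<bar>\<phi>t z\<bar> powr 2 + \<bar>\<phi>x z\<bar> powr 2 + \<bar>\<phi> z\<bar> powr (P + 1))"
      by (intro set_integrable_add3 C_t_Lp_slab_integrable Ct Cx C\<phi>) (use P in auto)
    moreover have "\<bar>x\<bar> powr 2 = x\<^sup>2" for x :: real by simp
    ultimately have i: "integrable lborel (\<lambda>z. indicator ?A z * ((\<phi>t z)\<^sup>2 + (\<phi>x z)\<^sup>2 + \<bar>\<phi> z\<bar> powr (P + 1)))"
      by (simp add: set_integrable_def)
    let ?S = "{z. c \<le> fst z + snd z \<and> fst z + snd z \<le> d}"
    have "integrable lborel (\<lambda>z. indicator ?A (null_map z) * ((\<phi>t (null_map z))\<^sup>2 + (\<phi>x (null_map z))\<^sup>2 + \<bar>\<phi> (null_map z)\<bar> powr (P + 1)))"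
      using integrable_null_map[of "\<lambda>z. indicator ?A z * ((\<phi>t z)\<^sup>2 + (\<phi>x z)\<^sup>2 + \<bar>\<phi> z\<bar> powr (P + 1))"] i by simp
    then have i': "integrable lborel (\<lambda>z. indicator ?S z * ((\<phi>t (null_map z))\<^sup>2 + (\<phi>x (null_map z))\<^sup>2 + \<bar>\<theta> z\<bar> powr (P + 1)))"
      by (rule Bochner_Integration.integrable_cong[THEN iffD1, rotated 2]) (auto simp: indicator_def \<theta>_def)
    have [measurable]: "?S \<in> sets borel"
      by (intro borel_closed closed_Collect_conj closed_Collect_le continuous_intros)
    have [measurable]: "\<theta> \<in> borel_measurable borel" by (rule borel_measurable_continuous_onI[OF \<theta>])
    have ab2: "(a z)\<^sup>2 \<le> (\<phi>t z)\<^sup>2 / 2 + (\<phi>x z)\<^sup>2 / 2" "(b z)\<^sup>2 \<le> (\<phi>t z)\<^sup>2 / 2 + (\<phi>x z)\<^sup>2 / 2" for z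
      using zero_le_power2[of "\<phi>t z + \<phi>x z"] zero_le_power2[of "\<phi>t z - \<phi>x z"]
      by (simp_all add: a_def b_def power2_eq_square field_simps)
    show ?thesis
      unfolding set_integrable_def
    proof (rule Bochner_Integration.integrable_bound[OF i'])
      show "(\<lambda>z. indicator ?S z *\<^sub>R ((p z)\<^sup>2 + (q z)\<^sup>2 + \<bar>\<theta> z\<bar> powr (P + 1))) \<in> borel_measurable lborel"
        by measurable
      show "AE z in lborel. norm (indicator ?S z *\<^sub>R ((p z)\<^sup>2 + (q z)\<^sup>2 + \<bar>\<theta> z\<bar> powr (P + 1)))
          \<le> norm (indicator ?S z * ((\<phi>t (null_map z))\<^sup>2 + (\<phi>x (null_map z))\<^sup>2 + \<bar>\<theta> z\<bar> powr (P + 1)))"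
        using pa qb
      proof eventually_elim
        case (elim z)
        then have "(p z)\<^sup>2 + (q z)\<^sup>2 \<le> (\<phi>t (null_map z))\<^sup>2 + (\<phi>x (null_map z))\<^sup>2"
          using ab2[of "null_map z"] by simp
        then show ?case by (auto simp: indicator_def)
      qed
    qed
  qed
  then have "null_wave P \<theta> p q"
    using P \<theta> p q pu pv qv' qu' by (intro null_wave.intro) (auto simp: q_def G_def)
  then show ?thesis unfolding \<theta>_def by blast
qed

section \<open>Multiplier identities\<close>

definition potential :: "real \<Rightarrow> real \<Rightarrow> real" where
  "potential P s = \<bar>s\<bar> powr (P + 1) / (P + 1)"

lemma potential_nonneg: "P > 1 \<Longrightarrow> potential P s \<ge> 0"
  by (simp add: potential_def)

text \<open>Away from 0 this is the power rule on either half line. At 0 the difference quotient is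
  bounded by \<bar>h\<bar> powr P, which tends to 0.\<close>

lemma potential_has_derivative:
  assumes P: "P > 1"
  shows "(potential P has_real_derivative - 4 * null_force P s) (at s)"
proof -
  consider "s > 0" | "s < 0" | "s = 0" by linarith
  then show ?thesis
  proof cases
    case 1
    have "((\<lambda>x. x powr (P + 1) / (P + 1)) has_real_derivative s powr P) (at s)"
      using 1 P by (auto intro!: derivative_eq_intros)
    then have "(potential P has_real_derivative s powr P) (at s)"
      by (rule has_field_derivative_transform_within_open[where S = "{0<..}"])
        (use 1 in \<open>auto simp: potential_def\<close>)
    moreover have "s powr P = - 4 * null_force P s"
      using 1 by (simp add: null_force_def powr_diff)
    ultimately show ?thesis by simp
  next
    case 2
    have "((\<lambda>x. (- x) powr (P + 1) / (P + 1)) has_real_derivative - ((- s) powr P)) (at s)"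
      using 2 P by (auto intro!: derivative_eq_intros)
    then have "(potential P has_real_derivative - ((- s) powr P)) (at s)"
      by (rule has_field_derivative_transform_within_open[where S = "{..<0}"])
        (use 2 in \<open>auto simp: potential_def\<close>)
    moreover have "- ((- s) powr P) = - 4 * null_force P s"
      using 2 by (simp add: null_force_def powr_diff)
    ultimately show ?thesis by simp
  next
    case 3
    have "((\<lambda>h. (potential P (0 + h) - potential P 0) / h) \<longlongrightarrow> 0) (at 0)"
    proof (rule Lim_null_comparison)
      show "\<forall>\<^sub>F h in at 0. norm ((potential P (0 + h) - potential P 0) / h) \<le> \<bar>h\<bar> powr P"
      proof (rule eventually_at_filter[THEN iffD2, OF always_eventually], intro allI impI)
        fix h :: real assume "h \<noteq> 0"
        then have "\<bar>h\<bar> powr (P + 1) / \<bar>h\<bar> = \<bar>h\<bar> powr P" by (simp add: powr_add)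
        moreover have "\<bar>h\<bar> powr P / (P + 1) \<le> \<bar>h\<bar> powr P / 1"
          using P by (intro divide_left_mono) auto
        moreover have "norm ((potential P (0 + h) - potential P 0) / h) = \<bar>h\<bar> powr (P + 1) / \<bar>h\<bar> / (P + 1)"
          using P by (simp add: potential_def abs_mult mult.commute)
        ultimately show "norm ((potential P (0 + h) - potential P 0) / h) \<le> \<bar>h\<bar> powr P" by simp
      qed
      have "continuous_on UNIV (\<lambda>h::real. \<bar>h\<bar> powr P)"
        using P by (intro continuous_on_powr_abs continuous_intros) auto
      then have "isCont (\<lambda>h::real. \<bar>h\<bar> powr P) 0" by (simp add: continuous_on_eq_continuous_at)
      then show "((\<lambda>h::real. \<bar>h\<bar> powr P) \<longlongrightarrow> 0) (at 0)" by (simp add: isCont_def)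
    qed
    then show ?thesis using 3 by (simp add: DERIV_def null_force_def)
  qed
qed

lemma continuous_potential:
  fixes f :: "'a::topological_space \<Rightarrow> real"
  assumes "continuous_on A f" "P > 1"
  shows "continuous_on A (\<lambda>x. potential P (f x))"
  unfolding potential_def using assms by (intro continuous_intros continuous_on_powr_abs) auto

lemma antiderivative_compact_support:
  fixes a :: "real \<Rightarrow> real"
  assumes a: "continuous_on UNIV a" "\<And>x. x \<notin> {l..r} \<Longrightarrow> a x = 0"
  obtains A where "\<And>x. (A has_real_derivative a x) (at x)" "\<And>x. x \<le> l \<Longrightarrow> A x = 0"
    "\<And>x. x \<ge> r \<Longrightarrow> A x = (LINT y|lborel. a y)" "\<And>x. \<bar>A x\<bar> \<le> (LINT y|lborel. \<bar>a y\<bar>)"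
proof -
  obtain F where F: "\<And>x. (F has_real_derivative a x) (at x)"
    using einterval_antiderivative[of "-\<infinity>" "\<infinity>" a] a(1)
    by (auto simp: has_real_derivative_iff_has_vector_derivative continuous_on_eq_continuous_at)
  define A where "A = (\<lambda>x. F x - F l)"
  have A: "(A has_real_derivative a x) (at x)" for x
    unfolding A_def by (auto intro!: derivative_eq_intros F)
  note ac = ac_density_of_continuous_deriv[OF A a(1)]
  have ai: "integrable lborel a"
    by (rule integrable_compact_support[OF a(1), of "{l..r}"]) (use a(2) in auto)
  have A0: "A x = 0" if "x \<le> l" for x
  proof -
    have "A l - A x = (LINT y:{x..l}|lborel. a y)" by (rule ac_densityD(3)[OF ac that])
    also have "\<dots> = 0" unfolding set_lebesgue_integral_def
      by (rule integral_eq_zero_AE)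
        (auto intro!: eventually_mono[OF AE_lborel_singleton[of l]] a(2) simp: indicator_def)
    finally show ?thesis by (simp add: A_def)
  qed
  have A1: "A x = (LINT y:{l..x}|lborel. a y)" if "x \<ge> l" for x
    using ac_densityD(3)[OF ac that] by (simp add: A_def)
  have "A x = (LINT y|lborel. a y)" if "x \<ge> r" for x
  proof (cases "x \<ge> l")
    case True
    have "indicator {l..x} y *\<^sub>R a y = a y" for y
      using a(2)[of y] that by (cases "y \<in> {l..r}") (auto simp: indicator_def)
    then have "(\<lambda>y. indicator {l..x} y *\<^sub>R a y) = a" by (rule ext)
    then show ?thesis using A1[OF True] unfolding set_lebesgue_integral_def by simp
  next
    case False
    then have "a y = 0" for y using a(2)[of y] that by auto
    then show ?thesis using A0[of x] False by simp
  qed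
  moreover have "\<bar>A x\<bar> \<le> (LINT y|lborel. \<bar>a y\<bar>)" for x
  proof (cases "x \<ge> l")
    case True
    have "\<bar>LINT y|lborel. indicator {l..x} y *\<^sub>R a y\<bar> \<le> (LINT y|lborel. \<bar>a y\<bar>)"
      using ai integrable_mult_indicator[of "{l..x}" lborel a]
      by (intro integral_abs_bound_integral) (auto simp: indicator_def)
    then show ?thesis using A1[OF True] by (simp add: set_lebesgue_integral_def)
  qed (use A0[of x] in simp)
  ultimately show ?thesis using that A A0 by blast
qed

context null_wave
begin

abbreviation pot :: "real \<times> real \<Rightarrow> real" where "pot z \<equiv> potential P (\<theta> z)"

text \<open>Half the integrand of the energy, since \<theta>_u^2 + \<theta>_v^2 = (\<phi>_t^2 +
  \<phi>_x^2) / 2.\<close>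

definition dens :: "real \<times> real \<Rightarrow> real" where
  "dens z = (p z)\<^sup>2 + (q z)\<^sup>2 + pot z"

lemma \<theta>_meas [measurable]: "\<theta> \<in> borel_measurable borel"
  by (rule borel_measurable_continuous_onI[OF \<theta>])

lemma pot_nonneg [simp]: "pot z \<ge> 0" using potential_nonneg[OF P] .

lemma pot_cont: "continuous_on UNIV pot" by (rule continuous_potential[OF \<theta> P])

lemma pot_meas [measurable]: "pot \<in> borel_measurable borel"
  by (rule borel_measurable_continuous_onI[OF pot_cont])

lemma dens_meas [measurable]: "dens \<in> borel_measurable borel"
  unfolding dens_def by measurable

lemma dens_bounds: "dens z \<ge> 0" "(p z)\<^sup>2 \<le> dens z" "(q z)\<^sup>2 \<le> dens z" "pot z \<le> dens z"
  "(p z)\<^sup>2 + pot z \<le> dens z" "(q z)\<^sup>2 + pot z \<le> dens z"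
  unfolding dens_def by simp_all

lemma powr_\<theta>: "\<bar>\<theta> z\<bar> powr (P + 1) = (P + 1) * pot z"
  using P by (simp add: potential_def)

text \<open>The source of nearly all integrability below: anything dominated by the energy density
  is integrable against a bounded weight that is supported in a bounded time interval. The powers in
  \<open>slab\<close> dominate \<open>pot\<close> because P + 1 > 1.\<close>

lemma slab_mult_dens:
  assumes g: "g \<in> borel_measurable borel" "\<And>z. \<bar>g z\<bar> \<le> C"
    "\<And>z. fst z + snd z \<notin> {a..b} \<Longrightarrow> g z = 0"
    and f: "f \<in> borel_measurable borel" "\<And>z. \<bar>f z\<bar> \<le> dens z"
  shows "integrable lborel (\<lambda>z. g z * f z)"
proof -
  let ?S = "{z :: real \<times> real. a \<le> fst z + snd z \<and> fst z + snd z \<le> b}"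
  show ?thesis
  proof (rule Bochner_Integration.integrable_bound)
    show "integrable lborel (\<lambda>z. C * (indicator ?S z * ((p z)\<^sup>2 + (q z)\<^sup>2 + \<bar>\<theta> z\<bar> powr (P + 1))))"
      using slab[of a b] by (simp add: set_integrable_def)
    show "(\<lambda>z. g z * f z) \<in> borel_measurable lborel" using f(1) g(1) by simp
    show "AE z in lborel. norm (g z * f z) \<le> norm (C * (indicator ?S z * ((p z)\<^sup>2 + (q z)\<^sup>2 + \<bar>\<theta> z\<bar> powr (P + 1))))"
    proof (rule AE_I2)
      fix z
      show "norm (g z * f z) \<le> norm (C * (indicator ?S z * ((p z)\<^sup>2 + (q z)\<^sup>2 + \<bar>\<theta> z\<bar> powr (P + 1))))"
      proof (cases "z \<in> ?S")
        case True
        have "pot z \<le> (P + 1) * pot z" using P pot_nonneg[of z] by (simp add: distrib_right)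
        then have "\<bar>f z\<bar> \<le> (p z)\<^sup>2 + (q z)\<^sup>2 + \<bar>\<theta> z\<bar> powr (P + 1)"
          using f(2)[of z] unfolding powr_\<theta> dens_def by linarith
        moreover have "\<bar>g z\<bar> \<le> \<bar>C\<bar>" using g(2)[of z] by simp
        ultimately have "\<bar>g z\<bar> * \<bar>f z\<bar> \<le> \<bar>C\<bar> * ((p z)\<^sup>2 + (q z)\<^sup>2 + \<bar>\<theta> z\<bar> powr (P + 1))"
          by (intro mult_mono) auto
        then show ?thesis using True by (simp add: abs_mult)
      qed (use g(3)[of z] in auto)
    qed
  qed
qed

lemma locally_integrable_dens_dominated:
  assumes f: "f \<in> borel_measurable borel" "\<And>z. \<bar>f z\<bar> \<le> C * (1 + dens z)"
  shows "locally_integrable f"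
  unfolding locally_integrable_def
proof (intro allI impI)
  fix K :: "(real \<times> real) set" assume K: "compact K"
  then have Km [measurable]: "K \<in> sets borel" by (rule borel_compact)
  have "compact ((\<lambda>z. fst z + snd z) ` K)" by (intro compact_continuous_image continuous_intros K)
  then obtain B where B: "\<And>z. z \<in> K \<Longrightarrow> \<bar>fst z + snd z\<bar> \<le> B"
    using compact_imp_bounded bounded_iff by (metis (no_types, lifting) image_eqI real_norm_def)
  have B': "fst z + snd z \<in> {- B..B}" if "z \<in> K" for z using B[OF that] by (simp add: abs_le_iff)
  have 1: "integrable lborel (\<lambda>z. indicator K z * dens z)"
    by (rule slab_mult_dens[where C = 1 and a = "- B" and b = B]) (use B' dens_bounds in \<open>auto simp: indicator_def\<close>)
  have "integrable lborel (\<lambda>z. indicator K z *\<^sub>R (1::real))"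
    by (rule borel_integrable_compact[OF K]) auto
  then have 2: "integrable lborel (\<lambda>z. C * (indicator K z * (1 + dens z)))"
    using 1 by (simp add: distrib_left)
  show "set_integrable lborel K f"
    unfolding set_integrable_def
  proof (rule Bochner_Integration.integrable_bound[OF 2])
    show "AE z in lborel. norm (indicator K z *\<^sub>R f z) \<le> norm (C * (indicator K z * (1 + dens z)))"
      using f(2) by (intro AE_I2) (auto simp: indicator_def intro: order_trans[OF _ abs_ge_self])
  qed (use f(1) in simp)
qed

lemma locally_integrable_densities:
  "locally_integrable (\<lambda>z. (p z)\<^sup>2)" "locally_integrable p" "locally_integrable (\<lambda>z. p z * q z)"
proof -
  have "2 * \<bar>x\<bar> \<le> 1 + x\<^sup>2" for x :: real
    using zero_le_power2[of "\<bar>x\<bar> - 1"] by (simp add: power2_diff)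
  then have 1: "\<bar>p z\<bar> \<le> 1 + dens z" for z
    using dens_bounds(2)[of z] abs_ge_zero[of "p z"] by (smt (verit))
  have "2 * (\<bar>x\<bar> * \<bar>y\<bar>) \<le> x\<^sup>2 + y\<^sup>2" for x y :: real
    using zero_le_power2[of "\<bar>x\<bar> - \<bar>y\<bar>"] by (simp add: power2_diff)
  from this[of "p _" "q _"] have 2: "\<bar>p z * q z\<bar> \<le> 1 + dens z" for z
    using abs_ge_zero[of "p z * q z"] pot_nonneg[of z] unfolding dens_def abs_mult by (smt (verit))
  show "locally_integrable (\<lambda>z. (p z)\<^sup>2)" "locally_integrable p" "locally_integrable (\<lambda>z. p z * q z)"
    using 1 2 dens_bounds(1,2)
    by (auto intro!: locally_integrable_dens_dominated[where C = 1] simp: add_increasing)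
qed

lemma p_slice_cont: "continuous_on A (\<lambda>v. p (u, v))"
  by (intro continuous_at_imp_continuous_on ballI DERIV_isCont[OF p_v])

lemma force_cont: "continuous_on UNIV (\<lambda>z. null_force P (\<theta> z))"
  by (rule continuous_null_force[OF \<theta> P])

lemma slice_cont:
  assumes "continuous_on UNIV (f :: real \<times> real \<Rightarrow> real)"
  shows "continuous_on A (\<lambda>v. f (u, v))" "continuous_on A (\<lambda>u. f (u, v))"
  by (intro continuous_on_compose2[OF assms] continuous_intros; simp)+

text \<open>Weak form of (\<theta>_u^2)_v + (V/2)_u = 0. \<open>A\<close> is the v-derivative of h
  p^2, legitimate because \<open>p\<close> is differentiable in v; \<open>D\<close> is the
  u-derivative of h V, legitimate because \<theta> has density \<open>p\<close> in u. Each
  integrates to 0 along its own lines, and in A + D/2 the force terms cancel.\<close>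

lemma energy_multiplier_compact:
  assumes h: "continuous_on UNIV h" "continuous_on UNIV hu" "continuous_on UNIV hv"
    and du: "\<And>u v. ((\<lambda>u. h (u, v)) has_real_derivative hu (u, v)) (at u)"
    and dv: "\<And>u v. ((\<lambda>v. h (u, v)) has_real_derivative hv (u, v)) (at v)"
    and supp: "\<And>z. z \<notin> cbox (- B, - B) (B, B) \<Longrightarrow> h z = 0 \<and> hu z = 0 \<and> hv z = 0"
  shows "integrable lborel (\<lambda>z. hv z * (p z)\<^sup>2 + hu z * pot z / 2)"
    and "(LINT z|lborel. hv z * (p z)\<^sup>2 + hu z * pot z / 2) = 0"
proof -
  let ?G = "\<lambda>z. null_force P (\<theta> z)"
  define A where "A = (\<lambda>z. (p z)\<^sup>2 * hv z + p z * (2 * (?G z * h z)))"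
  define D where "D = (\<lambda>z. hu z * pot z + p z * (- 4 * (?G z * h z)))"
  note K = compact_cbox[of "(- B, - B)" "(B, B)"]
  have out: "h (u, v) = 0" "hu (u, v) = 0" "hv (u, v) = 0" if "\<bar>u\<bar> > B \<or> \<bar>v\<bar> > B" for u v
  proof -
    have "(u, v) \<notin> cbox (- B, - B) (B, B)" using that by (auto simp: cbox_Pair_eq cbox_interval)
    from supp[OF this] show "h (u, v) = 0" "hu (u, v) = 0" "hv (u, v) = 0" by auto
  qed
  have i1: "integrable lborel (\<lambda>z. (p z)\<^sup>2 * hv z)"
    by (rule locally_integrable_mult_continuous[OF locally_integrable_densities(1) h(3) K]) (use supp in blast)
  have i2: "integrable lborel (\<lambda>z. p z * (c * (?G z * h z)))" for c
    by (rule locally_integrable_mult_continuous[OF locally_integrable_densities(2) _ K])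
      (use supp in \<open>auto intro!: continuous_intros force_cont h(1)\<close>)
  have i3: "integrable lborel (\<lambda>z. hu z * pot z)"
    by (rule integrable_compact_support[OF _ K])
      (use supp in \<open>auto intro!: continuous_intros pot_cont h(2)\<close>)
  have iA: "integrable lborel A" unfolding A_def by (intro Bochner_Integration.integrable_add i1 i2)
  have iD: "integrable lborel D" unfolding D_def by (intro Bochner_Integration.integrable_add i3 i2)
  have A0: "(LINT v|lborel. A (u, v)) = 0" for u
  proof (rule ac_density_integral_zero(2)[where B = B and \<theta> = "\<lambda>v. (p (u, v))\<^sup>2 * h (u, v)"])
    show "ac_density (\<lambda>v. (p (u, v))\<^sup>2 * h (u, v)) (\<lambda>v. A (u, v))"
    proof (rule ac_density_of_continuous_deriv)
      show "((\<lambda>v. (p (u, v))\<^sup>2 * h (u, v)) has_real_derivative A (u, v)) (at v)" for v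
        unfolding A_def by (auto intro!: derivative_eq_intros p_v dv simp: power2_eq_square algebra_simps)
      show "continuous_on UNIV (\<lambda>v. A (u, v))"
        unfolding A_def by (intro continuous_intros p_slice_cont slice_cont h force_cont)
    qed
  qed (use out in \<open>auto simp: A_def\<close>)
  have D0: "(LINT u|lborel. D (u, v)) = 0" for v
  proof (rule ac_density_integral_zero(2)[where B = B and \<theta> = "\<lambda>u. h (u, v) * pot (u, v)"])
    have "ac_density (\<lambda>u. h (u, v)) (\<lambda>u. hu (u, v))"
      by (rule ac_density_of_continuous_deriv[OF du slice_cont(2)[OF h(2)]])
    moreover have "ac_density (\<lambda>u. pot (u, v)) (\<lambda>u. - 4 * ?G (u, v) * p (u, v))"
      by (rule ac_density_compose[OF \<theta>_u potential_has_derivative[OF P]])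
        (intro continuous_intros continuous_null_force P)
    ultimately have "ac_density (\<lambda>u. h (u, v) * pot (u, v)) (\<lambda>u. hu (u, v) * pot (u, v) + h (u, v) * (- 4 * ?G (u, v) * p (u, v)))"
      by (rule ac_density_mult)
    then show "ac_density (\<lambda>u. h (u, v) * pot (u, v)) (\<lambda>u. D (u, v))"
      unfolding D_def by (simp add: algebra_simps)
  qed (use out in \<open>auto simp: D_def\<close>)
  have eq: "hv z * (p z)\<^sup>2 + hu z * pot z / 2 = A z + D z / 2" for z
    by (simp add: A_def D_def field_simps)
  show "integrable lborel (\<lambda>z. hv z * (p z)\<^sup>2 + hu z * pot z / 2)"
    unfolding eq using iA iD by simp
  have "(LINT z|lborel. A z) = 0" using plane_integral_fst(1)[OF iA] A0 by simp
  moreover have "(LINT z|lborel. D z) = 0" using plane_integral_snd(1)[OF iD] D0 by simp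
  ultimately show "(LINT z|lborel. hv z * (p z)\<^sup>2 + hu z * pot z / 2) = 0"
    unfolding eq using iA iD by simp
qed

text \<open>The integrand is the v-derivative of k p \<theta>, a product of a function
  differentiable in v and the absolutely continuous \<theta>. This is the third identity of the
  overview, tested with \<open>k\<close> and integrated by parts once.\<close>

lemma lagrangian_multiplier:
  assumes k: "continuous_on UNIV k" "continuous_on UNIV kv"
    and dv: "\<And>u v. ((\<lambda>v. k (u, v)) has_real_derivative kv (u, v)) (at v)"
    and supp: "\<And>z. z \<notin> cbox (- B, - B) (B, B) \<Longrightarrow> k z = 0 \<and> kv z = 0"
  shows "integrable lborel (\<lambda>z. k z * (p z * q z - (P + 1) / 4 * pot z) + kv z * \<theta> z * p z)"
    and "(LINT z|lborel. k z * (p z * q z - (P + 1) / 4 * pot z) + kv z * \<theta> z * p z) = 0"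
proof -
  let ?G = "\<lambda>z. null_force P (\<theta> z)"
  define A where "A = (\<lambda>z. (kv z * p z + k z * ?G z) * \<theta> z + (k z * p z) * q z)"
  \<comment> \<open>Homogeneity of the force: \<theta> times the derivative of the potential is P +
    1 times the potential.\<close>
  have \<theta>G: "\<theta> z * ?G z = - (P + 1) / 4 * pot z" for z
  proof -
    have "\<bar>\<theta> z\<bar> powr (P - 1) * (\<bar>\<theta> z\<bar> * \<bar>\<theta> z\<bar>) = \<bar>\<theta> z\<bar> powr (P + 1)"
      using powr_add[of "\<bar>\<theta> z\<bar>" "P - 1" 2] by (cases "\<theta> z = 0") (simp_all add: power2_eq_square add.commute)
    then show ?thesis using powr_\<theta>[of z] by (simp add: null_force_def algebra_simps)
  qed
  have eq: "k z * (p z * q z - (P + 1) / 4 * pot z) + kv z * \<theta> z * p z = A z" for z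
    using arg_cong[OF \<theta>G[of z], of "\<lambda>x. k z * x"] by (simp add: A_def field_simps)
  note K = compact_cbox[of "(- B, - B)" "(B, B)"]
  have out: "k (u, v) = 0" "kv (u, v) = 0" if "\<bar>v\<bar> > B" for u v
  proof -
    have "(u, v) \<notin> cbox (- B, - B) (B, B)" using that by (auto simp: cbox_Pair_eq cbox_interval)
    from supp[OF this] show "k (u, v) = 0" "kv (u, v) = 0" by auto
  qed
  have i1: "integrable lborel (\<lambda>z. p z * (kv z * \<theta> z))"
    by (rule locally_integrable_mult_continuous[OF locally_integrable_densities(2) _ K])
      (use supp in \<open>auto intro!: continuous_intros \<theta> k\<close>)
  have i2: "integrable lborel (\<lambda>z. (p z * q z) * k z)"
    by (rule locally_integrable_mult_continuous[OF locally_integrable_densities(3) k(1) K]) (use supp in blast)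
  have i3: "integrable lborel (\<lambda>z. k z * (?G z * \<theta> z))"
    by (rule integrable_compact_support[OF _ K])
      (use supp in \<open>auto intro!: continuous_intros force_cont \<theta> k\<close>)
  have "A = (\<lambda>z. p z * (kv z * \<theta> z) + (p z * q z) * k z + k z * (?G z * \<theta> z))"
    by (auto simp: A_def algebra_simps fun_eq_iff)
  then have iA: "integrable lborel A" using i1 i2 i3 by simp
  have A0: "(LINT v|lborel. A (u, v)) = 0" for u
  proof (rule ac_density_integral_zero(2)[where B = B and \<theta> = "\<lambda>v. k (u, v) * p (u, v) * \<theta> (u, v)"])
    have "ac_density (\<lambda>v. k (u, v) * p (u, v)) (\<lambda>v. kv (u, v) * p (u, v) + k (u, v) * ?G (u, v))"
    proof (rule ac_density_of_continuous_deriv)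
      show "((\<lambda>v. k (u, v) * p (u, v)) has_real_derivative kv (u, v) * p (u, v) + k (u, v) * ?G (u, v)) (at v)" for v
        by (auto intro!: derivative_eq_intros p_v dv)
    qed (intro continuous_intros p_slice_cont slice_cont k force_cont)
    from ac_density_mult[OF this \<theta>_v]
    show "ac_density (\<lambda>v. k (u, v) * p (u, v) * \<theta> (u, v)) (\<lambda>v. A (u, v))" unfolding A_def .
  qed (use out in \<open>auto simp: A_def\<close>)
  show "integrable lborel (\<lambda>z. k z * (p z * q z - (P + 1) / 4 * pot z) + kv z * \<theta> z * p z)"
    unfolding eq by (rule iA)
  show "(LINT z|lborel. k z * (p z * q z - (P + 1) / 4 * pot z) + kv z * \<theta> z * p z) = 0"
    unfolding eq using plane_integral_fst(1)[OF iA] A0 by simp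
qed

end

section \<open>Conservation of energy\<close>

lemma pos_part_square_has_derivative:
  "((\<lambda>x::real. (max 0 x)\<^sup>2) has_real_derivative 2 * max 0 x) (at x)"
proof -
  consider "x > 0" | "x < 0" | "x = 0" by linarith
  then show ?thesis
  proof cases
    case 1
    have "((\<lambda>x::real. x\<^sup>2) has_real_derivative 2 * x) (at x)" by (auto intro!: derivative_eq_intros)
    then have "((\<lambda>x::real. (max 0 x)\<^sup>2) has_real_derivative 2 * x) (at x)"
      by (rule has_field_derivative_transform_within_open[where S = "{0<..}"]) (use 1 in auto)
    then show ?thesis using 1 by simp
  next
    case 2
    have "((\<lambda>x::real. 0) has_real_derivative 0) (at x)" by simp
    then have "((\<lambda>x::real. (max 0 x)\<^sup>2) has_real_derivative 0) (at x)"
      by (rule has_field_derivative_transform_within_open[where S = "{..<0}"]) (use 2 in auto)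
    then show ?thesis using 2 by simp
  next
    case 3
    have "((\<lambda>h::real. ((max 0 (0 + h))\<^sup>2 - (max 0 0)\<^sup>2) / h) \<longlongrightarrow> 0) (at 0)"
    proof (rule Lim_null_comparison)
      show "\<forall>\<^sub>F h::real in at 0. norm (((max 0 (0 + h))\<^sup>2 - (max 0 0)\<^sup>2) / h) \<le> \<bar>h\<bar>"
        by (rule always_eventually) (auto simp: max_def power2_eq_square)
      show "((\<lambda>h::real. \<bar>h\<bar>) \<longlongrightarrow> 0) (at 0)" using tendsto_rabs_zero[OF tendsto_ident_at[of 0 UNIV]] by simp
    qed
    then show ?thesis using 3 by (simp add: DERIV_def)
  qed
qed

text \<open>A quadratic spline rising from 0 to 1 on {0..1}; its derivative is a tent of height 2.
  Multipliers have to be continuously differentiable only, so an explicit profile with explicit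
  bounds replaces the smooth step.\<close>

definition step :: "real \<Rightarrow> real" where
  "step x = 2 * (max 0 x)\<^sup>2 - 4 * (max 0 (x - 1/2))\<^sup>2 + 2 * (max 0 (x - 1))\<^sup>2"

definition step' :: "real \<Rightarrow> real" where
  "step' x = 4 * max 0 x - 8 * max 0 (x - 1/2) + 4 * max 0 (x - 1)"

lemma step_has_derivative: "(step has_real_derivative step' x) (at x)"
proof -
  have "((\<lambda>x. (max 0 (x - c))\<^sup>2) has_real_derivative 2 * max 0 (x - c)) (at x)" for c :: real
    using pos_part_square_has_derivative[of "x - c"] DERIV_shift[of "\<lambda>x. (max 0 x)\<^sup>2" _ x "- c"] by simp
  note d = this[of 0] this[of "1/2"] this[of 1]
  have "((\<lambda>x. 2 * (max 0 x)\<^sup>2 - 4 * (max 0 (x - 1/2))\<^sup>2 + 2 * (max 0 (x - 1))\<^sup>2) has_real_derivative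
      2 * (2 * max 0 x) - 4 * (2 * max 0 (x - 1/2)) + 2 * (2 * max 0 (x - 1))) (at x)"
    using d by (intro DERIV_add DERIV_diff DERIV_cmult) auto
  then show ?thesis by (simp add: step_def[abs_def] step'_def)
qed

lemma step'_cont: "continuous_on A step'"
  unfolding step'_def by (intro continuous_intros)

lemma step_cont: "continuous_on A step"
  unfolding step_def by (intro continuous_intros)

lemma step'_bounds: "0 \<le> step' x" "step' x \<le> 2" and step'_0: "x \<le> 0 \<or> x \<ge> 1 \<Longrightarrow> step' x = 0"
  unfolding step'_def by (auto simp: max_def)

lemma step_0: "x \<le> 0 \<Longrightarrow> step x = 0" and step_1: "x \<ge> 1 \<Longrightarrow> step x = 1"
  unfolding step_def by (auto simp: max_def power2_eq_square algebra_simps)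

lemma step_mono: "x \<le> y \<Longrightarrow> step x \<le> step y"
  by (rule DERIV_nonneg_imp_nondecreasing) (use step_has_derivative step'_bounds in blast)+

lemma step_bounds: "0 \<le> step x" "step x \<le> 1"
  using step_mono[of "min x 0" x] step_mono[of x "max x 1"] step_0[of "min x 0"] step_1[of "max x 1"] by auto

lemma step'_integral: "(LINT x|lborel. step' x) = 1"
proof -
  have "ac_density step step'" by (rule ac_density_of_continuous_deriv[OF step_has_derivative step'_cont])
  from ac_densityD(3)[OF this, of 0 1]
  have "(LINT x:{0..1}|lborel. step' x) = 1" by (simp add: step_0 step_1)
  moreover have "(\<lambda>x. indicator {0..1} x *\<^sub>R step' x) = step'"
    using step'_0 by (auto simp: indicator_def fun_eq_iff simp del: not_le) (metis linear)+
  ultimately show ?thesis unfolding set_lebesgue_integral_def by simp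
qed

section \<open>Cutoffs in time\<close>

abbreviation time_of :: "real \<times> real \<Rightarrow> real" where
  "time_of z \<equiv> (fst z + snd z) / 2"

lemma time_of_chain:
  assumes "\<And>t. (F has_real_derivative f t) (at t)"
  shows "((\<lambda>u. F (time_of (u, v))) has_real_derivative f (time_of (u, v)) / 2) (at u)"
    and "((\<lambda>v. F (time_of (u, v))) has_real_derivative f (time_of (u, v)) / 2) (at v)"
proof -
  have "((\<lambda>u. (u + v) / 2) has_real_derivative 1 / 2) (at u)"
    "((\<lambda>v. (u + v) / 2) has_real_derivative 1 / 2) (at v)"
    by (auto intro!: derivative_eq_intros)
  from DERIV_chain2[OF assms this(1)] DERIV_chain2[OF assms this(2)]
  show "((\<lambda>u. F (time_of (u, v))) has_real_derivative f (time_of (u, v)) / 2) (at u)"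
    "((\<lambda>v. F (time_of (u, v))) has_real_derivative f (time_of (u, v)) / 2) (at v)"
    by simp_all
qed

definition window :: "real \<Rightarrow> real \<Rightarrow> real" where
  "window T t = step (t - 1) - step (t - T)"

definition window' :: "real \<Rightarrow> real \<Rightarrow> real" where
  "window' T t = step' (t - 1) - step' (t - T)"

text \<open>A majorant of \<bar>window'\<bar>, with sum in place of difference. Its integral is 2
  whatever \<open>T\<close> is, so errors carried by the two ends of the window cost a fixed
  multiple of the energy.\<close>

definition flanks :: "real \<Rightarrow> real \<Rightarrow> real" where
  "flanks T t = step' (t - 1) + step' (t - T)"

lemma window_has_derivative: "(window T has_real_derivative window' T t) (at t)"
proof -
  have "((\<lambda>t. step (t - c)) has_real_derivative step' (t - c)) (at t)" for c
    using step_has_derivative[of "t - c"] DERIV_shift[of step _ t "- c"] by simp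
  then show ?thesis unfolding window_def[abs_def] window'_def by (intro DERIV_diff)
qed

lemma window_cont: "continuous_on A (window T)" "continuous_on A (window' T)" "continuous_on A (flanks T)"
  unfolding window_def[abs_def] window'_def[abs_def] flanks_def[abs_def]
  by (intro continuous_intros continuous_on_compose2[OF step_cont[of UNIV]]
      continuous_on_compose2[OF step'_cont[of UNIV]] subset_UNIV)+

lemma window_bounds:
  assumes "T \<ge> 2"
  shows "0 \<le> window T t" "window T t \<le> 1" "\<bar>window' T t\<bar> \<le> flanks T t" "flanks T t \<le> 4"
    "t \<notin> {1..T + 1} \<Longrightarrow> window T t = 0 \<and> window' T t = 0 \<and> flanks T t = 0"
    "2 \<le> t \<Longrightarrow> t \<le> T \<Longrightarrow> window T t = 1"
proof -
  show "0 \<le> window T t" using step_mono[of "t - T" "t - 1"] assms by (simp add: window_def)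
  show "window T t \<le> 1" using step_bounds[of "t - 1"] step_bounds[of "t - T"] by (simp add: window_def)
  show "\<bar>window' T t\<bar> \<le> flanks T t" "flanks T t \<le> 4"
    using step'_bounds[of "t - 1"] step'_bounds[of "t - T"] by (auto simp: window'_def flanks_def)
  show "t \<notin> {1..T + 1} \<Longrightarrow> window T t = 0 \<and> window' T t = 0 \<and> flanks T t = 0"
    using assms step_0[of "t - 1"] step_0[of "t - T"] step_1[of "t - 1"] step_1[of "t - T"]
      step'_0[of "t - 1"] step'_0[of "t - T"]
    by (cases "t < 1") (auto simp: window_def window'_def flanks_def)
  show "2 \<le> t \<Longrightarrow> t \<le> T \<Longrightarrow> window T t = 1"
    using step_1[of "t - 1"] step_0[of "t - T"] by (simp add: window_def)
qed

lemma flanks_nonneg: "flanks T t \<ge> 0"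
  using step'_bounds by (simp add: flanks_def)

lemma flanks_integral: "integrable lborel (flanks T)" "(LINT t|lborel. flanks T t) = 2"
proof -
  have i: "integrable lborel step'"
    by (rule integrable_compact_support[OF step'_cont, of "{0..1}"]) (use step'_0 in force)+
  have "integrable lborel (\<lambda>t. step' (t - c))" "(LINT t|lborel. step' (t - c)) = 1" for c
    using lborel_integrable_real_affine[OF i, of 1 "- c"] lborel_integral_real_affine[of 1 step' "- c"] step'_integral
    by (simp_all add: add.commute)
  then show "integrable lborel (flanks T)" "(LINT t|lborel. flanks T t) = 2"
    unfolding flanks_def[abs_def] by simp_all
qed

context null_wave
begin

text \<open>A multiplier bounded together with its derivatives needs compact support in time only:
  it is cut off in space, and the error, supported where the cutoff varies, disappears by dominated
  convergence with a multiple of the energy density on the slab as majorant.\<close>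

lemma energy_multiplier:
  assumes h: "continuous_on UNIV h" "continuous_on UNIV hu" "continuous_on UNIV hv"
    and du: "\<And>u v. ((\<lambda>u. h (u, v)) has_real_derivative hu (u, v)) (at u)"
    and dv: "\<And>u v. ((\<lambda>v. h (u, v)) has_real_derivative hv (u, v)) (at v)"
    and supp: "\<And>z. time_of z \<notin> {a..b} \<Longrightarrow> h z = 0 \<and> hu z = 0 \<and> hv z = 0"
    and bnd: "\<And>z. \<bar>h z\<bar> \<le> C" "\<And>z. \<bar>hu z\<bar> \<le> C" "\<And>z. \<bar>hv z\<bar> \<le> C"
  shows "integrable lborel (\<lambda>z. hv z * (p z)\<^sup>2 + hu z * pot z / 2)"
    and "(LINT z|lborel. hv z * (p z)\<^sup>2 + hu z * pot z / 2) = 0"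
proof -
  have C: "C \<ge> 0" using bnd(1)[of 0] by simp
  have off: "time_of z \<notin> {a..b}" if "fst z + snd z \<notin> {2 * a..2 * b}" for z :: "real \<times> real"
    using that by auto
  have [measurable]: "hu \<in> borel_measurable borel" "hv \<in> borel_measurable borel"
    using h by (auto intro: borel_measurable_continuous_onI)
  have i: "integrable lborel (\<lambda>z. hv z * (p z)\<^sup>2)" "integrable lborel (\<lambda>z. hu z * pot z)"
    using off supp dens_bounds by (auto intro!: slab_mult_dens[where C = C and a = "2 * a" and b = "2 * b"] bnd)
  show "integrable lborel (\<lambda>z. hv z * (p z)\<^sup>2 + hu z * pot z / 2)" using i by simp
  \<comment> \<open>Equal to 1 for \<bar>v - u\<bar> <= n and to 0 beyond n + 1. The slope stays
    below 2 while its support moves to infinity; this gives the factor 3 = 1 + 2 in the majorant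
    below.\<close>
  define \<kappa> where "\<kappa> = (\<lambda>n z. step (snd z - fst z + real n + 1) - step (snd z - fst z - real n))"
  define \<kappa>' where "\<kappa>' = (\<lambda>n z. step' (snd z - fst z + real n + 1) - step' (snd z - fst z - real n))"
  have \<kappa>c: "continuous_on UNIV (\<kappa> n)" "continuous_on UNIV (\<kappa>' n)" for n
    unfolding \<kappa>_def \<kappa>'_def
    by (intro continuous_intros continuous_on_compose2[OF step_cont[of UNIV]]
      continuous_on_compose2[OF step'_cont[of UNIV]] subset_UNIV)+
  have \<kappa>b: "\<bar>\<kappa> n z\<bar> \<le> 1" "\<bar>\<kappa>' n z\<bar> \<le> 2" for n z
    unfolding \<kappa>_def \<kappa>'_def
    using step_bounds[of "snd z - fst z + real n + 1"] step_bounds[of "snd z - fst z - real n"]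
      step'_bounds[of "snd z - fst z + real n + 1"] step'_bounds[of "snd z - fst z - real n"] by auto
  have \<kappa>0: "\<kappa> n z = 0 \<and> \<kappa>' n z = 0" if "\<bar>snd z - fst z\<bar> > real n + 1" for n z
    using that unfolding \<kappa>_def \<kappa>'_def by (cases "snd z > fst z") (auto simp: step_0 step_1 step'_0)
  have \<kappa>1: "\<kappa> n z = 1 \<and> \<kappa>' n z = 0" if "\<bar>snd z - fst z\<bar> \<le> real n" for n z
    using that step_1[of "snd z - fst z + real n + 1"] step_0[of "snd z - fst z - real n"]
      step'_0[of "snd z - fst z + real n + 1"] step'_0[of "snd z - fst z - real n"]
    unfolding \<kappa>_def \<kappa>'_def by (auto simp: abs_le_iff)
  define f where "f = (\<lambda>n z. (hv z * \<kappa> n z + h z * \<kappa>' n z) * (p z)\<^sup>2 + (hu z * \<kappa> n z - h z * \<kappa>' n z) * pot z / 2)"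
  have f0: "(LINT z|lborel. f n z) = 0" and fi: "integrable lborel (f n)" for n
  proof -
    define B where "B = \<bar>a\<bar> + \<bar>b\<bar> + real n + 1"
    have out: "h z * \<kappa> n z = 0 \<and> hu z * \<kappa> n z - h z * \<kappa>' n z = 0 \<and> hv z * \<kappa> n z + h z * \<kappa>' n z = 0"
      if z: "z \<notin> cbox (- B, - B) (B, B)" for z
    proof (cases "time_of z \<in> {a..b}")
      case True
      have "\<bar>snd z - fst z\<bar> > real n + 1"
      proof (rule ccontr)
        assume "\<not> ?thesis"
        then have "\<bar>fst z\<bar> \<le> B" "\<bar>snd z\<bar> \<le> B" using True unfolding B_def by auto
        then show False using z by (cases z) (auto simp: cbox_Pair_eq cbox_interval abs_le_iff)
      qed
      then show ?thesis using \<kappa>0 by simp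
    qed (use supp in auto)
    have ds: "((\<lambda>u. \<kappa> n (u, v)) has_real_derivative - \<kappa>' n (u, v)) (at u)"
      "((\<lambda>v. \<kappa> n (u, v)) has_real_derivative \<kappa>' n (u, v)) (at v)" for u v
      unfolding \<kappa>_def \<kappa>'_def
      by (auto intro!: derivative_eq_intros DERIV_chain2[OF step_has_derivative])
    note em = energy_multiplier_compact[of "\<lambda>z. h z * \<kappa> n z" "\<lambda>z. hu z * \<kappa> n z - h z * \<kappa>' n z"
      "\<lambda>z. hv z * \<kappa> n z + h z * \<kappa>' n z" B]
    show "(LINT z|lborel. f n z) = 0" unfolding f_def
      by (rule em(2)) (use out in \<open>auto intro!: continuous_intros h \<kappa>c derivative_eq_intros du dv ds\<close>)
    show "integrable lborel (f n)" unfolding f_def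
      by (rule em(1)) (use out in \<open>auto intro!: continuous_intros h \<kappa>c derivative_eq_intros du dv ds\<close>)
  qed
  have "(\<lambda>n. LINT z|lborel. f n z) \<longlonglongrightarrow> (LINT z|lborel. hv z * (p z)\<^sup>2 + hu z * pot z / 2)"
  proof (rule integral_dominated_convergence)
    let ?S = "{z :: real \<times> real. 2 * a \<le> fst z + snd z \<and> fst z + snd z \<le> 2 * b}"
    have [measurable]: "?S \<in> sets borel"
      by (intro borel_closed closed_Collect_conj closed_Collect_le continuous_intros)
    show "integrable lborel (\<lambda>z. (3 * C * indicator ?S z) * dens z)"
    proof (rule slab_mult_dens[where C = "3 * C" and a = "2 * a" and b = "2 * b"])
      show "(\<lambda>z. 3 * C * indicator ?S z) \<in> borel_measurable borel" by measurable
    qed (use C dens_bounds in \<open>auto simp: indicator_def\<close>)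
    show "f n \<in> borel_measurable lborel" for n using fi by blast
    show "(\<lambda>z. hv z * (p z)\<^sup>2 + hu z * pot z / 2) \<in> borel_measurable lborel" by measurable
    show "AE z in lborel. (\<lambda>n. f n z) \<longlonglongrightarrow> hv z * (p z)\<^sup>2 + hu z * pot z / 2"
    proof (rule AE_I2)
      fix z
      obtain N where N: "\<bar>snd z - fst z\<bar> \<le> real N" using real_arch_simple by blast
      have "f n z = hv z * (p z)\<^sup>2 + hu z * pot z / 2" if "n \<ge> N" for n
        using \<kappa>1[of z n] N that by (simp add: f_def)
      then have "\<forall>\<^sub>F n in sequentially. hv z * (p z)\<^sup>2 + hu z * pot z / 2 = f n z"
        using eventually_sequentially by force
      then show "(\<lambda>n. f n z) \<longlonglongrightarrow> hv z * (p z)\<^sup>2 + hu z * pot z / 2"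
        by (rule Lim_transform_eventually[OF tendsto_const])
    qed
    show "AE z in lborel. norm (f n z) \<le> (3 * C * indicator ?S z) * dens z" for n
    proof (rule AE_I2)
      fix z
      show "norm (f n z) \<le> (3 * C * indicator ?S z) * dens z"
      proof (cases "time_of z \<in> {a..b}")
        case True
        have "\<bar>hv z * \<kappa> n z\<bar> \<le> C * 1" "\<bar>hu z * \<kappa> n z\<bar> \<le> C * 1" "\<bar>h z * \<kappa>' n z\<bar> \<le> C * 2"
          unfolding abs_mult using bnd \<kappa>b C by (intro mult_mono; auto)+
        then have "\<bar>hv z * \<kappa> n z + h z * \<kappa>' n z\<bar> \<le> 3 * C" "\<bar>hu z * \<kappa> n z - h z * \<kappa>' n z\<bar> \<le> 3 * C"
          by linarith+
        then have "\<bar>(hv z * \<kappa> n z + h z * \<kappa>' n z) * (p z)\<^sup>2\<bar> \<le> 3 * C * (p z)\<^sup>2"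
          "\<bar>(hu z * \<kappa> n z - h z * \<kappa>' n z) * pot z\<bar> \<le> 3 * C * pot z"
          unfolding abs_mult by (intro mult_mono; simp)+
        then have "\<bar>f n z\<bar> \<le> 3 * C * (p z)\<^sup>2 + 3 * C * pot z / 2"
          unfolding f_def by linarith
        also have "\<dots> \<le> 3 * C * dens z"
        proof -
          have "3 * C * ((p z)\<^sup>2 + pot z / 2) \<le> 3 * C * dens z"
            using C dens_bounds(5)[of z] pot_nonneg[of z] by (intro mult_left_mono) linarith+
          then show ?thesis by (simp add: distrib_left)
        qed
        finally show ?thesis using True by (simp add: indicator_def field_simps)
      next
        case False
        then show ?thesis using supp[OF False] dens_bounds(1)[of z] C by (simp add: f_def)
      qed
    qed
  qed
  then show "(LINT z|lborel. hv z * (p z)\<^sup>2 + hu z * pot z / 2) = 0"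
    unfolding f0 by (rule LIMSEQ_unique[OF _ tendsto_const])
qed

lemma energy_multiplier':
  assumes h: "continuous_on UNIV h" "continuous_on UNIV hu" "continuous_on UNIV hv"
    and du: "\<And>u v. ((\<lambda>u. h (u, v)) has_real_derivative hu (u, v)) (at u)"
    and dv: "\<And>u v. ((\<lambda>v. h (u, v)) has_real_derivative hv (u, v)) (at v)"
    and supp: "\<And>z. time_of z \<notin> {a..b} \<Longrightarrow> h z = 0 \<and> hu z = 0 \<and> hv z = 0"
    and bnd: "\<And>z. \<bar>h z\<bar> \<le> C" "\<And>z. \<bar>hu z\<bar> \<le> C" "\<And>z. \<bar>hv z\<bar> \<le> C"
  shows "integrable lborel (\<lambda>z. hu z * (q z)\<^sup>2 + hv z * pot z / 2)"
    and "(LINT z|lborel. hu z * (q z)\<^sup>2 + hv z * pot z / 2) = 0"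
proof -
  interpret sw: null_wave P "\<lambda>z. \<theta> (snd z, fst z)" "\<lambda>z. q (snd z, fst z)" "\<lambda>z. p (snd z, fst z)"
    by (rule null_wave_swap)
  have "integrable lborel (\<lambda>z. hu (snd z, fst z) * (q (snd z, fst z))\<^sup>2 + hv (snd z, fst z) * sw.pot z / 2)"
    "(LINT z|lborel. hu (snd z, fst z) * (q (snd z, fst z))\<^sup>2 + hv (snd z, fst z) * sw.pot z / 2) = 0"
  proof -
    have supp': "h (snd z, fst z) = 0 \<and> hv (snd z, fst z) = 0 \<and> hu (snd z, fst z) = 0" if "time_of z \<notin> {a..b}" for z
      using supp[of "(snd z, fst z)"] that by (simp add: add.commute)
    note em = sw.energy_multiplier[of "\<lambda>z. h (snd z, fst z)" "\<lambda>z. hv (snd z, fst z)" "\<lambda>z. hu (snd z, fst z)",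
        OF continuous_on_swap[OF h(1)] continuous_on_swap[OF h(3)] continuous_on_swap[OF h(2)] _ _ supp' bnd(1) bnd(3) bnd(2)]
    show "integrable lborel (\<lambda>z. hu (snd z, fst z) * (q (snd z, fst z))\<^sup>2 + hv (snd z, fst z) * sw.pot z / 2)"
      "(LINT z|lborel. hu (snd z, fst z) * (q (snd z, fst z))\<^sup>2 + hv (snd z, fst z) * sw.pot z / 2) = 0"
      by (rule em; simp add: du dv)+
  qed
  note i = this
  show "integrable lborel (\<lambda>z. hu z * (q z)\<^sup>2 + hv z * pot z / 2)" using plane_swap(1)[OF i(1)] by simp
  show "(LINT z|lborel. hu z * (q z)\<^sup>2 + hv z * pot z / 2) = 0" using plane_swap(2)[OF i(1)] i(2) by simp
qed

text \<open>A weighted mean of the energy over times between 0 and 1 instead of its value at one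
  time, because \<theta>_u and \<theta>_v are accessible through plane integrals. The Jacobian 2
  compensates for the factor 1/2 in \<open>dens\<close>.\<close>

definition energy0 :: real where
  "energy0 = (LINT z|lborel. step' (time_of z) * dens z)"

text \<open>Conservation of energy in averaged form. A time profile with integral 0 has an
  antiderivative of compact support; used as multiplier in both energy identities, whose sum has the
  bulk \<open>dens\<close>, it shows that the profile integrates to 0 against the energy.\<close>

lemma energy_time_average:
  assumes \<omega>: "continuous_on UNIV \<omega>" "\<And>t. t \<notin> {a..b} \<Longrightarrow> \<omega> t = 0"
  shows "integrable lborel (\<lambda>z. \<omega> (time_of z) * dens z)"
    and "(LINT z|lborel. \<omega> (time_of z) * dens z) = energy0 * (LINT t|lborel. \<omega> t)"
proof -
  have int: "integrable lborel (\<lambda>z. f (time_of z) * dens z)"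
    if f: "continuous_on UNIV f" "\<And>t. t \<notin> {c..d} \<Longrightarrow> f t = 0" for f c d
  proof -
    obtain C where C: "\<And>t. \<bar>f t\<bar> \<le> C" using continuous_compact_support_bounded[OF f(1), of "{c..d}"] f(2) by auto
    show ?thesis
    proof (rule slab_mult_dens[where C = C and a = "2 * c" and b = "2 * d"])
      show "(\<lambda>z. f (time_of z)) \<in> borel_measurable borel"
        by (intro borel_measurable_continuous_onI continuous_on_compose2[OF f(1)] continuous_intros) auto
      show "f (time_of z) = 0" if "fst z + snd z \<notin> {2 * c..2 * d}" for z using that by (intro f(2)) auto
    qed (use C dens_bounds(1) in auto)
  qed
  show i\<omega>: "integrable lborel (\<lambda>z. \<omega> (time_of z) * dens z)" by (rule int[OF \<omega>])
  have s0: "step' t = 0" if "t \<notin> {0..1}" for t using that step'_0[of t] by auto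
  have iS: "integrable lborel (\<lambda>z. step' (time_of z) * dens z)" by (rule int[OF step'_cont s0])
  define c where "c = (LINT t|lborel. \<omega> t)"
  \<comment> \<open>Subtraction of the same mass distributed as \<open>step'\<close> makes the
    integral 0 and compares the average with \<open>energy0\<close>.\<close>
  define \<omega>1 where "\<omega>1 = (\<lambda>t. \<omega> t - c * step' t)"
  define l where "l = min a 0"
  define r where "r = max b 1"
  have \<omega>1c: "continuous_on UNIV \<omega>1" unfolding \<omega>1_def by (intro continuous_intros \<omega> step'_cont)
  have \<omega>10: "\<omega>1 t = 0" if "t \<notin> {l..r}" for t
  proof -
    have "t \<notin> {a..b}" "t \<notin> {0..1}" using that by (auto simp: l_def r_def)
    then show ?thesis using \<omega>(2) s0 by (simp add: \<omega>1_def)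
  qed
  have "integrable lborel \<omega>" "integrable lborel step'"
    using \<omega>(2) s0 by (auto intro!: integrable_compact_support[OF \<omega>(1), of "{a..b}"] integrable_compact_support[OF step'_cont, of "{0..1}"])
  then have int0: "(LINT t|lborel. \<omega>1 t) = 0" by (simp add: \<omega>1_def c_def step'_integral)
  obtain A where A: "\<And>x. (A has_real_derivative \<omega>1 x) (at x)" "\<And>x. x \<le> l \<Longrightarrow> A x = 0"
    "\<And>x. x \<ge> r \<Longrightarrow> A x = 0" "\<And>x. \<bar>A x\<bar> \<le> (LINT y|lborel. \<bar>\<omega>1 y\<bar>)"
    using antiderivative_compact_support[OF \<omega>1c \<omega>10] int0 by auto
  obtain D where D: "\<And>t. \<bar>\<omega>1 t\<bar> \<le> D" using continuous_compact_support_bounded[OF \<omega>1c, of "{l..r}"] \<omega>10 by auto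
  define C where "C = max D (LINT y|lborel. \<bar>\<omega>1 y\<bar>)"
  have Ac: "continuous_on UNIV A" by (intro continuous_at_imp_continuous_on ballI DERIV_isCont[OF A(1)])
  have cont: "continuous_on UNIV (\<lambda>z. A (time_of z))" "continuous_on UNIV (\<lambda>z. \<omega>1 (time_of z) / 2)"
    by (intro continuous_intros continuous_on_compose2[OF Ac] continuous_on_compose2[OF \<omega>1c]; simp)+
  note der = time_of_chain[OF A(1)]
  have supp: "A (time_of z) = 0 \<and> \<omega>1 (time_of z) / 2 = 0 \<and> \<omega>1 (time_of z) / 2 = 0" if "time_of z \<notin> {l..r}" for z
    using that \<omega>10[OF that] A(2)[of "time_of z"] A(3)[of "time_of z"] by auto
  have bnd: "\<bar>A (time_of z)\<bar> \<le> C" "\<bar>\<omega>1 (time_of z) / 2\<bar> \<le> C" for z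
    using A(4)[of "time_of z"] D[of "time_of z"] unfolding C_def by auto
  note e1 = energy_multiplier[OF cont(1) cont(2) cont(2) der supp bnd(1) bnd(2) bnd(2)]
  note e2 = energy_multiplier'[OF cont(1) cont(2) cont(2) der supp bnd(1) bnd(2) bnd(2)]
  have "(LINT z|lborel. \<omega>1 (time_of z) / 2 * (p z)\<^sup>2 + \<omega>1 (time_of z) / 2 * pot z / 2
      + (\<omega>1 (time_of z) / 2 * (q z)\<^sup>2 + \<omega>1 (time_of z) / 2 * pot z / 2)) = 0"
    using e1 e2 by (subst Bochner_Integration.integral_add) auto
  also have "(\<lambda>z. \<omega>1 (time_of z) / 2 * (p z)\<^sup>2 + \<omega>1 (time_of z) / 2 * pot z / 2
      + (\<omega>1 (time_of z) / 2 * (q z)\<^sup>2 + \<omega>1 (time_of z) / 2 * pot z / 2)) = (\<lambda>z. (1/2) * (\<omega> (time_of z) * dens z - c * (step' (time_of z) * dens z)))"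
    by (auto simp: dens_def \<omega>1_def field_simps fun_eq_iff)
  finally have "(LINT z|lborel. \<omega> (time_of z) * dens z - c * (step' (time_of z) * dens z)) = 0" by simp
  then show "(LINT z|lborel. \<omega> (time_of z) * dens z) = energy0 * (LINT t|lborel. \<omega> t)"
    using i\<omega> iS by (simp add: energy0_def c_def)
qed

lemma energy0_nonneg: "energy0 \<ge> 0"
  unfolding energy0_def using step'_bounds(1) dens_bounds(1) by (intro integral_nonneg_AE AE_I2 mult_nonneg_nonneg)

end

section \<open>Flux through null lines\<close>

text \<open>The cutoff vanishes for x + c < 2 and the factor \<open>F\<close> is differentiable for
  x + c > 1. These open regions overlap and cover the line, so truncations of \<open>F\<close> near
  t = 0 are invisible.\<close>

lemma window_mult_has_derivative:
  assumes T: "T \<ge> 2" and F: "x + c > 1 \<Longrightarrow> (F has_real_derivative f) (at x)"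
  shows "((\<lambda>x. window T ((x + c) / 2) * F x) has_real_derivative
    window' T ((x + c) / 2) / 2 * F x + window T ((x + c) / 2) * f) (at x)"
proof (cases "x + c > 1")
  case True
  have "((\<lambda>x. window T ((x + c) / 2)) has_real_derivative window' T ((x + c) / 2) / 2) (at x)"
    using time_of_chain(1)[OF window_has_derivative, of T c x] by simp
  from DERIV_mult[OF this F[OF True]] show ?thesis by (simp add: mult.commute)
next
  case False
  have "((\<lambda>x. 0) has_real_derivative 0) (at x)" by simp
  then have "((\<lambda>x. window T ((x + c) / 2) * F x) has_real_derivative 0) (at x)"
    by (rule has_field_derivative_transform_within_open[where S = "{x. x + c < 2}"])
      (use False window_bounds(5)[OF T] in \<open>auto intro!: open_Collect_less continuous_intros\<close>)
  moreover have "window' T ((x + c) / 2) = 0" "window T ((x + c) / 2) = 0"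
    using window_bounds(5)[OF T, of "(x + c) / 2"] False by auto
  ultimately show ?thesis by simp
qed

lemma window_mult_has_derivative':
  assumes T: "T \<ge> 2" and F: "c + x > 1 \<Longrightarrow> (F has_real_derivative f) (at x)"
  shows "((\<lambda>x. window T ((c + x) / 2) * F x) has_real_derivative
    window' T ((c + x) / 2) / 2 * F x + window T ((c + x) / 2) * f) (at x)"
  using window_mult_has_derivative[OF T, where x = x and c = c and F = F and f = f] F
  by (simp add: add.commute)

lemma borel_measurable_fst_real [measurable]: "fst \<in> borel_measurable (borel :: (real \<times> real) measure)"
  and borel_measurable_snd_real [measurable]: "snd \<in> borel_measurable (borel :: (real \<times> real) measure)"
  by (auto intro!: borel_measurable_continuous_onI continuous_intros)

context null_wave
begin

text \<open>A multiplier depending on u alone has the bulk term g'(u) V / 2 and nothing else apart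
  from the ends of the time window. With g' close to the indicator of the strip, \<bar>g\<bar> is at
  most the width of the strip plus 2, which gives a bound independent of \<open>T\<close>.\<close>

lemma strip_flux:
  assumes T: "T \<ge> 2" and RL: "R + L \<ge> 0"
  shows "(LINT z|lborel. indicator {2..T} (time_of z) * indicator {- R..L} (fst z) * pot z) \<le> 2 * (L + R + 2) * energy0"
proof -
  define G where "G = L + R + 2"
  \<comment> \<open>A trapezoid with ramps of length 1 outside the strip; the ramps account for the
    summand 2 in \<open>G\<close>.\<close>
  define w where "w = (\<lambda>u. max 0 (min 1 (min (u + R + 1) (L + 1 - u))))"
  have wc: "continuous_on A w" for A unfolding w_def by (intro continuous_intros)
  have w01: "0 \<le> w u" "w u \<le> 1" for u unfolding w_def by auto
  have w0: "w u = 0" if "u \<notin> {- R - 1..L + 1}" for u using that unfolding w_def by auto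
  have w1: "w u = 1" if "u \<in> {- R..L}" for u using that unfolding w_def by auto
  obtain g where g: "\<And>u. (g has_real_derivative w u) (at u)" "\<And>u. \<bar>g u\<bar> \<le> (LINT y|lborel. \<bar>w y\<bar>)"
    using antiderivative_compact_support[OF wc w0] by metis
  have "(LINT y|lborel. \<bar>w y\<bar>) \<le> (LINT y|lborel. indicator {- R - 1..L + 1} y)"
  proof (rule integral_mono)
    show "integrable lborel (\<lambda>y. \<bar>w y\<bar>)"
      by (intro integrable_abs integrable_compact_support[OF wc, of "{- R - 1..L + 1}"]) (use w0 in auto)
    show "\<bar>w y\<bar> \<le> indicator {- R - 1..L + 1} y" for y
      using w01[of y] w0[of y] by (auto simp: indicator_def)
  qed (auto intro!: integrable_real_indicator simp: emeasure_lborel_Icc_eq)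
  also have "\<dots> = G" using RL by (simp add: G_def)
  finally have gG: "\<bar>g u\<bar> \<le> G" for u using g(2)[of u] by linarith
  have gc: "continuous_on A g" for A by (intro continuous_at_imp_continuous_on ballI DERIV_isCont[OF g(1)])
  note wb = window_bounds[OF T]
  define F where "F = (\<lambda>z. (window' T (time_of z) / 2 * g (fst z)) * (p z)\<^sup>2
      + (window' T (time_of z) / 2 * g (fst z) + window T (time_of z) * w (fst z)) * pot z / 2)"
  have em: "integrable lborel F" "(LINT z|lborel. F z) = 0"
  proof -
    have c: "continuous_on UNIV (\<lambda>z. window T (time_of z))" "continuous_on UNIV (\<lambda>z. window' T (time_of z))"
       "continuous_on UNIV (\<lambda>z. g (fst z))" "continuous_on UNIV (\<lambda>z. w (fst z))"
      by (intro continuous_on_compose2[OF window_cont(1)[of UNIV]] continuous_on_compose2[OF window_cont(2)[of UNIV]]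
        continuous_on_compose2[OF gc[of UNIV]] continuous_on_compose2[OF wc[of UNIV]] continuous_intros subset_UNIV; simp)+
    have d1: "((\<lambda>u. window T (time_of (u, v)) * g (fst (u, v))) has_real_derivative
        window' T (time_of (u, v)) / 2 * g (fst (u, v)) + window T (time_of (u, v)) * w (fst (u, v))) (at u)" for u v
      using window_mult_has_derivative[OF T g(1), where x = u and c = v] by simp
    have d2: "((\<lambda>v. window T (time_of (u, v)) * g (fst (u, v))) has_real_derivative
        window' T (time_of (u, v)) / 2 * g (fst (u, v))) (at v)" for u v
      using DERIV_cmult_right[OF time_of_chain(2)[OF window_has_derivative, of T u v], of "g u"] by simp
    have w2: "\<bar>window' T t / 2\<bar> \<le> 2" for t using wb(3,4)[of t] by linarith
    have b1: "\<bar>window T t * g u\<bar> \<le> 1 * G" for t u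
      unfolding abs_mult using wb(1,2)[of t] gG by (intro mult_mono) auto
    have b2: "\<bar>window' T t / 2 * g u\<bar> \<le> 2 * G" for t u
      unfolding abs_mult using w2[of t] gG by (intro mult_mono) auto
    have b3: "\<bar>window T t * w u\<bar> \<le> 1" for t u
      unfolding abs_mult using wb(1,2)[of t] w01[of u] by (intro mult_le_one) auto
    have G: "G \<ge> 2" using RL by (simp add: G_def)
    have supp: "window T (time_of z) * g (fst z) = 0 \<and> window' T (time_of z) / 2 * g (fst z) + window T (time_of z) * w (fst z) = 0
        \<and> window' T (time_of z) / 2 * g (fst z) = 0" if "time_of z \<notin> {1..T + 1}" for z
      using wb(5)[OF that] by simp
    note em = energy_multiplier[where h = "\<lambda>z. window T (time_of z) * g (fst z)" and a = 1 and b = "T + 1" and C = "2 * G + 1"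
        and hu = "\<lambda>z. window' T (time_of z) / 2 * g (fst z) + window T (time_of z) * w (fst z)"
        and hv = "\<lambda>z. window' T (time_of z) / 2 * g (fst z)"]
    have B: "\<bar>window T (time_of z) * g (fst z)\<bar> \<le> 2 * G + 1"
      "\<bar>window' T (time_of z) / 2 * g (fst z) + window T (time_of z) * w (fst z)\<bar> \<le> 2 * G + 1"
      "\<bar>window' T (time_of z) / 2 * g (fst z)\<bar> \<le> 2 * G + 1" for z
      using b1[of "time_of z" "fst z"] b2[of "time_of z" "fst z"] b3[of "time_of z" "fst z"] G by linarith+
    have c': "continuous_on UNIV (\<lambda>z. window T (time_of z) * g (fst z))"
      "continuous_on UNIV (\<lambda>z. window' T (time_of z) / 2 * g (fst z) + window T (time_of z) * w (fst z))"
      "continuous_on UNIV (\<lambda>z. window' T (time_of z) / 2 * g (fst z))"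
      using c by (auto intro!: continuous_on_add continuous_on_mult continuous_on_divide)
    show "integrable lborel F" "(LINT z|lborel. F z) = 0"
      unfolding F_def
      by (rule em[OF c'(1) c'(2) c'(3) d1 d2 supp B]; assumption)+
  qed
  have fl0: "flanks T t = 0" if "t \<notin> {1..T + 1}" for t using wb(5)[OF that] by simp
  note fl = energy_time_average[OF window_cont(3) fl0]
  have "(LINT z|lborel. indicator {2..T} (time_of z) * indicator {- R..L} (fst z) * pot z)
      \<le> (LINT z|lborel. 2 * F z + G * (flanks T (time_of z) * dens z))"
  proof (rule integral_mono)
    show "integrable lborel (\<lambda>z. indicator {2..T} (time_of z) * indicator {- R..L} (fst z) * pot z)"
      by (rule slab_mult_dens[where C = 1 and a = 4 and b = "2 * T"])
        (use dens_bounds in \<open>auto simp: indicator_def\<close>)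
    show "integrable lborel (\<lambda>z. 2 * F z + G * (flanks T (time_of z) * dens z))" using em fl by simp
    fix z
    let ?t = "time_of z"
    have "\<bar>window' T ?t * g (fst z)\<bar> \<le> flanks T ?t * G"
      unfolding abs_mult using wb(3)[of ?t] gG flanks_nonneg by (intro mult_mono) auto
    moreover have "\<bar>(p z)\<^sup>2 + pot z / 2\<bar> \<le> dens z"
    proof -
      have "\<bar>(p z)\<^sup>2 + pot z / 2\<bar> = (p z)\<^sup>2 + pot z / 2" by (rule abs_of_nonneg) simp
      then show ?thesis using dens_bounds(5)[of z] pot_nonneg[of z] by linarith
    qed
    ultimately have "\<bar>(window' T ?t * g (fst z)) * ((p z)\<^sup>2 + pot z / 2)\<bar> \<le> (flanks T ?t * G) * dens z"
      unfolding abs_mult[of _ "(p z)\<^sup>2 + pot z / 2"]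
      by (intro mult_mono) (auto intro: order_trans[OF abs_ge_zero])
    moreover have "2 * F z = (window' T ?t * g (fst z)) * ((p z)\<^sup>2 + pot z / 2) + window T ?t * w (fst z) * pot z"
      unfolding F_def by (simp add: field_simps)
    moreover have "indicator {2..T} ?t * indicator {- R..L} (fst z) * pot z \<le> window T ?t * w (fst z) * pot z"
    proof (rule mult_right_mono)
      show "indicator {2..T} ?t * indicator {- R..L} (fst z) \<le> window T ?t * w (fst z)"
      proof (cases "?t \<in> {2..T} \<and> fst z \<in> {- R..L}")
        case True
        then have "window T ?t = 1" "w (fst z) = 1" using wb(6)[of ?t] w1 by auto
        then show ?thesis using True by (simp add: indicator_def)
      next
        case False
        then have *: "indicator {2..T} ?t * indicator {- R..L} (fst z) = (0::real)" by (auto simp: indicator_def)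
        show ?thesis unfolding * using wb(1)[of ?t] w01(1)[of "fst z"] by (rule mult_nonneg_nonneg)
      qed
    qed simp
    ultimately show "indicator {2..T} ?t * indicator {- R..L} (fst z) * pot z \<le> 2 * F z + G * (flanks T ?t * dens z)"
      by (simp add: mult_ac)
  qed
  also have "\<dots> = 2 * G * energy0" using em fl flanks_integral(2)[of T] by simp
  finally show ?thesis unfolding G_def by simp
qed

end

lemma cone_integral:
  assumes \<omega>: "continuous_on UNIV \<omega>" "\<And>t. t \<notin> {1..b} \<Longrightarrow> \<omega> t = 0"
  defines "cn \<equiv> \<lambda>z :: real \<times> real. if fst z \<ge> 0 \<and> snd z \<ge> 0 then 1 / max 1 (time_of z) else 0"
  shows "integrable lborel (\<lambda>z. \<omega> (time_of z) * cn z)"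
    and "(LINT z|lborel. \<omega> (time_of z) * cn z) = 4 * (LINT t|lborel. \<omega> t)"
proof -
  define f where "f = (\<lambda>z. \<omega> (fst z) * (if \<bar>snd z\<bar> \<le> fst z then 1 / max 1 (fst z) else 0))"
  have [measurable]: "\<omega> \<in> borel_measurable borel" by (rule borel_measurable_continuous_onI[OF \<omega>(1)])
  have fm [measurable]: "f \<in> borel_measurable borel" unfolding f_def by measurable
  obtain C where C: "\<And>t. \<bar>\<omega> t\<bar> \<le> C" using continuous_compact_support_bounded[OF \<omega>(1), of "{1..b}"] \<omega>(2) by auto
  have fi: "integrable lborel f"
  proof (rule Bochner_Integration.integrable_bound)
    have "integrable lborel (\<lambda>z. indicator (cbox (1, - b) (b, b)) z *\<^sub>R C)"
      by (intro borel_integrable_compact) auto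
    then show "integrable lborel (\<lambda>z. C * indicator (cbox (1, - b) (b, b)) z)" by (simp add: mult.commute)
    have "\<bar>f z\<bar> \<le> C * indicator (cbox (1, - b) (b, b)) z" for z
    proof (cases "fst z \<in> {1..b} \<and> \<bar>snd z\<bar> \<le> fst z")
      case True
      then have "z \<in> cbox (1, - b) (b, b)" by (cases z) (auto simp: cbox_Pair_eq cbox_interval)
      moreover have "\<bar>\<omega> (fst z)\<bar> * (1 / max 1 (fst z)) \<le> C * 1" using C[of "fst z"] by (intro mult_mono) auto
      ultimately show ?thesis using True by (simp add: f_def abs_mult)
    next
      case False
      then have "f z = 0" using \<omega>(2)[of "fst z"] by (auto simp: f_def)
      then show ?thesis using C[of 0] by simp
    qed
    then show "AE z in lborel. norm (f z) \<le> norm (C * indicator (cbox (1, - b) (b, b)) z)"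
      by (intro AE_I2) (auto intro: order_trans[OF _ abs_ge_self])
  qed measurable
  have eq: "f (null_map z) = \<omega> (time_of z) * cn z" for z
  proof -
    have "\<bar>(snd z - fst z) / 2\<bar> \<le> time_of z \<longleftrightarrow> fst z \<ge> 0 \<and> snd z \<ge> 0"
    proof safe
      assume *: "\<bar>(snd z - fst z) / 2\<bar> \<le> time_of z"
      then have **: "(snd z - fst z) / 2 \<le> time_of z" "- ((snd z - fst z) / 2) \<le> time_of z"
        unfolding abs_le_iff by blast+
      show "fst z \<ge> 0" using ** by (simp add: field_simps)
      show "snd z \<ge> 0" using ** by (simp add: field_simps)
    qed (simp add: abs_le_iff field_simps)
    then show ?thesis by (simp add: f_def cn_def)
  qed
  show "integrable lborel (\<lambda>z. \<omega> (time_of z) * cn z)"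
    using integrable_null_map[OF fm] fi by (simp add: eq)
  have "(LINT z|lborel. \<omega> (time_of z) * cn z) = 2 * (LINT z|lborel. f z)"
    using integral_null_map[OF fm] by (simp add: eq)
  also have "(LINT z|lborel. f z) = (LINT t|lborel. LINT x|lborel. f (t, x))"
    using plane_integral_fst(1)[OF fi] by simp
  also have "\<dots> = (LINT t|lborel. 2 * \<omega> t)"
  proof (rule Bochner_Integration.integral_cong)
    fix t :: real
    show "(LINT x|lborel. f (t, x)) = 2 * \<omega> t"
    proof (cases "t \<in> {1..b}")
      case True
      \<comment> \<open>The slice of the cone has length 2t, which cancels the weight 1/t; the
        Jacobian contributes the other factor 2.\<close>
      have "f (t, x) = (\<omega> t / t) * indicator {- t..t} x" for x
        using True by (auto simp: f_def indicator_def)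
      then show ?thesis using True by simp
    next
      case False
      then show ?thesis using \<omega>(2)[OF False] by (simp add: f_def)
    qed
  qed simp
  finally show "(LINT z|lborel. \<omega> (time_of z) * cn z) = 4 * (LINT t|lborel. \<omega> t)" by simp
qed

text \<open>The weight K of the overview, extended by 0 outside the cone. The truncation at u + v =
  1 removes the singular vertex; the time window ignores that region.\<close>

definition cone_weight :: "real \<times> real \<Rightarrow> real" where
  "cone_weight z = 32 * (max 0 (fst z))\<^sup>2 * (max 0 (snd z))\<^sup>2 / (max 1 (fst z + snd z)) ^ 5"

definition cone_weight' :: "real \<times> real \<Rightarrow> real" where
  "cone_weight' z = 64 * (max 0 (fst z))\<^sup>2 * max 0 (snd z) / (max 1 (fst z + snd z)) ^ 5
     - 160 * (max 0 (fst z))\<^sup>2 * (max 0 (snd z))\<^sup>2 / (max 1 (fst z + snd z)) ^ 6"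

lemma cone_weight_cont: "continuous_on UNIV cone_weight" "continuous_on UNIV cone_weight'"
  unfolding cone_weight_def cone_weight'_def by (intro continuous_intros; simp add: max_def)+

lemma cone_weight_has_derivative:
  assumes "u + v > 1"
  shows "((\<lambda>v. cone_weight (u, v)) has_real_derivative cone_weight' (u, v)) (at v)"
proof -
  have "((\<lambda>v. 32 * (max 0 u)\<^sup>2 * (max 0 v)\<^sup>2 / (u + v) ^ 5) has_real_derivative
      (32 * (max 0 u)\<^sup>2 * (2 * max 0 v) * (u + v) ^ 5 - 32 * (max 0 u)\<^sup>2 * (max 0 v)\<^sup>2 * (5 * (u + v) ^ 4)) / ((u + v) ^ 5 * (u + v) ^ 5)) (at v)"
    using assms by (intro DERIV_divide DERIV_cmult pos_part_square_has_derivative) (auto intro!: derivative_eq_intros)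
  also have "(32 * (max 0 u)\<^sup>2 * (2 * max 0 v) * (u + v) ^ 5 - 32 * (max 0 u)\<^sup>2 * (max 0 v)\<^sup>2 * (5 * (u + v) ^ 4)) / ((u + v) ^ 5 * (u + v) ^ 5)
      = cone_weight' (u, v)"
  proof -
    have "(x * s ^ 5 - y * (5 * s ^ 4)) / (s ^ 5 * s ^ 5) = x / s ^ 5 - 5 * y / s ^ 6" if "s > 1" for x y s :: real
      using that by (simp add: field_simps eval_nat_numeral)
    note this[OF assms, of "32 * (max 0 u)\<^sup>2 * (2 * max 0 v)" "32 * (max 0 u)\<^sup>2 * (max 0 v)\<^sup>2"]
    also have "32 * (max 0 u)\<^sup>2 * (2 * max 0 v) / (u + v) ^ 5 - 5 * (32 * (max 0 u)\<^sup>2 * (max 0 v)\<^sup>2) / (u + v) ^ 6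
        = cone_weight' (u, v)" using assms by (simp add: cone_weight'_def)
    finally show ?thesis .
  qed
  finally have "((\<lambda>v. 32 * (max 0 u)\<^sup>2 * (max 0 v)\<^sup>2 / (u + v) ^ 5) has_real_derivative cone_weight' (u, v)) (at v)" .
  then show ?thesis
    by (rule has_field_derivative_transform_within_open[where S = "{v. u + v > 1}"])
      (use assms in \<open>auto simp: cone_weight_def intro!: open_Collect_less continuous_intros\<close>)
qed

text \<open>After division by s = u + v both numerators are polynomials in two quantities between 0
  and 1, and the degrees -1 and -2 of homogeneity give the powers of s.\<close>

lemma cone_weight_bounds:
  "0 \<le> cone_weight z" "cone_weight z \<le> 32 / max 1 (fst z + snd z)" "\<bar>cone_weight' z\<bar> \<le> 160 / (max 1 (fst z + snd z))\<^sup>2"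
proof -
  define s where "s = max 1 (fst z + snd z)"
  define a where "a = max 0 (fst z) / s"
  define b where "b = max 0 (snd z) / s"
  have s: "s \<ge> 1" by (simp add: s_def)
  show "0 \<le> cone_weight z" using s by (simp add: cone_weight_def flip: s_def)
  have e: "cone_weight z = 32 * (a\<^sup>2 * b\<^sup>2) / s" "cone_weight' z = (64 * (a\<^sup>2 * b) - 160 * (a\<^sup>2 * b\<^sup>2)) / s\<^sup>2"
    using s by (simp_all add: cone_weight_def cone_weight'_def a_def b_def field_simps eval_nat_numeral flip: s_def)
  show "cone_weight z \<le> 32 / max 1 (fst z + snd z)" "\<bar>cone_weight' z\<bar> \<le> 160 / (max 1 (fst z + snd z))\<^sup>2"
  proof -
    have ab: "a\<^sup>2 * b\<^sup>2 \<le> 1 \<and> a\<^sup>2 * b \<le> 1 \<and> 0 \<le> a\<^sup>2 * b\<^sup>2 \<and> 0 \<le> a\<^sup>2 * b"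
    proof (cases "fst z \<ge> 0 \<and> snd z \<ge> 0")
      case True
      then have "0 \<le> a" "a \<le> 1" "0 \<le> b" "b \<le> 1" using s by (auto simp: a_def b_def s_def)
      then show ?thesis by (auto intro!: mult_le_one power_le_one)
    qed (auto simp: a_def b_def)
    then have "32 * (a\<^sup>2 * b\<^sup>2) / s \<le> 32 / s" using s by (intro divide_right_mono) auto
    then show "cone_weight z \<le> 32 / max 1 (fst z + snd z)" unfolding e s_def[symmetric] .
    have "\<bar>64 * (a\<^sup>2 * b) - 160 * (a\<^sup>2 * b\<^sup>2)\<bar> \<le> 160" using ab by (simp only: abs_le_iff) linarith
    then show "\<bar>cone_weight' z\<bar> \<le> 160 / (max 1 (fst z + snd z))\<^sup>2"
      unfolding e s_def[symmetric] abs_divide using s by (auto intro!: divide_right_mono)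
  qed
qed

lemma cone_weight_0: "fst z \<le> 0 \<or> snd z \<le> 0 \<Longrightarrow> cone_weight z = 0 \<and> cone_weight' z = 0"
  by (auto simp: cone_weight_def cone_weight'_def)

section \<open>The homogeneous multiplier\<close>

text \<open>Both components of the multiplier are functions of \<open>x = u / (u + v)\<close> alone. Their slopes
  \<open>- 32 x\<^sup>2 (1 - x)\<close> and \<open>32 x (1 - x)\<^sup>2\<close> are chosen such that the quadratic form in
  \<open>(\<theta>\<^sub>u, \<theta>\<^sub>v)\<close> in the bulk term becomes a perfect square.\<close>

definition ray_slope :: "real \<Rightarrow> real" where
  "ray_slope x = - 32 * (max 0 (min 1 x))\<^sup>2 * (1 - max 0 (min 1 x))"

text \<open>The v-derivative of the primitive of \<open>ray_slope\<close> along x = u / (u + v). It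
  is the coefficient of \<theta>_u^2 in the bulk; with u and v exchanged it is that of
  \<theta>_v^2.\<close>

definition flux_weight :: "real \<times> real \<Rightarrow> real" where
  "flux_weight z = 32 * (max 0 (fst z)) ^ 3 * max 0 (snd z) / (max 1 (fst z + snd z)) ^ 5"

lemma ray_slope_eq:
  assumes "u + v > 1"
  shows "ray_slope (u / (u + v)) = - 32 * (max 0 u)\<^sup>2 * max 0 v / (u + v) ^ 3"
proof -
  define s where "s = u + v"
  have s: "s > 1" "v = s - u" using assms by (auto simp: s_def)
  consider "u < 0" | "u \<ge> 0" "v < 0" | "u \<ge> 0" "v \<ge> 0" by linarith
  then have "ray_slope (u / s) = - 32 * (max 0 u)\<^sup>2 * max 0 v / s ^ 3"
  proof cases
    case 1
    then have "u / s \<le> 0" using s by (simp add: divide_le_0_iff)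
    then show ?thesis using 1 by (simp add: ray_slope_def)
  next
    case 2
    then have "u / s \<ge> 1" using s by simp
    then show ?thesis using 2 by (simp add: ray_slope_def)
  next
    case 3
    then have "0 \<le> u / s" "u / s \<le> 1" using s by auto
    then have "ray_slope (u / s) = - 32 * (u / s)\<^sup>2 * (1 - u / s)" by (simp add: ray_slope_def)
    also have "1 - u / s = v / s" using s by (simp add: field_simps)
    also have "- 32 * (u / s)\<^sup>2 * (v / s) = - 32 * u\<^sup>2 * v / s ^ 3"
      by (simp add: power_divide eval_nat_numeral)
    finally show ?thesis using 3 by simp
  qed
  then show ?thesis by (simp add: s_def)
qed

text \<open>The derivatives of u / (u + v) are v / (u + v)^2 and - u / (u + v)^2. Their ratio links
  the two weights, so a single slope determines the coefficients of \<theta>_u^2 and of the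
  potential together.\<close>

lemma ray_primitive_has_derivative:
  assumes A: "\<And>x. (A has_real_derivative ray_slope x) (at x)" and uv: "u + v > 1"
  shows "((\<lambda>u. A (u / max 1 (u + v))) has_real_derivative - cone_weight (u, v)) (at u)"
    and "((\<lambda>v. A (u / max 1 (u + v))) has_real_derivative flux_weight (u, v)) (at v)"
proof -
  have m: "max 0 v * v = (max 0 v)\<^sup>2" "(max 0 u)\<^sup>2 * u = (max 0 u) ^ 3"
    by (auto simp: max_def power2_eq_square eval_nat_numeral)
  have "((\<lambda>u. u / (u + v)) has_real_derivative v / (u + v)\<^sup>2) (at u)"
    using uv by (auto intro!: derivative_eq_intros simp: power2_eq_square field_simps)
  from DERIV_chain2[OF A this]
  have "((\<lambda>u. A (u / (u + v))) has_real_derivative ray_slope (u / (u + v)) * (v / (u + v)\<^sup>2)) (at u)" .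
  also have "ray_slope (u / (u + v)) * (v / (u + v)\<^sup>2) = - (32 * (max 0 u)\<^sup>2 * (max 0 v * v) / (u + v) ^ 5)"
    unfolding ray_slope_eq[OF uv] by (simp add: eval_nat_numeral mult.assoc)
  also have "\<dots> = - cone_weight (u, v)" using uv by (simp add: cone_weight_def m)
  finally have "((\<lambda>u. A (u / (u + v))) has_real_derivative - cone_weight (u, v)) (at u)" .
  then show "((\<lambda>u. A (u / max 1 (u + v))) has_real_derivative - cone_weight (u, v)) (at u)"
    by (rule has_field_derivative_transform_within_open[where S = "{u. u + v > 1}"])
      (use uv in \<open>auto intro!: open_Collect_less continuous_intros\<close>)
  have "((\<lambda>v. u / (u + v)) has_real_derivative - (u / (u + v)\<^sup>2)) (at v)"
    using uv by (auto intro!: derivative_eq_intros simp: power2_eq_square)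
  from DERIV_chain2[OF A this]
  have "((\<lambda>v. A (u / (u + v))) has_real_derivative ray_slope (u / (u + v)) * - (u / (u + v)\<^sup>2)) (at v)" .
  also have "ray_slope (u / (u + v)) * - (u / (u + v)\<^sup>2) = 32 * ((max 0 u)\<^sup>2 * u) * max 0 v / (u + v) ^ 5"
    unfolding ray_slope_eq[OF uv] by (simp add: eval_nat_numeral mult.assoc)
  also have "\<dots> = flux_weight (u, v)" using uv by (simp add: flux_weight_def m)
  finally have "((\<lambda>v. A (u / (u + v))) has_real_derivative flux_weight (u, v)) (at v)" .
  then show "((\<lambda>v. A (u / max 1 (u + v))) has_real_derivative flux_weight (u, v)) (at v)"
    by (rule has_field_derivative_transform_within_open[where S = "{v. u + v > 1}"])
      (use uv in \<open>auto intro!: open_Collect_less continuous_intros\<close>)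
qed

lemma flux_weight_cont: "continuous_on UNIV flux_weight"
  unfolding flux_weight_def by (intro continuous_intros; simp add: max_def)

lemma flux_weight_bounds: "0 \<le> flux_weight z" "flux_weight z \<le> 32"
proof -
  define s where "s = max 1 (fst z + snd z)"
  define a where "a = max 0 (fst z) / s"
  define b where "b = max 0 (snd z) / s"
  have s: "s \<ge> 1" by (simp add: s_def)
  show "0 \<le> flux_weight z" using s by (simp add: flux_weight_def flip: s_def)
  have e: "flux_weight z = 32 * (a ^ 3 * b) / s"
    using s by (simp add: flux_weight_def a_def b_def field_simps eval_nat_numeral flip: s_def)
  have "a ^ 3 * b \<le> 1 \<and> 0 \<le> a ^ 3 * b"
  proof (cases "fst z \<ge> 0 \<and> snd z \<ge> 0")
    case True
    then have "0 \<le> a" "a \<le> 1" "0 \<le> b" "b \<le> 1" using s by (auto simp: a_def b_def s_def)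
    then show ?thesis by (auto intro!: mult_le_one power_le_one)
  qed (auto simp: a_def b_def)
  then have "32 * (a ^ 3 * b) \<le> 32 * s" using s by linarith
  then show "flux_weight z \<le> 32" unfolding e using s by (simp add: divide_le_eq)
qed

text \<open>The product of the two flux weights is the square of \<open>cone_weight\<close>, so the
  form degenerates to a nonnegative multiple of (u x - v y)^2; at x = \<theta>_u, y = \<theta>_v
  this is the squared derivative along Lorentz boosts.\<close>

lemma multiplier_form_nonneg:
  "flux_weight (u, v) * x\<^sup>2 + flux_weight (v, u) * y\<^sup>2 - 2 * cone_weight (u, v) * (x * y) \<ge> 0"
proof -
  define a b s where "a = max 0 u" and "b = max 0 v" and "s = (max 1 (u + v)) ^ 5"
  have s0: "s \<noteq> 0" by (auto simp: s_def max_def)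
  have "flux_weight (u, v) * x\<^sup>2 + flux_weight (v, u) * y\<^sup>2 - 2 * cone_weight (u, v) * (x * y)
      = 32 * a ^ 3 * b / s * x\<^sup>2 + 32 * b ^ 3 * a / s * y\<^sup>2 - 2 * (32 * a\<^sup>2 * b\<^sup>2 / s) * (x * y)"
    by (simp add: flux_weight_def cone_weight_def a_def b_def s_def add.commute)
  also have "\<dots> = 32 * a * b / s * (a * x - b * y)\<^sup>2"
    using s0 by (simp add: field_simps power2_eq_square eval_nat_numeral)
  finally show ?thesis by (simp add: a_def b_def s_def)
qed

text \<open>The rate t^(-3/2), truncated at t = 1. It is what remains of K_v = O(1/t^2) after
  Young's inequality with ratio sqrt t, and it is integrable at infinity with integral 2 from t = 1
  on.\<close>

definition decay_rate :: "real \<Rightarrow> real" where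
  "decay_rate t = 1 / (max 1 t * sqrt (max 1 t))"

lemma decay_rate_cont: "continuous_on A decay_rate"
  unfolding decay_rate_def by (intro continuous_intros) (auto simp: max_def)

lemma decay_rate_nonneg: "decay_rate t \<ge> 0" by (simp add: decay_rate_def)

lemma window_decay_integral:
  assumes T: "T \<ge> 2"
  shows "integrable lborel (\<lambda>t. window T t * decay_rate t)" "(LINT t|lborel. window T t * decay_rate t) \<le> 2"
proof -
  note wb = window_bounds[OF T]
  show i: "integrable lborel (\<lambda>t. window T t * decay_rate t)"
    by (rule integrable_compact_support[of _ "{1..T + 1}"])
      (use wb(5) in \<open>auto intro!: continuous_intros window_cont decay_rate_cont\<close>)
  have "((\<lambda>t. - 2 / sqrt t) has_real_derivative 1 / (t * sqrt t)) (at t)" if "t > 0" for t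
    using that by (auto intro!: derivative_eq_intros simp: field_simps power2_eq_square)
  moreover have "isCont (\<lambda>t. 1 / (t * sqrt t)) t" if "t > 0" for t :: real
    using that by (intro continuous_intros) auto
  ultimately have ftc: "has_bochner_integral lborel (\<lambda>t. 1 / (t * sqrt t) * indicator {1..T + 1} t) (- 2 / sqrt (T + 1) - - 2 / sqrt 1)"
    using T by (intro has_bochner_integral_FTC_Icc_real) auto
  have "(LINT t|lborel. window T t * decay_rate t) \<le> (LINT t|lborel. 1 / (t * sqrt t) * indicator {1..T + 1} t)"
  proof (rule integral_mono[OF i])
    show "integrable lborel (\<lambda>t. 1 / (t * sqrt t) * indicator {1..T + 1} t)" using ftc by (simp add: has_bochner_integral_iff)
    show "window T t * decay_rate t \<le> 1 / (t * sqrt t) * indicator {1..T + 1} t" for t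
    proof (cases "t \<in> {1..T + 1}")
      case True
      have "window T t * decay_rate t \<le> 1 * decay_rate t"
        using wb(2) decay_rate_nonneg by (intro mult_right_mono)
      then show ?thesis using True by (simp add: decay_rate_def)
    qed (use wb(5) in simp)
  qed
  also have "\<dots> \<le> 2" using ftc T by (simp add: has_bochner_integral_iff)
  finally show "(LINT t|lborel. window T t * decay_rate t) \<le> 2" .
qed

context null_wave
begin

text \<open>Small values of \<theta> are bounded by 1, large ones by the power P + 1 > 2. The
  constant 1 is not integrable in space, which is why the weights must live in the cone.\<close>

lemma \<theta>_square_le: "(\<theta> z)\<^sup>2 \<le> 1 + (P + 1) * pot z"
proof (cases "\<bar>\<theta> z\<bar> \<le> 1")
  case True
  then have "(\<theta> z)\<^sup>2 \<le> 1" by (simp add: abs_square_le_1)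
  moreover have "(P + 1) * pot z \<ge> 0" using P pot_nonneg[of z] by (intro mult_nonneg_nonneg) auto
  ultimately show ?thesis by linarith
next
  case False
  then have "\<bar>\<theta> z\<bar> powr 2 \<le> \<bar>\<theta> z\<bar> powr (P + 1)" using P by (intro powr_mono) auto
  then show ?thesis using False unfolding powr_\<theta> by simp
qed

text \<open>These terms come from the derivative of window times cone weight in the Lagrangian
  identity. \<open>cn\<close> is 1/t on the forward cone and carries the constant 1 from
  \<open>\<theta>_square_le\<close>. The factors 8 and 40 are half of 16 = 32/2 and 160/4, the
  bounds on K and K_v at u + v = 2t, the latter with the factor 2 of the left side.\<close>

lemma flank_error_bound:
  assumes T: "T \<ge> 2"
  defines "cn \<equiv> \<lambda>z :: real \<times> real. if fst z \<ge> 0 \<and> snd z \<ge> 0 then 1 / max 1 (time_of z) else 0"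
  shows "\<bar>window' T (time_of z) * cone_weight z * \<theta> z * p z\<bar> \<le> flanks T (time_of z) * (8 * cn z + 8 * (P + 1) * dens z)"
    and "\<bar>2 * window T (time_of z) * cone_weight' z * \<theta> z * p z\<bar>
      \<le> window T (time_of z) * decay_rate (time_of z) * (40 * cn z + 40 * (P + 1) * dens z)"
proof -
  note wb = window_bounds[OF T, of "time_of z"]
  let ?t = "time_of z"
  have cn0: "cn z \<ge> 0" by (simp add: cn_def le_max_iff_disj)
  have D0: "(P + 1) * dens z \<ge> 0" using P dens_bounds(1)[of z] by (intro mult_nonneg_nonneg) auto
  have "\<bar>window' T ?t * cone_weight z * \<theta> z * p z\<bar> \<le> flanks T ?t * (8 * cn z + 8 * (P + 1) * dens z) \<and>
    \<bar>2 * window T ?t * cone_weight' z * \<theta> z * p z\<bar>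
    \<le> window T ?t * decay_rate ?t * (40 * cn z + 40 * (P + 1) * dens z)"
  proof (cases "fst z \<ge> 0 \<and> snd z \<ge> 0 \<and> ?t \<ge> 1")
    case False
    then consider "fst z \<le> 0 \<or> snd z \<le> 0" | "?t \<notin> {1..T + 1}" by fastforce
    then have zero: "cone_weight z = 0 \<and> cone_weight' z = 0 \<or> window T ?t = 0 \<and> window' T ?t = 0"
      using cone_weight_0[of z] wb(5) by cases auto
    have nn: "k * cn z + k * (P + 1) * dens z \<ge> 0" if "k \<ge> 0" for k
      using mult_nonneg_nonneg[OF that cn0] mult_nonneg_nonneg[OF that D0] by (simp add: mult.assoc)
    have "flanks T ?t * (8 * cn z + 8 * (P + 1) * dens z) \<ge> 0"
      by (rule mult_nonneg_nonneg[OF flanks_nonneg nn]) simp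
    moreover have "window T ?t * decay_rate ?t * (40 * cn z + 40 * (P + 1) * dens z) \<ge> 0"
      by (rule mult_nonneg_nonneg[OF mult_nonneg_nonneg[OF wb(1) decay_rate_nonneg] nn]) simp
    ultimately show ?thesis using zero by auto
  next
    case True
    define t where "t = ?t"
    define r where "r = sqrt t"
    have t: "t \<ge> 1" "fst z + snd z = 2 * t" using True by (auto simp: t_def)
    have r: "r \<ge> 1" "t = r * r" using t by (auto simp: r_def)
    have cn: "cn z = 1 / t" using True by (simp add: cn_def t_def)
    have dr: "decay_rate t = 1 / (t * r)" using t by (simp add: decay_rate_def r_def)
    have K: "cone_weight z \<le> 16 / t" "\<bar>cone_weight' z\<bar> \<le> 40 / t\<^sup>2"
      using cone_weight_bounds(2,3)[of z] t by (simp_all add: power_mult_distrib)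
    have pD: "(P + 1) * pot z + (p z)\<^sup>2 \<le> (P + 1) * dens z"
    proof -
      have "(P + 1) * ((p z)\<^sup>2 + pot z) \<le> (P + 1) * dens z"
        using P dens_bounds(5)[of z] by (intro mult_left_mono) auto
      moreover have "1 * (p z)\<^sup>2 \<le> (P + 1) * (p z)\<^sup>2" using P by (intro mult_right_mono) auto
      ultimately show ?thesis by (simp add: distrib_left)
    qed
    have V0: "(P + 1) * pot z \<ge> 0" using P pot_nonneg[of z] by (intro mult_nonneg_nonneg) auto
    \<comment> \<open>Used with c = 1 at the ends of the window, where K = O(1/t) is enough, and
      with c = sqrt t in the bulk, where it balances the growth of the cone against the
      energy.\<close>
    have young: "2 * \<bar>\<theta> z * p z\<bar> \<le> (\<theta> z)\<^sup>2 / c + c * (p z)\<^sup>2" if "c > 0" for c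
    proof -
      have "0 \<le> (\<bar>\<theta> z\<bar> - c * \<bar>p z\<bar>)\<^sup>2 / c" using that by simp
      also have "\<dots> = (\<theta> z)\<^sup>2 / c + c * (p z)\<^sup>2 - 2 * \<bar>\<theta> z * p z\<bar>"
        using that by (simp add: power2_diff abs_mult power_mult_distrib field_simps power2_eq_square)
      finally show ?thesis by simp
    qed
    have 1: "\<bar>cone_weight z * (\<theta> z * p z)\<bar> \<le> 8 * cn z + 8 * (P + 1) * dens z"
    proof -
      have "\<bar>cone_weight z * (\<theta> z * p z)\<bar> \<le> 16 / t * ((1 + (P + 1) * pot z + (p z)\<^sup>2) / 2)"
        unfolding abs_mult[of "cone_weight z"]
        using K(1) cone_weight_bounds(1)[of z] young[of 1] \<theta>_square_le[of z] t
        by (intro mult_mono) auto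
      also have "\<dots> = 8 / t + 8 / t * ((P + 1) * pot z + (p z)\<^sup>2)"
        using t(1) by (simp add: field_simps)
      also have "\<dots> \<le> 8 * (1 / t) + 8 * (P + 1) * dens z"
      proof -
        have "8 / t * ((P + 1) * pot z + (p z)\<^sup>2) \<le> 8 * ((P + 1) * dens z)"
          using pD V0 t by (intro mult_mono) (auto simp: divide_le_eq)
        then show ?thesis by (simp only: mult.assoc)
      qed
      finally show ?thesis by (simp only: cn)
    qed
    have "\<bar>window' T ?t * (cone_weight z * (\<theta> z * p z))\<bar> \<le> flanks T ?t * (8 * cn z + 8 * (P + 1) * dens z)"
      unfolding abs_mult[of "window' T ?t"] using 1 wb(3) flanks_nonneg by (intro mult_mono) auto
    moreover have 2: "\<bar>2 * (cone_weight' z * (\<theta> z * p z))\<bar> \<le> decay_rate t * (40 * cn z + 40 * (P + 1) * dens z)"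
    proof -
      have "\<bar>2 * (cone_weight' z * (\<theta> z * p z))\<bar> = \<bar>cone_weight' z\<bar> * (2 * \<bar>\<theta> z * p z\<bar>)" by (simp add: abs_mult)
      also have "\<dots> \<le> 40 / t\<^sup>2 * ((1 + (P + 1) * pot z) / r + r * (p z)\<^sup>2)"
      proof (intro mult_mono K(2))
        have "(\<theta> z)\<^sup>2 / r \<le> (1 + (P + 1) * pot z) / r" using \<theta>_square_le[of z] r by (intro divide_right_mono) auto
        then show "2 * \<bar>\<theta> z * p z\<bar> \<le> (1 + (P + 1) * pot z) / r + r * (p z)\<^sup>2" using young[of r] r by linarith
      qed auto
      also have "\<dots> = 40 * decay_rate t * ((1 + (P + 1) * pot z) / t + (p z)\<^sup>2)"
        unfolding dr unfolding r(2) using r(1) by (simp add: field_simps power2_eq_square)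
      also have "\<dots> \<le> 40 * decay_rate t * (cn z + (P + 1) * dens z)"
      proof (rule mult_left_mono)
        have "(P + 1) * pot z / t \<le> (P + 1) * pot z / 1" using V0 t by (intro divide_left_mono) auto
        then show "(1 + (P + 1) * pot z) / t + (p z)\<^sup>2 \<le> cn z + (P + 1) * dens z"
          using pD by (simp add: cn add_divide_distrib)
      qed (use decay_rate_nonneg in simp)
      finally show ?thesis by (simp add: algebra_simps)
    qed
    then have "window T ?t * \<bar>2 * (cone_weight' z * (\<theta> z * p z))\<bar> \<le> window T ?t * (decay_rate ?t * (40 * cn z + 40 * (P + 1) * dens z))"
      unfolding t_def using wb(1) by (intro mult_left_mono) auto
    ultimately show ?thesis using wb(1) by (simp add: abs_mult mult_ac)
  qed
  then show "\<bar>window' T ?t * cone_weight z * \<theta> z * p z\<bar> \<le> flanks T ?t * (8 * cn z + 8 * (P + 1) * dens z)"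
    "\<bar>2 * window T ?t * cone_weight' z * \<theta> z * p z\<bar>
      \<le> window T ?t * decay_rate ?t * (40 * cn z + 40 * (P + 1) * dens z)" by blast+
qed

end

section \<open>Finiteness of the weighted potential energy\<close>

lemma ray_slope_cont: "continuous_on A ray_slope"
  unfolding ray_slope_def by (intro continuous_intros)

lemma ray_slope_0: "x \<notin> {0..1} \<Longrightarrow> ray_slope x = 0"
  by (auto simp: ray_slope_def max_def)

context null_wave
begin

lemma window_cone_integrable:
  assumes T: "T \<ge> 2"
  shows "integrable lborel (\<lambda>z. window T (time_of z) * cone_weight z * pot z)"
proof (rule slab_mult_dens[where C = 32 and a = 2 and b = "2 * T + 2"])
  show "(\<lambda>z. window T (time_of z) * cone_weight z) \<in> borel_measurable borel"
    by (intro borel_measurable_continuous_onI continuous_on_mult cone_weight_cont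
        continuous_on_compose2[OF window_cont(1)[of UNIV]] continuous_intros) auto
  fix z :: "real \<times> real"
  have "32 / max 1 (fst z + snd z) \<le> 32 / 1" by (intro divide_left_mono) auto
  then have "cone_weight z \<le> 32" using cone_weight_bounds(2)[of z] by linarith
  then have "\<bar>window T (time_of z)\<bar> * \<bar>cone_weight z\<bar> \<le> 1 * 32"
    using window_bounds(1,2)[OF T] cone_weight_bounds(1)[of z] by (intro mult_mono) auto
  then show "\<bar>window T (time_of z) * cone_weight z\<bar> \<le> 32" by (simp add: abs_mult)
  show "window T (time_of z) * cone_weight z = 0" if "fst z + snd z \<notin> {2..2 * T + 2}"
    using window_bounds(5)[OF T, of "time_of z"] that by auto
qed (use dens_bounds in auto)

text \<open>The identity for \<theta>_u with the multiplier A(u/(u+v)) and that for \<theta>_v with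
  A(v/(u+v)) are added, and twice the Lagrangian identity with weight K is subtracted. The quadratic
  terms become a square and the potential keeps a positive multiple of K; everything else is an
  error bounded uniformly in \<open>T\<close>.\<close>

lemma weighted_potential_bounded:
  "\<exists>C. \<forall>T\<ge>2. (LINT z|lborel. window T (time_of z) * cone_weight z * pot z) \<le> C"
proof -
  obtain A where A: "\<And>x. (A has_real_derivative ray_slope x) (at x)" "\<And>x. \<bar>A x\<bar> \<le> (LINT y|lborel. \<bar>ray_slope y\<bar>)"
    using antiderivative_compact_support[OF ray_slope_cont ray_slope_0] by metis
  define CA where "CA = (LINT y|lborel. \<bar>ray_slope y\<bar>)"
  have AC: "\<bar>A x\<bar> \<le> CA" for x using A(2) by (simp add: CA_def)
  have CA0: "CA \<ge> 0" using AC[of 0] by simp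
  have Ac: "continuous_on UNIV A" by (intro continuous_at_imp_continuous_on ballI DERIV_isCont[OF A(1)])
  define A1 where "A1 = (\<lambda>z. A (fst z / max 1 (fst z + snd z)))"
  define A2 where "A2 = (\<lambda>z. A (snd z / max 1 (fst z + snd z)))"
  define M2 where "M2 = (\<lambda>z. flux_weight (snd z, fst z))"
  have A12c: "continuous_on UNIV A1" "continuous_on UNIV A2"
    unfolding A1_def A2_def by (intro continuous_on_compose2[OF Ac] continuous_intros; simp add: max_def)+
  have M2c: "continuous_on UNIV M2" unfolding M2_def by (rule continuous_on_swap[OF flux_weight_cont])
  have cone_swap: "cone_weight (v, u) = cone_weight (u, v)" for u v
    by (simp add: cone_weight_def add.commute mult_ac)
  have dA1: "((\<lambda>u. A1 (u, v)) has_real_derivative - cone_weight (u, v)) (at u)"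
    "((\<lambda>v. A1 (u, v)) has_real_derivative flux_weight (u, v)) (at v)" if "u + v > 1" for u v
    using ray_primitive_has_derivative[OF A(1) that] by (simp_all add: A1_def)
  have dA2: "((\<lambda>u. A2 (u, v)) has_real_derivative M2 (u, v)) (at u)"
    "((\<lambda>v. A2 (u, v)) has_real_derivative - cone_weight (u, v)) (at v)" if "u + v > 1" for u v
    using ray_primitive_has_derivative[OF A(1), of v u] that
    by (simp_all add: A2_def M2_def add.commute cone_swap)
  \<comment> \<open>\<open>CA\<close> bounds the multiplier at the ends of the window, and 40 (P +
    1) dominates the constants of \<open>flank_error_bound\<close>. In \<open>bound\<close>, 4
    estimates the integral of the error profile, 16 contains the further 4 of
    \<open>cone_integral\<close>, and (P - 1) / 2 is the coefficient that the potential
    retains.\<close>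
  define c where "c = CA + 40 * (P + 1)"
  define bound where "bound = c * (4 * energy0 + 16) / ((P - 1) / 2)"
  have "(LINT z|lborel. window T (time_of z) * cone_weight z * pot z) \<le> bound" if T: "T \<ge> 2" for T
  proof -
    define W where "W = (\<lambda>z. window T (time_of z))"
    define W' where "W' = (\<lambda>z. window' T (time_of z))"
    note wb = window_bounds[OF T]
    have Wc: "continuous_on UNIV W" "continuous_on UNIV W'"
      unfolding W_def W'_def
      by (intro continuous_on_compose2[OF window_cont(1)[of UNIV]] continuous_on_compose2[OF window_cont(2)[of UNIV]] continuous_intros subset_UNIV; simp)+
    have W0: "W z = 0 \<and> W' z = 0" if "time_of z \<notin> {1..T + 1}" for z
      using wb(5)[OF that] by (simp add: W_def W'_def)
    have Wb: "\<bar>W z\<bar> \<le> 1" "\<bar>W' z / 2\<bar> \<le> 2" for z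
      using wb(1-4)[of "time_of z"] by (auto simp: W_def W'_def)
    have cw32: "cone_weight z \<le> 32" for z
    proof -
      have "32 / max 1 (fst z + snd z) \<le> 32 / 1" by (intro divide_left_mono) auto
      then show ?thesis using cone_weight_bounds(2)[of z] by linarith
    qed
    have bnds: "\<bar>W z * a\<bar> \<le> 2 * CA + 32" "\<bar>W' z / 2 * a + W z * m\<bar> \<le> 2 * CA + 32"
      if "\<bar>a\<bar> \<le> CA" "\<bar>m\<bar> \<le> 32" for z a m
    proof -
      have "\<bar>W z\<bar> * \<bar>a\<bar> \<le> 1 * CA" "\<bar>W' z / 2\<bar> * \<bar>a\<bar> \<le> 2 * CA" "\<bar>W z\<bar> * \<bar>m\<bar> \<le> 1 * 32"
        using that Wb[of z] by (intro mult_mono; simp)+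
      then have "\<bar>W z * a\<bar> \<le> CA" "\<bar>W' z / 2 * a\<bar> \<le> 2 * CA" "\<bar>W z * m\<bar> \<le> 32" by (simp_all add: abs_mult)
      then show "\<bar>W z * a\<bar> \<le> 2 * CA + 32" "\<bar>W' z / 2 * a + W z * m\<bar> \<le> 2 * CA + 32" using CA0 by linarith+
    qed
    have du: "((\<lambda>u. W (u, v) * f (u, v)) has_real_derivative W' (u, v) / 2 * f (u, v) + W (u, v) * d (u, v)) (at u)"
      if "u + v > 1 \<Longrightarrow> ((\<lambda>u. f (u, v)) has_real_derivative d (u, v)) (at u)" for f d :: "real \<times> real \<Rightarrow> real" and u v
      using window_mult_has_derivative[OF T, where x = u and c = v, OF that] by (simp add: W_def W'_def)
    have dv: "((\<lambda>v. W (u, v) * f (u, v)) has_real_derivative W' (u, v) / 2 * f (u, v) + W (u, v) * d (u, v)) (at v)"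
      if "u + v > 1 \<Longrightarrow> ((\<lambda>v. f (u, v)) has_real_derivative d (u, v)) (at v)" for f d :: "real \<times> real \<Rightarrow> real" and u v
      using window_mult_has_derivative'[OF T, where x = v and c = u, OF that] by (simp add: W_def W'_def)
    define F1 where "F1 = (\<lambda>z. (W' z / 2 * A1 z + W z * flux_weight z) * (p z)\<^sup>2 + (W' z / 2 * A1 z + W z * (- cone_weight z)) * pot z / 2)"
    define F2 where "F2 = (\<lambda>z. (W' z / 2 * A2 z + W z * M2 z) * (q z)\<^sup>2 + (W' z / 2 * A2 z + W z * (- cone_weight z)) * pot z / 2)"
    define F3 where "F3 = (\<lambda>z. (W z * cone_weight z) * (p z * q z - (P + 1) / 4 * pot z)
        + (W' z / 2 * cone_weight z + W z * cone_weight' z) * \<theta> z * p z)"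
    have A12b: "\<bar>A1 z\<bar> \<le> CA" "\<bar>A2 z\<bar> \<le> CA" for z using AC by (auto simp: A1_def A2_def)
    have mb: "\<bar>- cone_weight z\<bar> \<le> 32" "\<bar>flux_weight z\<bar> \<le> 32" "\<bar>M2 z\<bar> \<le> 32" for z
      using cw32[of z] cone_weight_bounds(1)[of z] flux_weight_bounds[of z] flux_weight_bounds[of "(snd z, fst z)"]
      by (auto simp: M2_def)
    have cont: "continuous_on UNIV (\<lambda>z. W z * A1 z)" "continuous_on UNIV (\<lambda>z. W' z / 2 * A1 z + W z * (- cone_weight z))"
      "continuous_on UNIV (\<lambda>z. W' z / 2 * A1 z + W z * flux_weight z)"
      "continuous_on UNIV (\<lambda>z. W z * A2 z)" "continuous_on UNIV (\<lambda>z. W' z / 2 * A2 z + W z * (- cone_weight z))"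
      "continuous_on UNIV (\<lambda>z. W' z / 2 * A2 z + W z * M2 z)"
      "continuous_on UNIV (\<lambda>z. W z * cone_weight z)" "continuous_on UNIV (\<lambda>z. W' z / 2 * cone_weight z + W z * cone_weight' z)"
      using Wc A12c M2c cone_weight_cont flux_weight_cont
      by (auto intro!: continuous_on_add continuous_on_diff continuous_on_mult continuous_on_divide)
    have supp0: "W z * a = 0 \<and> W' z / 2 * a + W z * m = 0 \<and> W' z / 2 * a + W z * m' = 0"
      if "time_of z \<notin> {1..T + 1}" for z a m m'
      using W0[OF that] by simp
    have F1: "integrable lborel F1" "(LINT z|lborel. F1 z) = 0"
      unfolding F1_def
      by (rule energy_multiplier[OF cont(1,2,3) du[where f = A1 and d = "\<lambda>z. - cone_weight z", OF dA1(1)] dv[where f = A1 and d = flux_weight, OF dA1(2)] supp0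
          bnds(1)[OF A12b(1) mb(1)] bnds(2)[OF A12b(1) mb(1)] bnds(2)[OF A12b(1) mb(2)]]; assumption)+
    have F2: "integrable lborel F2" "(LINT z|lborel. F2 z) = 0"
      unfolding F2_def
      by (rule energy_multiplier'[OF cont(4,6,5) du[where f = A2 and d = M2, OF dA2(1)] dv[where f = A2 and d = "\<lambda>z. - cone_weight z", OF dA2(2)] supp0
          bnds(1)[OF A12b(2) mb(1)] bnds(2)[OF A12b(2) mb(3)] bnds(2)[OF A12b(2) mb(1)]]; assumption)+
    \<comment> \<open>Inside the cone a bound on t bounds u and v, so the weight has compact support
      and the Lagrangian identity applies without a cutoff in space.\<close>
    have supp: "W z * cone_weight z = 0 \<and> W' z / 2 * cone_weight z + W z * cone_weight' z = 0"
      if z: "z \<notin> cbox (- (2 * T + 2), - (2 * T + 2)) (2 * T + 2, 2 * T + 2)" for z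
    proof (cases "fst z \<le> 0 \<or> snd z \<le> 0")
      case False
      have "time_of z \<notin> {1..T + 1}"
      proof
        assume *: "time_of z \<in> {1..T + 1}"
        have "fst z \<le> 2 * T + 2" "snd z \<le> 2 * T + 2" "fst z \<ge> - (2 * T + 2)" "snd z \<ge> - (2 * T + 2)"
          using * False T by auto
        then show False using z by (cases z) (auto simp: cbox_Pair_eq cbox_interval)
      qed
      then show ?thesis using W0 by simp
    qed (use cone_weight_0 in auto)
    have F3: "integrable lborel F3" "(LINT z|lborel. F3 z) = 0"
      unfolding F3_def
      by (rule lagrangian_multiplier[OF cont(7,8) dv[where f = cone_weight and d = cone_weight', OF cone_weight_has_derivative] supp]; assumption)+
    let ?cn = "\<lambda>z :: real \<times> real. if fst z \<ge> 0 \<and> snd z \<ge> 0 then 1 / max 1 (time_of z) else 0 :: real"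
    \<comment> \<open>One profile for all errors: the ends of the window and the rate t^(-3/2) in
      between, each of integral at most 2.\<close>
    define \<omega> where "\<omega> = (\<lambda>t. flanks T t + window T t * decay_rate t)"
    have \<omega>c: "continuous_on UNIV \<omega>" unfolding \<omega>_def by (intro continuous_intros window_cont decay_rate_cont)
    have \<omega>0: "\<omega> t = 0" if "t \<notin> {1..T + 1}" for t using wb(5)[OF that] by (simp add: \<omega>_def)
    note E = energy_time_average[OF \<omega>c \<omega>0] cone_integral[OF \<omega>c \<omega>0]
    have \<omega>4: "(LINT t|lborel. \<omega> t) \<le> 4"
      using flanks_integral[of T] window_decay_integral[OF T] by (simp add: \<omega>_def)
    have c0: "c \<ge> 0" using CA0 P by (simp add: c_def)
    have "(LINT z|lborel. (P - 1) / 2 * (window T (time_of z) * cone_weight z * pot z))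
        \<le> (LINT z|lborel. F1 z + F2 z - 2 * F3 z + c * (\<omega> (time_of z) * dens z + \<omega> (time_of z) * ?cn z))"
    proof (rule integral_mono)
      show "integrable lborel (\<lambda>z. (P - 1) / 2 * (window T (time_of z) * cone_weight z * pot z))"
        using window_cone_integrable[OF T] by (rule integrable_mult_right)
      show "integrable lborel (\<lambda>z. F1 z + F2 z - 2 * F3 z + c * (\<omega> (time_of z) * dens z + \<omega> (time_of z) * ?cn z))"
        using F1 F2 F3 E by (intro Bochner_Integration.integrable_add Bochner_Integration.integrable_diff integrable_mult_right)
      fix z
      define Q where "Q = W' z / 2 * (A1 z * ((p z)\<^sup>2 + pot z / 2) + A2 z * ((q z)\<^sup>2 + pot z / 2))"
      \<comment> \<open>The potential enters with -1 from the two energy identities and with (P + 1)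
        / 2 from the Lagrangian one, which leaves (P - 1) / 2. \<open>Q\<close> collects the terms
        in which the time cutoff is differentiated.\<close>
      have id: "(P - 1) / 2 * (W z * cone_weight z * pot z) = F1 z + F2 z - 2 * F3 z - Q
          - W z * (flux_weight z * (p z)\<^sup>2 + M2 z * (q z)\<^sup>2 - 2 * cone_weight z * (p z * q z))
          + W' z * cone_weight z * \<theta> z * p z + 2 * W z * cone_weight' z * \<theta> z * p z"
        unfolding F1_def F2_def F3_def Q_def by (simp add: field_simps)
      have sq: "W z * (flux_weight z * (p z)\<^sup>2 + M2 z * (q z)\<^sup>2 - 2 * cone_weight z * (p z * q z)) \<ge> 0"
        using multiplier_form_nonneg[of "fst z" "snd z" "p z" "q z"] wb(1)
        by (intro mult_nonneg_nonneg) (auto simp: W_def M2_def)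
      have QB: "\<bar>Q\<bar> \<le> CA * (flanks T (time_of z) * dens z)"
      proof -
        have "\<bar>A1 z * ((p z)\<^sup>2 + pot z / 2)\<bar> \<le> CA * ((p z)\<^sup>2 + pot z / 2)"
          "\<bar>A2 z * ((q z)\<^sup>2 + pot z / 2)\<bar> \<le> CA * ((q z)\<^sup>2 + pot z / 2)"
          unfolding abs_mult
          by (rule mult_mono[OF A12b(1)] mult_mono[OF A12b(2)]; simp add: CA0 abs_of_nonneg)+
        moreover have "CA * ((p z)\<^sup>2 + pot z / 2) + CA * ((q z)\<^sup>2 + pot z / 2) = CA * dens z"
          by (simp add: dens_def field_simps)
        ultimately have s: "\<bar>A1 z * ((p z)\<^sup>2 + pot z / 2) + A2 z * ((q z)\<^sup>2 + pot z / 2)\<bar> \<le> CA * dens z"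
          by linarith
        have "\<bar>W' z / 2\<bar> \<le> flanks T (time_of z)"
          using wb(3)[of "time_of z"] flanks_nonneg[of T "time_of z"] unfolding W'_def by linarith
        then have "\<bar>Q\<bar> \<le> flanks T (time_of z) * (CA * dens z)"
          unfolding Q_def abs_mult[of "W' z / 2"] using s by (intro mult_mono) (auto intro: order_trans[OF abs_ge_zero])
        then show ?thesis by (simp add: mult_ac)
      qed
      note err = flank_error_bound[OF T, of z]
      define f where "f = flanks T (time_of z)"
      define r where "r = W z * decay_rate (time_of z)"
      have fr: "f \<ge> 0" "r \<ge> 0" "\<omega> (time_of z) = f + r"
        using flanks_nonneg wb(1) decay_rate_nonneg by (auto simp: f_def r_def \<omega>_def W_def)
      have cn0: "?cn z \<ge> 0" by (simp add: le_max_iff_disj)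
      have D0: "dens z \<ge> 0" by (rule dens_bounds(1))
      have sum: "CA * (f * dens z) + f * (8 * ?cn z + 8 * (P + 1) * dens z) + r * (40 * ?cn z + 40 * (P + 1) * dens z)
          \<le> c * ((f + r) * dens z + (f + r) * ?cn z)"
      proof -
        have a: "CA + 8 * (P + 1) \<le> c" "8 \<le> c" "40 \<le> c" "40 * (P + 1) \<le> c" using P CA0 by (auto simp: c_def)
        define k where "k = ?cn z"
        have "(CA + 8 * (P + 1)) * (f * dens z) \<le> c * (f * dens z)" "8 * (f * k) \<le> c * (f * k)"
          "40 * (r * k) \<le> c * (r * k)" "40 * (P + 1) * (r * dens z) \<le> c * (r * dens z)"
          using a[THEN mult_right_mono] fr(1,2) cn0 D0 by (simp_all only: k_def mult_nonneg_nonneg)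
        then show ?thesis unfolding k_def[symmetric] by (simp add: algebra_simps)
      qed
      show "(P - 1) / 2 * (window T (time_of z) * cone_weight z * pot z)
          \<le> F1 z + F2 z - 2 * F3 z + c * (\<omega> (time_of z) * dens z + \<omega> (time_of z) * ?cn z)"
        using id sq QB err sum
        unfolding fr(3) f_def[symmetric] W_def[unfolded fun_eq_iff, rule_format, symmetric]
          W'_def[unfolded fun_eq_iff, rule_format, symmetric] r_def[symmetric]
        by linarith
    qed
    also have "\<dots> = c * (energy0 * (LINT t|lborel. \<omega> t) + 4 * (LINT t|lborel. \<omega> t))"
      using F1 F2 F3 E by simp
    also have "\<dots> \<le> c * (energy0 * 4 + 4 * 4)"
      using c0 \<omega>4 energy0_nonneg by (intro mult_left_mono add_mono) auto
    finally have "(P - 1) / 2 * (LINT z|lborel. window T (time_of z) * cone_weight z * pot z) \<le> c * (4 * energy0 + 16)"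
      by (simp add: mult.commute)
    then show ?thesis unfolding bound_def using P by (simp add: field_simps)
  qed
  then show ?thesis by blast
qed

text \<open>The bound is uniform in \<open>T\<close>, so monotone convergence along T = 2 + n
  exhausts all times after 2.\<close>

lemma cone_potential_integrable:
  "integrable lborel (\<lambda>z. indicator {2..} (time_of z) * (cone_weight z * pot z))"
proof -
  obtain C where C: "\<And>T. T \<ge> 2 \<Longrightarrow> (LINT z|lborel. window T (time_of z) * cone_weight z * pot z) \<le> C"
    using weighted_potential_bounded by blast
  define f where "f = (\<lambda>(n::nat) z. indicator {2..2 + real n} (time_of z) * (cone_weight z * pot z))"
  have [measurable]: "cone_weight \<in> borel_measurable borel"
    by (rule borel_measurable_continuous_onI[OF cone_weight_cont(1)])
  have nn: "cone_weight z * pot z \<ge> 0" for z using cone_weight_bounds(1)[of z] by simp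
  have le: "f n z \<le> window (2 + real n) (time_of z) * cone_weight z * pot z" for n z
  proof -
    have "indicator {2..2 + real n} (time_of z) \<le> window (2 + real n) (time_of z)"
      using window_bounds(1,6)[of "2 + real n" "time_of z"] by (auto simp: indicator_def)
    from mult_right_mono[OF this nn[of z]] show ?thesis by (simp add: f_def mult.assoc)
  qed
  have f0: "f n z \<ge> 0" for n z using nn[of z] by (simp add: f_def)
  have fi: "integrable lborel (f n)" for n
  proof (rule Bochner_Integration.integrable_bound[OF window_cone_integrable[of "2 + real n"]])
    show "f n \<in> borel_measurable lborel" unfolding f_def by measurable
    show "AE z in lborel. norm (f n z) \<le> norm (window (2 + real n) (time_of z) * cone_weight z * pot z)"
      using le f0 by (intro AE_I2) (auto intro: order_trans[OF _ abs_ge_self])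
  qed simp
  have fC: "(LINT z|lborel. f n z) \<le> C" for n
    using integral_mono[OF fi window_cone_integrable[of "2 + real n"] le] C[of "2 + real n"] by simp
  have mono: "f m z \<le> f n z" if "m \<le> n" for m n z
    unfolding f_def using that nn[of z] by (intro mult_right_mono) (auto simp: indicator_def)
  have "incseq (\<lambda>n. LINT z|lborel. f n z)"
    unfolding incseq_def using integral_mono[OF fi fi mono] by blast
  then obtain L where L: "(\<lambda>n. LINT z|lborel. f n z) \<longlonglongrightarrow> L"
    using incseq_convergent[of "\<lambda>n. LINT z|lborel. f n z" C] fC by blast
  show ?thesis
  proof (rule integrable_monotone_convergence[OF fi _ _ L])
    show "AE z in lborel. mono (\<lambda>n. f n z)" using mono by (intro AE_I2 monoI)
    show "AE z in lborel. (\<lambda>n. f n z) \<longlonglongrightarrow> indicator {2..} (time_of z) * (cone_weight z * pot z)"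
    proof (rule AE_I2)
      fix z
      obtain N where N: "time_of z \<le> 2 + real N" using real_arch_simple[of "time_of z"] by (meson add_increasing le_numeral_extra zero_le_numeral)
      have "\<forall>n\<ge>N. indicator {2..} (time_of z) * (cone_weight z * pot z) = f n z"
        using N by (auto simp: f_def indicator_def)
      then have "\<forall>\<^sub>F n in sequentially. indicator {2..} (time_of z) * (cone_weight z * pot z) = f n z"
        using eventually_sequentially by blast
      then show "(\<lambda>n. f n z) \<longlonglongrightarrow> indicator {2..} (time_of z) * (cone_weight z * pot z)"
        by (rule Lim_transform_eventually[OF tendsto_const])
    qed
    show "(\<lambda>z. indicator {2..} (time_of z) * (cone_weight z * pot z)) \<in> borel_measurable lborel" by measurable
  qed
qed

end

section \<open>Decay of the potential energy\<close>

context null_wave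
begin

text \<open>The region \<bar>x\<bar> <= t + R is the quadrant u >= -R, v >= -R in null
  coordinates.\<close>

definition cone_potential :: "real \<Rightarrow> real \<Rightarrow> real" where
  "cone_potential R T = (LINT z|lborel. indicator {0..T} (time_of z) * indicator {- R..} (fst z) * indicator {- R..} (snd z) * pot z)"

text \<open>The numerator is at least 32 (\<delta> T)^4, while u + v <= 2 T makes the denominator at
  most 32 T^5.\<close>

lemma cone_weight_lower_bound:
  assumes "\<delta> > 0" "T > 0" "fst z \<ge> \<delta> * T" "snd z \<ge> \<delta> * T" "2 \<le> time_of z" "time_of z \<le> T"
  shows "\<delta> ^ 4 / T \<le> cone_weight z"
proof -
  define s where "s = fst z + snd z"
  have s: "1 \<le> s" "s \<le> 2 * T" using assms by (auto simp: s_def)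
  have dT: "\<delta> * T > 0" using assms by simp
  have "(\<delta> * T)\<^sup>2 * (\<delta> * T)\<^sup>2 \<le> (fst z)\<^sup>2 * (snd z)\<^sup>2"
    using assms dT by (intro mult_mono power_mono) auto
  moreover have "s ^ 5 \<le> (2 * T) ^ 5" using s by (intro power_mono) auto
  ultimately have "32 * ((\<delta> * T)\<^sup>2 * (\<delta> * T)\<^sup>2) / (2 * T) ^ 5 \<le> 32 * ((fst z)\<^sup>2 * (snd z)\<^sup>2) / s ^ 5"
    using s by (intro frac_le) auto
  moreover have "32 * ((\<delta> * T)\<^sup>2 * (\<delta> * T)\<^sup>2) / (2 * T) ^ 5 = \<delta> ^ 4 / T"
    using assms by (simp add: field_simps eval_nat_numeral)
  moreover have "cone_weight z = 32 * ((fst z)\<^sup>2 * (snd z)\<^sup>2) / s ^ 5"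
  proof -
    have "max 0 (fst z) = fst z" "max 0 (snd z) = snd z" using assms(3,4) dT by auto
    then show ?thesis using s by (simp add: cone_weight_def flip: s_def)
  qed
  ultimately show ?thesis by simp
qed

lemma cone_potential_integrable':
  "integrable lborel (\<lambda>z. indicator {0..T} (time_of z) * indicator {- R..} (fst z) * indicator {- R..} (snd z) * pot z)"
  by (rule slab_mult_dens[where C = 1 and a = 0 and b = "2 * T"]) (use dens_bounds in \<open>auto simp: indicator_def\<close>)

lemma cone_potential_nonneg: "cone_potential R T \<ge> 0"
  unfolding cone_potential_def by (intro integral_nonneg_AE AE_I2) simp

text \<open>The reflected solution brings its own \<open>energy0\<close>; \<open>E\<close> adds the
  two constants so that both families of strips obey one bound.\<close>

lemma strip_flux_both:
  obtains E where "E \<ge> 0" "\<And>T R L. T \<ge> 2 \<Longrightarrow> R + L \<ge> 0 \<Longrightarrow>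
    (LINT z|lborel. indicator {2..T} (time_of z) * indicator {- R..L} (fst z) * pot z)
    + (LINT z|lborel. indicator {2..T} (time_of z) * indicator {- R..L} (snd z) * pot z) \<le> (L + R + 2) * E"
proof -
  interpret sw: null_wave P "\<lambda>z. \<theta> (snd z, fst z)" "\<lambda>z. q (snd z, fst z)" "\<lambda>z. p (snd z, fst z)"
    by (rule null_wave_swap)
  have s: "(LINT z|lborel. indicator {2..T} (time_of z) * indicator {- R..L} (snd z) * pot z) \<le> 2 * (L + R + 2) * sw.energy0"
    if "T \<ge> 2" "R + L \<ge> 0" for T R L
  proof -
    have i: "integrable lborel (\<lambda>z. indicator {2..T} (time_of z) * indicator {- R..L} (snd z) * pot z)"
      by (rule slab_mult_dens[where C = 1 and a = 4 and b = "2 * T"]) (use dens_bounds in \<open>auto simp: indicator_def\<close>)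
    show ?thesis using plane_swap(2)[OF i] sw.strip_flux[OF that] by (simp add: add.commute)
  qed
  show ?thesis
  proof (rule that[of "2 * energy0 + 2 * sw.energy0"])
    show "0 \<le> 2 * energy0 + 2 * sw.energy0" using energy0_nonneg sw.energy0_nonneg by simp
    fix T R L :: real assume TRL: "T \<ge> 2" "R + L \<ge> 0"
    have "2 * (L + R + 2) * energy0 + 2 * (L + R + 2) * sw.energy0 = (L + R + 2) * (2 * energy0 + 2 * sw.energy0)"
      by (simp add: algebra_simps)
    then show "(LINT z|lborel. indicator {2..T} (time_of z) * indicator {- R..L} (fst z) * pot z)
        + (LINT z|lborel. indicator {2..T} (time_of z) * indicator {- R..L} (snd z) * pot z)
        \<le> (L + R + 2) * (2 * energy0 + 2 * sw.energy0)"
      using strip_flux[OF TRL] s[OF TRL] by linarith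
  qed
qed

text \<open>After division by \<open>T\<close> the strips contribute about \<delta> E, and the
  interior contributes the tail of a convergent integral divided by \<delta>^4. As \<delta> is fixed
  before \<open>T\<close> grows, that power of \<delta> is harmless.\<close>

lemma cone_potential_sublinear: "((\<lambda>T. cone_potential R T / T) \<longlongrightarrow> 0) at_top"
proof -
  obtain E where E: "E \<ge> 0" and flux: "\<And>T R L. T \<ge> 2 \<Longrightarrow> R + L \<ge> 0 \<Longrightarrow>
    (LINT z|lborel. indicator {2..T} (time_of z) * indicator {- R..L} (fst z) * pot z)
    + (LINT z|lborel. indicator {2..T} (time_of z) * indicator {- R..L} (snd z) * pot z) \<le> (L + R + 2) * E"
    using strip_flux_both by blast
  have cwm [measurable]: "cone_weight \<in> borel_measurable borel"
    by (rule borel_measurable_continuous_onI[OF cone_weight_cont(1)])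
  \<comment> \<open>A lower bound on u alone suffices: for fixed \<delta> > 0 the region u >
    \<delta> T loses every point as \<open>T\<close> grows, so the integral tends to 0 by dominated
    convergence.\<close>
  define tail where "tail = (\<lambda>\<delta> T. LINT z|lborel. indicator {\<delta> * T<..} (fst z) * (indicator {2..} (time_of z) * (cone_weight z * pot z)))"
  have nnK: "indicator {2..} (time_of z) * (cone_weight z * pot z) \<ge> 0" for z
    using cone_weight_bounds(1)[of z] by simp
  have tail_int: "integrable lborel (\<lambda>z. indicator {c<..} (fst z) * (indicator {2..} (time_of z) * (cone_weight z * pot z)))" for c
  proof (rule Bochner_Integration.integrable_bound[OF cone_potential_integrable])
    show "(\<lambda>z. indicator {c<..} (fst z) * (indicator {2..} (time_of z) * (cone_weight z * pot z))) \<in> borel_measurable lborel"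
      by measurable
  qed (auto simp: indicator_def)
  have tail0: "(tail \<delta> \<longlongrightarrow> 0) at_top" if \<delta>: "\<delta> > 0" for \<delta>
  proof -
    have "((\<lambda>T. LINT z|lborel. indicator {\<delta> * T<..} (fst z) * (indicator {2..} (time_of z) * (cone_weight z * pot z)))
        \<longlongrightarrow> (LINT z::real \<times> real|lborel. 0)) at_top"
    proof (rule integral_dominated_convergence_at_top[OF _ _ cone_potential_integrable])
      show "\<forall>\<^sub>F T in at_top. AE z in lborel. norm (indicator {\<delta> * T<..} (fst z) * (indicator {2..} (time_of z) * (cone_weight z * pot z)))
          \<le> indicator {2..} (time_of z) * (cone_weight z * pot z)"
        using cone_weight_bounds(1) by (intro always_eventually allI AE_I2) (auto simp: indicator_def abs_mult)
      show "AE z in lborel. ((\<lambda>T. indicator {\<delta> * T<..} (fst z) * (indicator {2..} (time_of z) * (cone_weight z * pot z))) \<longlongrightarrow> 0) at_top"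
      proof (rule AE_I2)
        fix z :: "real \<times> real"
        have "\<forall>\<^sub>F T in at_top. 0 = indicator {\<delta> * T<..} (fst z) * (indicator {2..} (time_of z) * (cone_weight z * pot z))"
        proof (rule eventually_mono[OF eventually_ge_at_top[of "fst z / \<delta>"]])
          fix T assume "fst z / \<delta> \<le> T"
          then have "fst z \<le> \<delta> * T" using \<delta> by (simp add: field_simps)
          then show "0 = indicator {\<delta> * T<..} (fst z) * (indicator {2..} (time_of z) * (cone_weight z * pot z))" by simp
        qed
        then show "((\<lambda>T. indicator {\<delta> * T<..} (fst z) * (indicator {2..} (time_of z) * (cone_weight z * pot z))) \<longlongrightarrow> 0) at_top"
          by (rule Lim_transform_eventually[OF tendsto_const])
      qed
    qed measurable
    then show ?thesis by (simp add: tail_def[abs_def])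
  qed
  have bound: "cone_potential R T \<le> cone_potential R 2 + (\<delta> * T + \<bar>R\<bar> + 2) * E + T / \<delta> ^ 4 * tail \<delta> T"
    if \<delta>: "\<delta> > 0" and T: "T \<ge> 2" for \<delta> T
  proof -
    let ?c = "\<lambda>T z. indicator {0..T} (time_of z) * indicator {- R..} (fst z) * indicator {- R..} (snd z) * pot z"
    \<comment> \<open>The absolute value of \<open>R\<close> ensures that the strip is nonempty for
      either sign of \<open>R\<close>.\<close>
    let ?s1 = "\<lambda>z. indicator {2..T} (time_of z) * indicator {- \<bar>R\<bar>..\<delta> * T} (fst z) * pot z"
    let ?s2 = "\<lambda>z. indicator {2..T} (time_of z) * indicator {- \<bar>R\<bar>..\<delta> * T} (snd z) * pot z"
    let ?r = "\<lambda>z. T / \<delta> ^ 4 * (indicator {\<delta> * T<..} (fst z) * (indicator {2..} (time_of z) * (cone_weight z * pot z)))"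
    have iS: "integrable lborel ?s1" "integrable lborel ?s2"
      by (rule slab_mult_dens[where C = 1 and a = 4 and b = "2 * T"]; use dens_bounds in \<open>auto simp: indicator_def\<close>)+
    have "cone_potential R T \<le> (LINT z|lborel. ?c 2 z + (?s1 z + ?s2 z) + ?r z)"
      unfolding cone_potential_def
    proof (rule integral_mono)
      show "integrable lborel (\<lambda>z. ?c 2 z + (?s1 z + ?s2 z) + ?r z)"
        by (intro Bochner_Integration.integrable_add cone_potential_integrable' iS integrable_mult_right tail_int)
      fix z
      have nn: "?c 2 z \<ge> 0" "?s1 z \<ge> 0" "?s2 z \<ge> 0" by simp_all
      have nr: "?r z \<ge> 0" using \<delta> T nnK[of z] by simp
      show "?c T z \<le> ?c 2 z + (?s1 z + ?s2 z) + ?r z"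
      proof (cases "time_of z \<in> {0..T} \<and> fst z \<ge> - R \<and> snd z \<ge> - R")
        case False
        then have "?c T z = 0" by (auto simp: indicator_def)
        then show ?thesis using nn nr by linarith
      next
        case True
        then have c: "?c T z = pot z" by simp
        consider "time_of z \<le> 2" | "time_of z > 2" "fst z \<le> \<delta> * T" | "time_of z > 2" "snd z \<le> \<delta> * T"
          | "time_of z > 2" "fst z > \<delta> * T" "snd z > \<delta> * T" by linarith
        then show ?thesis
        proof cases
          case 1
          then have "?c 2 z = pot z" using True by simp
          then show ?thesis using c nn nr by linarith
        next
          case 2
          then have "fst z \<in> {- \<bar>R\<bar>..\<delta> * T}" using True by auto
          then have "?s1 z = pot z" using True 2 by simp
          then show ?thesis using c nn nr by linarith
        next
          case 3
          then have "snd z \<in> {- \<bar>R\<bar>..\<delta> * T}" using True by auto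
          then have "?s2 z = pot z" using True 3 by simp
          then show ?thesis using c nn nr by linarith
        next
          case 4
          have "\<delta> ^ 4 / T \<le> cone_weight z"
            by (rule cone_weight_lower_bound) (use \<delta> T True 4 in auto)
          then have "T / \<delta> ^ 4 * (\<delta> ^ 4 / T) \<le> T / \<delta> ^ 4 * cone_weight z" using \<delta> T by (intro mult_left_mono) auto
          then have "1 \<le> T / \<delta> ^ 4 * cone_weight z" using \<delta> T by simp
          from mult_right_mono[OF this pot_nonneg[of z]] have "pot z \<le> ?r z" using 4 by (simp add: mult.assoc)
          then show ?thesis using c nn by linarith
        qed
      qed
    qed (rule cone_potential_integrable')
    also have "\<dots> = cone_potential R 2 + ((LINT z|lborel. ?s1 z) + (LINT z|lborel. ?s2 z)) + T / \<delta> ^ 4 * tail \<delta> T"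
      unfolding cone_potential_def tail_def
      using cone_potential_integrable'[of 2 R] iS integrable_mult_right[OF tail_int, of "T / \<delta> ^ 4" "\<delta> * T"] by simp
    also have "\<dots> \<le> cone_potential R 2 + (\<delta> * T + \<bar>R\<bar> + 2) * E + T / \<delta> ^ 4 * tail \<delta> T"
      using flux[OF T, of "\<bar>R\<bar>" "\<delta> * T"] \<delta> T by simp
    finally show ?thesis .
  qed
  show ?thesis
  proof (rule order_tendstoI)
    fix e :: real assume "e < 0"
    then show "\<forall>\<^sub>F T in at_top. e < cone_potential R T / T"
      by (intro eventually_mono[OF eventually_gt_at_top[of 0]] less_le_trans[OF _ divide_nonneg_pos[OF cone_potential_nonneg]])
  next
    fix e :: real assume e: "e > 0"
    \<comment> \<open>Chosen so that \<delta> E < e, with E + 1 in the denominator to admit E = 0;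
      the other terms vanish in the limit.\<close>
    define \<delta> where "\<delta> = e / (2 * (E + 1))"
    have \<delta>: "\<delta> > 0" using e E by (simp add: \<delta>_def)
    have \<delta>E: "\<delta> * E < e"
    proof -
      have "e * E < e * (2 * (E + 1))" using e E by (intro mult_strict_left_mono) auto
      then show ?thesis using E by (simp add: \<delta>_def field_simps)
    qed
    have "((\<lambda>T. (cone_potential R 2 + (\<bar>R\<bar> + 2) * E) / T + \<delta> * E + tail \<delta> T / \<delta> ^ 4) \<longlongrightarrow> 0 + \<delta> * E + 0 / \<delta> ^ 4) at_top"
      using \<delta> by (intro tendsto_intros tail0 tendsto_divide_0[OF tendsto_const filterlim_at_top_imp_at_infinity[OF filterlim_ident]]) auto
    then have "\<forall>\<^sub>F T in at_top. (cone_potential R 2 + (\<bar>R\<bar> + 2) * E) / T + \<delta> * E + tail \<delta> T / \<delta> ^ 4 < e"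
      by (rule order_tendstoD(2)) (use \<delta>E in simp)
    then show "\<forall>\<^sub>F T in at_top. cone_potential R T / T < e"
      using eventually_ge_at_top[of 2]
    proof eventually_elim
      case (elim T)
      have "cone_potential R T / T \<le> (cone_potential R 2 + (\<delta> * T + \<bar>R\<bar> + 2) * E + T / \<delta> ^ 4 * tail \<delta> T) / T"
        using bound[OF \<delta>, of T] elim by (intro divide_right_mono) auto
      also have "\<dots> = (cone_potential R 2 + (\<bar>R\<bar> + 2) * E) / T + \<delta> * E + tail \<delta> T / \<delta> ^ 4"
        using elim \<delta> by (simp add: field_simps)
      finally show ?case using elim by linarith
    qed
  qed
qed

end

theorem proposition3p2:
  fixes p R :: real and \<phi> :: "real \<times> real \<Rightarrow> real" and \<phi>0 \<phi>1 :: "real \<Rightarrow> real"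
  assumes "p > 1"
    and "finite_energy_solution p \<phi> \<phi>0 \<phi>1"
    and "R > 0"
  shows "((\<lambda>T. 1 / T * (LINT t:{0..T}|lborel. LINT x:{x. \<bar>x\<bar> \<le> t + R}|lborel.
             \<bar>\<phi> (t, x)\<bar> powr (p + 1))) \<longlongrightarrow> 0) at_top"
proof -
  obtain r s where nw: "null_wave p (\<lambda>z. \<phi> (null_map z)) r s"
    using finite_energy_solution_null_wave[OF assms(2,1)] by blast
  interpret null_wave p "\<lambda>z. \<phi> (null_map z)" r s by (rule nw)
  have \<phi>: "continuous_on UNIV \<phi>" using assms(2) by (simp add: finite_energy_solution_def)
  have fc: "continuous_on UNIV (\<lambda>z. \<bar>\<phi> z\<bar> powr (p + 1))"
    using assms(1) by (intro continuous_on_powr_abs \<phi>) auto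
  \<comment> \<open>The factor p + 1 undoes the normalisation of the potential, and 1/2 is the
    Jacobian of the null coordinates.\<close>
  have eq: "(LINT t:{0..T}|lborel. LINT x:{x. \<bar>x\<bar> \<le> t + R}|lborel. \<bar>\<phi> (t, x)\<bar> powr (p + 1))
      = (p + 1) / 2 * cone_potential R T" for T
  proof -
    define D where "D = {z :: real \<times> real. 0 \<le> fst z \<and> fst z \<le> T \<and> \<bar>snd z\<bar> \<le> fst z + R}"
    define f where "f = (\<lambda>z. indicator D z * \<bar>\<phi> z\<bar> powr (p + 1))"
    have "closed D" unfolding D_def by (intro closed_Collect_conj closed_Collect_le continuous_intros)
    moreover have "D \<subseteq> cbox (0, - (T + R)) (T, T + R)"
      by (auto simp: D_def cbox_Pair_eq cbox_interval)
    ultimately have "compact D" using compact_eq_bounded_closed bounded_subset[OF bounded_cbox] by blast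
    then have fi: "integrable lborel f"
      using borel_integrable_compact[of D "\<lambda>z. \<bar>\<phi> z\<bar> powr (p + 1)"] continuous_on_subset[OF fc] by (simp add: f_def)
    have "(LINT t:{0..T}|lborel. LINT x:{x. \<bar>x\<bar> \<le> t + R}|lborel. \<bar>\<phi> (t, x)\<bar> powr (p + 1))
        = (LINT t|lborel. LINT x|lborel. f (t, x))"
      unfolding set_lebesgue_integral_def
    proof (rule Bochner_Integration.integral_cong)
      fix t
      show "indicator {0..T} t *\<^sub>R (LINT x|lborel. indicator {x. \<bar>x\<bar> \<le> t + R} x *\<^sub>R \<bar>\<phi> (t, x)\<bar> powr (p + 1)) = (LINT x|lborel. f (t, x))"
      proof (cases "t \<in> {0..T}")
        case True
        then show ?thesis
          by (auto simp: f_def D_def indicator_def intro!: Bochner_Integration.integral_cong)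
      next
        case False
        then show ?thesis by (auto simp: f_def D_def)
      qed
    qed simp
    also have "\<dots> = (LINT z|lborel. f z)" by (rule plane_integral_fst(1)[OF fi])
    also have "\<dots> = (LINT z|lborel. f (null_map z)) / 2"
      by (rule integral_null_map) (use borel_measurable_integrable[OF fi] in simp)
    also have "(\<lambda>z. f (null_map z)) = (\<lambda>z. (p + 1) * (indicator {0..T} (time_of z) * indicator {- R..} (fst z) * indicator {- R..} (snd z) * pot z))"
    proof (rule ext)
      fix z
      \<comment> \<open>The two signs of x turn the one condition \<bar>x\<bar> <= t + R into one
        lower bound for each null coordinate.\<close>
      have "\<bar>(snd z - fst z) / 2\<bar> \<le> time_of z + R \<longleftrightarrow> fst z \<ge> - R \<and> snd z \<ge> - R"
        by (auto simp: abs_le_iff field_simps)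
      then have "indicator D (null_map z) = indicator {0..T} (time_of z) * indicator {- R..} (fst z) * (indicator {- R..} (snd z) :: real)"
        by (auto simp: D_def indicator_def)
      then show "f (null_map z) = (p + 1) * (indicator {0..T} (time_of z) * indicator {- R..} (fst z) * indicator {- R..} (snd z) * pot z)"
        unfolding f_def powr_\<theta> by (simp add: mult_ac)
    qed
    finally show ?thesis by (simp add: cone_potential_def)
  qed
  have "((\<lambda>T. (p + 1) / 2 * (cone_potential R T / T)) \<longlongrightarrow> (p + 1) / 2 * 0) at_top"
    by (intro tendsto_mult tendsto_const cone_potential_sublinear)
  then show ?thesis unfolding eq by (simp add: mult_ac)
qed

end
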